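(* Let $(p_n)_{n\ge 0}$ be a sequence of distinct prime numbers and let $G$ be the countable group constructed from $(p_n)_{n \geq 0}$ as described in the context (the increasing union of the iterated amalgamated free products $G_{N+1} = G_N *_{K_N} (K_N \times \mathbb{Z})$ starting from $G_0 = K \rtimes \mathrm{SL}(3,\mathbb{Z})$). Then $G$ is inner amenable and has infinite conjugacy classes, while the II$_1$ factor $\mathrm{L}G$ does not have property Gamma.
   Context: Construction of $G$. Fix a sequence $(p_n)_{n\ge 0}$ of distinct prime numbers. For $n \geq 0$ put $H_n := (\mathbb{Z}/p_n\mathbb{Z})^3$, and put $K := \bigoplus_{n=0}^\infty H_n$. Let $\Lambda = \mathrm{SL}(3,\mathbb{Z})$, acting on each $H_n$ by automorphisms in the natural way (matrix multiplication modulo $p_n$), denoted $g\cdot x$, and acting on $K$ diagonally: $(g\cdot x)_n = g\cdot x_n$ for all $g \in \Lambda$, $x \in K$, $n \geq 0$. For $N \geq 0$ put $K_N := \bigoplus_{n=N}^\infty H_n < K$. Put $G_0 := K \rtimes \Lambda$ and inductively define the amalgamated free product $$G_N \hookrightarrow G_{N+1} := G_N *_{K_N} (K_N \times \mathbb{Z}),$$ where $K_N$ is viewed as a subgroup of $G_N$ via $K_N < K < G_0 < G_N$, and as the subgroup $K_N \times \{0\}$ of $K_N \times \mathbb{Z}$. Let $G$ be the inductive limit (increasing union) of $G_0 \subset G_1 \subset G_2 \subset \cdots$. Definitions. A countable group $G$ is inner amenable if there exists a finitely additive measure $m$ on the subsets of $G\setminus\{e\}$, of total mass $1$, with $m(gXg^{-1})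 = m(X)$ for all $X \subset G \setminus\{e\}$ and all $g \in G$. A group $G$ has infinite conjugacy classes (icc) if the conjugacy class of every $g \in G\setminus\{e\}$ is infinite. $\mathrm{L}G$ denotes the group von Neumann algebra of $G$, i.e. the von Neumann algebra on $\ell^2(G)$ generated by the left translation unitaries $(u_g)_{g\in G}$, with trace $\tau(x) = \langle \delta_e, x\delta_e\rangle$. A II$_1$ factor $M$ with trace $\tau$ has property Gamma if there exists a sequence of unitaries $x_n \in M$ with $\tau(x_n) = 0$ for all $n$ and $\|x_n y - y x_n\|_2 \to 0$ for all $y \in M$, where $\|x\|_2 = \sqrt{\tau(xx^* )}$. *)

theory Defs
  imports
    "HOL-Analysis.Analysis"
    "HOL-Algebra.Product_Groups"
    "HOL-Algebra.Weak_Morphisms"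
    "HOL-Computational_Algebra.Primes"
begin

definition semidirect_product ::
  "('k, 'm) monoid_scheme \<Rightarrow> ('h, 'n) monoid_scheme \<Rightarrow> ('h \<Rightarrow> 'k \<Rightarrow> 'k) \<Rightarrow> ('k \<times> 'h) monoid" where
  "semidirect_product K H act =
     \<lparr>carrier = carrier K \<times> carrier H,
      monoid.mult = (\<lambda>(x, g) (y, h). (x \<otimes>\<^bsub>K\<^esub> act g y, g \<otimes>\<^bsub>H\<^esub> h)),
      one = (\<one>\<^bsub>K\<^esub>, \<one>\<^bsub>H\<^esub>)\<rparr>"

text \<open>
  The amalgamated free product of \<open>A\<close> and \<open>B\<close> over \<open>C\<close>, where \<open>C\<close> is (the carrier of) a group
  that is embedded by \<open>\<phi>\<close> into \<open>A\<close> and by \<open>\<psi>\<close> into \<open>B\<close>: words in the disjoint union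
  of \<open>A\<close> and \<open>B\<close>, modulo the congruence generated by multiplication within each
  factor, deletion of identity letters, and \<open>\<phi> c = \<psi> c\<close> for \<open>c\<close> in \<open>C\<close>.
\<close>

inductive amalg_step ::
  "('a, 'm) monoid_scheme \<Rightarrow> ('b, 'n) monoid_scheme \<Rightarrow> 'c set \<Rightarrow> ('c \<Rightarrow> 'a) \<Rightarrow> ('c \<Rightarrow> 'b)
    \<Rightarrow> ('a + 'b) list \<Rightarrow> ('a + 'b) list \<Rightarrow> bool"
  for A B C \<phi> \<psi> where
  mult_left: "a \<in> carrier A \<Longrightarrow> a' \<in> carrier A \<Longrightarrow>
     amalg_step A B C \<phi> \<psi> (u @ [Inl a, Inl a'] @ v) (u @ [Inl (a \<otimes>\<^bsub>A\<^esub> a')] @ v)"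
| mult_right: "b \<in> carrier B \<Longrightarrow> b' \<in> carrier B \<Longrightarrow>
     amalg_step A B C \<phi> \<psi> (u @ [Inr b, Inr b'] @ v) (u @ [Inr (b \<otimes>\<^bsub>B\<^esub> b')] @ v)"
| one_left: "amalg_step A B C \<phi> \<psi> (u @ [Inl \<one>\<^bsub>A\<^esub>] @ v) (u @ v)"
| one_right: "amalg_step A B C \<phi> \<psi> (u @ [Inr \<one>\<^bsub>B\<^esub>] @ v) (u @ v)"
| glue: "c \<in> C \<Longrightarrow> amalg_step A B C \<phi> \<psi> (u @ [Inl (\<phi> c)] @ v) (u @ [Inr (\<psi> c)] @ v)"

definition amalg_words ::
  "('a, 'm) monoid_scheme \<Rightarrow> ('b, 'n) monoid_scheme \<Rightarrow> ('a + 'b) list set" where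
  "amalg_words A B = lists (carrier A <+> carrier B)"

definition amalg_rel ::
  "('a, 'm) monoid_scheme \<Rightarrow> ('b, 'n) monoid_scheme \<Rightarrow> 'c set \<Rightarrow> ('c \<Rightarrow> 'a) \<Rightarrow> ('c \<Rightarrow> 'b)
    \<Rightarrow> (('a + 'b) list \<times> ('a + 'b) list) set" where
  "amalg_rel A B C \<phi> \<psi> =
     {(v, w). v \<in> amalg_words A B \<and> w \<in> amalg_words A B \<and> equivclp (amalg_step A B C \<phi> \<psi>) v w}"

definition amalg_product ::
  "('a, 'm) monoid_scheme \<Rightarrow> ('b, 'n) monoid_scheme \<Rightarrow> 'c set \<Rightarrow> ('c \<Rightarrow> 'a) \<Rightarrow> ('c \<Rightarrow> 'b)
    \<Rightarrow> ('a + 'b) list set monoid" where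
  "amalg_product A B C \<phi> \<psi> =
     (let R = amalg_rel A B C \<phi> \<psi> in
       \<lparr>carrier = amalg_words A B // R,
        monoid.mult = (\<lambda>X Y. \<Union>v\<in>X. \<Union>w\<in>Y. R `` {v @ w}),
        one = R `` {[]}\<rparr>)"

definition amalg_inl ::
  "('a, 'm) monoid_scheme \<Rightarrow> ('b, 'n) monoid_scheme \<Rightarrow> 'c set \<Rightarrow> ('c \<Rightarrow> 'a) \<Rightarrow> ('c \<Rightarrow> 'b)
    \<Rightarrow> 'a \<Rightarrow> ('a + 'b) list set" where
  "amalg_inl A B C \<phi> \<psi> a = amalg_rel A B C \<phi> \<psi> `` {[Inl a]}"

text \<open>
  The inductive limit of a sequence of groups \<open>G 0, G 1, \<dots>\<close> along connecting homomorphisms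
  \<open>\<iota> N\<close> from \<open>G N\<close> to \<open>G (Suc N)\<close>; \<open>transition \<iota> N k\<close> maps \<open>G N\<close> to \<open>G (N + k)\<close>.
\<close>

primrec transition :: "(nat \<Rightarrow> 'a \<Rightarrow> 'a) \<Rightarrow> nat \<Rightarrow> nat \<Rightarrow> 'a \<Rightarrow> 'a" where
  "transition \<iota> N 0 x = x"
| "transition \<iota> N (Suc k) x = \<iota> (N + k) (transition \<iota> N k x)"

definition limit_rel ::
  "(nat \<Rightarrow> ('a, 'm) monoid_scheme) \<Rightarrow> (nat \<Rightarrow> 'a \<Rightarrow> 'a) \<Rightarrow> ((nat \<times> 'a) \<times> (nat \<times> 'a)) set" where
  "limit_rel G \<iota> =
     {((N, x), (M, y)). x \<in> carrier (G N) \<and> y \<in> carrier (G M) \<and>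
        (\<exists>k l. N + k = M + l \<and> transition \<iota> N k x = transition \<iota> M l y)}"

definition inductive_limit ::
  "(nat \<Rightarrow> ('a, 'm) monoid_scheme) \<Rightarrow> (nat \<Rightarrow> 'a \<Rightarrow> 'a) \<Rightarrow> (nat \<times> 'a) set monoid" where
  "inductive_limit G \<iota> =
     (let R = limit_rel G \<iota> in
       \<lparr>carrier = (SIGMA N:UNIV. carrier (G N)) // R,
        monoid.mult = (\<lambda>X Y. \<Union>(N, x)\<in>X. \<Union>(M, y)\<in>Y.
            R `` {(N + M, transition \<iota> N M x \<otimes>\<^bsub>G (N + M)\<^esub> transition \<iota> M N y)}),
        one = R `` {(0, \<one>\<^bsub>G 0\<^esub>)}\<rparr>)"

type_synonym k_elem = "nat \<Rightarrow> 3 \<Rightarrow> int"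
type_synonym g0_elem = "k_elem \<times> (int^3^3)"

definition SL3Z :: "(int^3^3) monoid" where
  "SL3Z = \<lparr>carrier = {A. det A = 1}, monoid.mult = (**), one = mat 1\<rparr>"

definition H_group :: "nat \<Rightarrow> (3 \<Rightarrow> int) monoid" where
  "H_group q = product_group UNIV (\<lambda>_. integer_mod_group q)"

definition H_act :: "nat \<Rightarrow> int^3^3 \<Rightarrow> (3 \<Rightarrow> int) \<Rightarrow> (3 \<Rightarrow> int)" where
  "H_act q g x = (\<lambda>i. (\<Sum>j\<in>UNIV. g $ i $ j * x j) mod int q)"

definition K_group :: "(nat \<Rightarrow> nat) \<Rightarrow> k_elem monoid" where
  "K_group p = sum_group UNIV (\<lambda>n. H_group (p n))"

definition K_act :: "(nat \<Rightarrow> nat) \<Rightarrow> int^3^3 \<Rightarrow> k_elem \<Rightarrow> k_elem" where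
  "K_act p g x = (\<lambda>n. H_act (p n) g (x n))"

definition K_tail :: "(nat \<Rightarrow> nat) \<Rightarrow> nat \<Rightarrow> k_elem set" where
  "K_tail p N = {x \<in> carrier (K_group p). \<forall>n<N. x n = \<one>\<^bsub>H_group (p n)\<^esub>}"

definition G0_group :: "(nat \<Rightarrow> nat) \<Rightarrow> g0_elem monoid" where
  "G0_group p = semidirect_product (K_group p) SL3Z (K_act p)"

definition K_tail_times_Z :: "(nat \<Rightarrow> nat) \<Rightarrow> nat \<Rightarrow> (k_elem \<times> int) monoid" where
  "K_tail_times_Z p N = (K_group p)\<lparr>carrier := K_tail p N\<rparr> \<times>\<times> integer_group"

text \<open>
  Every amalgamated free product has a larger type than its factors. To iterate the construction
  inside one type, each stage is transported along an injection into the following type: a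
  nonempty set of words is sent to one of its elements (equivalence classes being disjoint,
  this is injective on classes).
\<close>

datatype ('a, 'b) tower = Base 'a | Word "(('a, 'b) tower + 'b) list"

definition encode_class :: "(('a, 'b) tower + 'b) list set \<Rightarrow> ('a, 'b) tower" where
  "encode_class X = Word (SOME w. w \<in> X)"

type_synonym g_elem = "(g0_elem, k_elem \<times> int) tower"

text \<open>
  \<open>next_stage p N (G, e)\<close> turns the group \<open>G\<close> together with an embedding \<open>e\<close> of \<open>G0_group p\<close>
  into \<open>G\<close> into the next group and embedding; \<open>stage_inl\<close> is the canonical embedding
  of \<open>G\<close> into the next group.
\<close>

definition stage_inl ::
  "(nat \<Rightarrow> nat) \<Rightarrow> nat \<Rightarrow> g_elem monoid \<times> (g0_elem \<Rightarrow> g_elem) \<Rightarrow> g_elem \<Rightarrow> g_elem" where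
  "stage_inl p N = (\<lambda>(G, e) a.
     encode_class (amalg_inl G (K_tail_times_Z p N) (K_tail p N)
       (\<lambda>x. e (x, \<one>\<^bsub>SL3Z\<^esub>)) (\<lambda>x. (x, 0)) a))"

definition next_stage ::
  "(nat \<Rightarrow> nat) \<Rightarrow> nat \<Rightarrow> g_elem monoid \<times> (g0_elem \<Rightarrow> g_elem)
    \<Rightarrow> g_elem monoid \<times> (g0_elem \<Rightarrow> g_elem)" where
  "next_stage p N = (\<lambda>(G, e).
     (image_group encode_class
        (amalg_product G (K_tail_times_Z p N) (K_tail p N) (\<lambda>x. e (x, \<one>\<^bsub>SL3Z\<^esub>)) (\<lambda>x. (x, 0))),
      \<lambda>a. stage_inl p N (G, e) (e a)))"

primrec stage :: "(nat \<Rightarrow> nat) \<Rightarrow> nat \<Rightarrow> g_elem monoid \<times> (g0_elem \<Rightarrow> g_elem)" where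
  "stage p 0 = (image_group Base (G0_group p), Base)"
| "stage p (Suc N) = next_stage p N (stage p N)"

definition G_group :: "(nat \<Rightarrow> nat) \<Rightarrow> (nat \<times> g_elem) set monoid" where
  "G_group p = inductive_limit (\<lambda>N. fst (stage p N)) (\<lambda>N. stage_inl p N (stage p N))"

definition inner_amenable :: "('a, 'm) monoid_scheme \<Rightarrow> bool" where
  "inner_amenable G \<longleftrightarrow> group G \<and> countable (carrier G) \<and>
     (\<exists>m :: 'a set \<Rightarrow> real.
        (\<forall>X \<subseteq> carrier G - {\<one>\<^bsub>G\<^esub>}. 0 \<le> m X) \<and>
        m (carrier G - {\<one>\<^bsub>G\<^esub>}) = 1 \<and>
        (\<forall>X \<subseteq> carrier G - {\<one>\<^bsub>G\<^esub>}. \<forall>Y \<subseteq> carrier G - {\<one>\<^bsub>G\<^esub>}.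
            X \<inter> Y = {} \<longrightarrow> m (X \<union> Y) = m X + m Y) \<and>
        (\<forall>X \<subseteq> carrier G - {\<one>\<^bsub>G\<^esub>}. \<forall>g \<in> carrier G.
            m ((\<lambda>x. g \<otimes>\<^bsub>G\<^esub> x \<otimes>\<^bsub>G\<^esub> inv\<^bsub>G\<^esub> g) ` X) = m X))"

definition icc :: "('a, 'm) monoid_scheme \<Rightarrow> bool" where
  "icc G \<longleftrightarrow> group G \<and>
     (\<forall>g \<in> carrier G - {\<one>\<^bsub>G\<^esub>}.
        infinite ((\<lambda>h. h \<otimes>\<^bsub>G\<^esub> g \<otimes>\<^bsub>G\<^esub> inv\<^bsub>G\<^esub> h) ` carrier G))"

definition l2 :: "'a set \<Rightarrow> ('a \<Rightarrow> complex) set" where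
  "l2 S = {f. (\<forall>x. x \<notin> S \<longrightarrow> f x = 0) \<and> (\<lambda>x. (cmod (f x))\<^sup>2) summable_on S}"

text \<open>The inner product is linear in the second variable.\<close>

definition l2_inner :: "'a set \<Rightarrow> ('a \<Rightarrow> complex) \<Rightarrow> ('a \<Rightarrow> complex) \<Rightarrow> complex" where
  "l2_inner S f g = (\<Sum>\<^sub>\<infinity>x\<in>S. cnj (f x) * g x)"

definition l2_norm :: "'a set \<Rightarrow> ('a \<Rightarrow> complex) \<Rightarrow> real" where
  "l2_norm S f = sqrt (\<Sum>\<^sub>\<infinity>x\<in>S. (cmod (f x))\<^sup>2)"

definition l2_delta :: "'a \<Rightarrow> 'a \<Rightarrow> complex" where
  "l2_delta a = (\<lambda>x. if x = a then 1 else 0)"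

text \<open>
  Operators on \<open>l2 S\<close> are functions that are undefined outside \<open>l2 S\<close>, so that equality
  of operators is equality in HOL.
\<close>

type_synonym 'a oper = "('a \<Rightarrow> complex) \<Rightarrow> ('a \<Rightarrow> complex)"

definition bounded_opers :: "'a set \<Rightarrow> 'a oper set" where
  "bounded_opers S = {T \<in> l2 S \<rightarrow>\<^sub>E l2 S.
     (\<forall>f\<in>l2 S. \<forall>g\<in>l2 S. T (\<lambda>x. f x + g x) = (\<lambda>x. T f x + T g x)) \<and>
     (\<forall>c. \<forall>f\<in>l2 S. T (\<lambda>x. c * f x) = (\<lambda>x. c * T f x)) \<and>
     (\<exists>B. \<forall>f\<in>l2 S. l2_norm S (T f) \<le> B * l2_norm S f)}"

definition op_id :: "'a set \<Rightarrow> 'a oper" where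
  "op_id S = (\<lambda>f\<in>l2 S. f)"

definition op_add :: "'a set \<Rightarrow> 'a oper \<Rightarrow> 'a oper \<Rightarrow> 'a oper" where
  "op_add S T U = (\<lambda>f\<in>l2 S. \<lambda>x. T f x + U f x)"

definition op_diff :: "'a set \<Rightarrow> 'a oper \<Rightarrow> 'a oper \<Rightarrow> 'a oper" where
  "op_diff S T U = (\<lambda>f\<in>l2 S. \<lambda>x. T f x - U f x)"

definition op_scale :: "'a set \<Rightarrow> complex \<Rightarrow> 'a oper \<Rightarrow> 'a oper" where
  "op_scale S c T = (\<lambda>f\<in>l2 S. \<lambda>x. c * T f x)"

definition op_mult :: "'a set \<Rightarrow> 'a oper \<Rightarrow> 'a oper \<Rightarrow> 'a oper" where
  "op_mult S T U = compose (l2 S) T U"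

definition op_adj :: "'a set \<Rightarrow> 'a oper \<Rightarrow> 'a oper" where
  "op_adj S T = (THE U. U \<in> bounded_opers S \<and>
     (\<forall>f\<in>l2 S. \<forall>g\<in>l2 S. l2_inner S (U f) g = l2_inner S f (T g)))"

definition wot_closed :: "'a set \<Rightarrow> 'a oper set \<Rightarrow> bool" where
  "wot_closed S M \<longleftrightarrow>
     (\<forall>T\<in>bounded_opers S.
        (\<forall>F \<epsilon>. finite F \<and> F \<subseteq> l2 S \<times> l2 S \<and> \<epsilon> > 0 \<longrightarrow>
           (\<exists>U\<in>M. \<forall>(f, g)\<in>F. cmod (l2_inner S f (U g) - l2_inner S f (T g)) < \<epsilon>))
        \<longrightarrow> T \<in> M)"

definition von_neumann_algebra :: "'a set \<Rightarrow> 'a oper set \<Rightarrow> bool" where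
  "von_neumann_algebra S M \<longleftrightarrow>
     M \<subseteq> bounded_opers S \<and>
     op_id S \<in> M \<and>
     (\<forall>T\<in>M. \<forall>U\<in>M. op_add S T U \<in> M) \<and>
     (\<forall>c. \<forall>T\<in>M. op_scale S c T \<in> M) \<and>
     (\<forall>T\<in>M. \<forall>U\<in>M. op_mult S T U \<in> M) \<and>
     (\<forall>T\<in>M. op_adj S T \<in> M) \<and>
     wot_closed S M"

definition generated_vna :: "'a set \<Rightarrow> 'a oper set \<Rightarrow> 'a oper set" where
  "generated_vna S X = \<Inter>{M. von_neumann_algebra S M \<and> X \<subseteq> M}"

definition factor :: "'a set \<Rightarrow> 'a oper set \<Rightarrow> bool" where
  "factor S M \<longleftrightarrow> von_neumann_algebra S M \<and>
     (\<forall>T\<in>M. (\<forall>U\<in>M. op_mult S T U = op_mult S U T) \<longrightarrow> (\<exists>c. T = op_scale S c (op_id S)))"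

definition infinite_dimensional :: "'a set \<Rightarrow> 'a oper set \<Rightarrow> bool" where
  "infinite_dimensional S M \<longleftrightarrow>
     \<not> (\<exists>B. finite B \<and> B \<subseteq> M \<and>
          (\<forall>T\<in>M. \<exists>c. T = (\<lambda>f\<in>l2 S. \<lambda>x. \<Sum>b\<in>B. c b * b f x)))"

text \<open>
  Normality is expressed as weak operator continuity on norm bounded sets; by linearity it
  suffices to require it at \<open>0\<close> on the unit ball.
\<close>

definition faithful_normal_trace :: "'a set \<Rightarrow> 'a oper set \<Rightarrow> ('a oper \<Rightarrow> complex) \<Rightarrow> bool" where
  "faithful_normal_trace S M \<tau> \<longleftrightarrow>
     (\<forall>T\<in>M. \<forall>U\<in>M. \<tau> (op_add S T U) = \<tau> T + \<tau> U) \<and>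
     (\<forall>c. \<forall>T\<in>M. \<tau> (op_scale S c T) = c * \<tau> T) \<and>
     \<tau> (op_id S) = 1 \<and>
     (\<forall>T\<in>M. \<tau> (op_mult S (op_adj S T) T) \<in> \<real>\<^sub>\<ge>\<^sub>0) \<and>
     (\<forall>T\<in>M. \<forall>U\<in>M. \<tau> (op_mult S T U) = \<tau> (op_mult S U T)) \<and>
     (\<forall>T\<in>M. \<tau> (op_mult S (op_adj S T) T) = 0 \<longrightarrow> T = op_scale S 0 (op_id S)) \<and>
     (\<forall>\<epsilon>>0. \<exists>F \<delta>. finite F \<and> F \<subseteq> l2 S \<times> l2 S \<and> \<delta> > 0 \<and>
        (\<forall>T\<in>M. (\<forall>f\<in>l2 S. l2_norm S (T f) \<le> l2_norm S f) \<and>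
                 (\<forall>(f, g)\<in>F. cmod (l2_inner S f (T g)) < \<delta>)
           \<longrightarrow> cmod (\<tau> T) < \<epsilon>))"

definition II1_factor :: "'a set \<Rightarrow> 'a oper set \<Rightarrow> ('a oper \<Rightarrow> complex) \<Rightarrow> bool" where
  "II1_factor S M \<tau> \<longleftrightarrow>
     factor S M \<and> infinite_dimensional S M \<and> faithful_normal_trace S M \<tau>"

definition unitary_op :: "'a set \<Rightarrow> 'a oper \<Rightarrow> bool" where
  "unitary_op S T \<longleftrightarrow>
     op_mult S (op_adj S T) T = op_id S \<and> op_mult S T (op_adj S T) = op_id S"

definition trace_norm2 :: "'a set \<Rightarrow> ('a oper \<Rightarrow> complex) \<Rightarrow> 'a oper \<Rightarrow> real" where
  "trace_norm2 S \<tau> T = sqrt (Re (\<tau> (op_mult S T (op_adj S T))))"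

definition property_Gamma :: "'a set \<Rightarrow> 'a oper set \<Rightarrow> ('a oper \<Rightarrow> complex) \<Rightarrow> bool" where
  "property_Gamma S M \<tau> \<longleftrightarrow>
     (\<exists>x :: nat \<Rightarrow> 'a oper.
        (\<forall>n. x n \<in> M \<and> unitary_op S (x n) \<and> \<tau> (x n) = 0) \<and>
        (\<forall>y\<in>M. (\<lambda>n. trace_norm2 S \<tau> (op_diff S (op_mult S (x n) y) (op_mult S y (x n))))
                  \<longlonglongrightarrow> 0))"

definition left_translation :: "('a, 'm) monoid_scheme \<Rightarrow> 'a \<Rightarrow> 'a oper" where
  "left_translation G g =
     (\<lambda>f\<in>l2 (carrier G). \<lambda>x. if x \<in> carrier G then f (inv\<^bsub>G\<^esub> g \<otimes>\<^bsub>G\<^esub> x) else 0)"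

definition group_vna :: "('a, 'm) monoid_scheme \<Rightarrow> 'a oper set" where
  "group_vna G = generated_vna (carrier G) (left_translation G ` carrier G)"

definition group_trace :: "('a, 'm) monoid_scheme \<Rightarrow> 'a oper \<Rightarrow> complex" where
  "group_trace G T = l2_inner (carrier G) (l2_delta \<one>\<^bsub>G\<^esub>) (T (l2_delta \<one>\<^bsub>G\<^esub>))"

end

theory Submission
  imports Defs
begin

text \<open>
  Inner amenability: every element of \<open>G\<close> permutes \<open>H\<^sub>n - {0}\<close> for all large \<open>n\<close>, because the generator
  added at stage \<open>N\<close> commutes with \<open>H\<^sub>n\<close> for \<open>n \<ge> N\<close>. A cluster point of the uniform measures
  on these finite sets is an invariant mean.

  For the rest, let \<open>\<xi>\<^sub>i\<close> be asymptotically conjugation invariant vectors in the unit ball of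
  \<open>\<ell>\<^sup>2(G)\<close>, and regard \<open>\<bar>\<xi>\<^sub>i\<bar>\<^sup>2\<close> as measures on \<open>G\<close>. The only source of rigidity is that a measure on
  the plane that is almost invariant under the two elementary matrices has almost no mass off the origin. On
  \<open>G - G\<^sub>0\<close> the Bass--Serre tree gives a \<open>\<Lambda>\<close>-equivariant map to \<open>\<int>\<^sup>3 - {0}\<close>, and on \<open>G\<^sub>0 - K\<close> the
  columns of the matrix part are transformed linearly; hence the mass concentrates on \<open>K\<close>. The stable
  letter \<open>t\<^sub>N\<close> moves \<open>K - K\<^sub>N\<close> off \<open>K\<close>, so it concentrates on every \<open>K\<^sub>N\<close>. This already gives the icc property.

  If \<open>\<xi>\<^sub>i\<close> comes from a central sequence of unitaries of trace zero, take the Fourier transform of \<open>\<xi>\<^sub>i\<close> on \<open>K\<^sub>N\<close>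
  in the last two coordinates and apply the same principle to the point \<open>(u y, u z)\<close> of the torus, \<open>u\<close> being
  the first coordinate and \<open>y, z\<close> the dual ones. Almost all mass with \<open>u \<noteq> 0\<close> lies where some components of \<open>y\<close> and
  \<open>z\<close> vanish simultaneously; since the operators are contractions, this is at most \<open>\<Sum>\<^sub>n\<^sub>\<ge>\<^sub>N p\<^sub>n\<^bsup>-2\<^esup>\<close>, which is small. So
  the mass concentrates at the neutral element, contradicting trace zero.
\<close>

section \<open>Amalgamated free products\<close>

text \<open>The obstacle: inner amenability itself produces unit vectors, orthogonal to the point
  mass at the identity, that are asymptotically conjugation invariant, namely the normalized
  indicators of H_n - {0}. They concentrate on every K_N, so invariance alone cannot exclude
  property Gamma. They are excluded because a central sequence consists of contractions: each pair
  (y, z) of dual coordinates then carries at most its even share of the transformed mass. The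
  indicators violate this; for u nonzero their transform lives exactly where the n-th components of
  y and z vanish.

  Two coordinates are transformed because such pairs have density p_n^-2, which is summable over
  distinct primes, while the density p_n^-1 for a single coordinate need not be. The coordinate u
  stays untransformed: adding u to another coordinate becomes multiplication by a phase, almost
  invariance forces most phases near 1, and this confines (u y, u z) to a part of the torus that
  lifts to the plane.

  The plane estimate stands in for property (T) of SL(3, Z); it is a ping-pong between sectors and
  needs only finitely additive measures.\<close>

locale amalgam = A: group A + B: group B
  for A :: "('a, 'm) monoid_scheme" and B :: "('b, 'n) monoid_scheme"
    and C :: "'c set" and \<phi> :: "'c \<Rightarrow> 'a" and \<psi> :: "'c \<Rightarrow> 'b" +
  assumes glue_left: "c \<in> C \<Longrightarrow> \<phi> c \<in> carrier A"
    and glue_right: "c \<in> C \<Longrightarrow> \<psi> c \<in> carrier B"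
begin

abbreviation "W \<equiv> amalg_words A B"
abbreviation "R \<equiv> amalg_rel A B C \<phi> \<psi>"
abbreviation "step \<equiv> amalg_step A B C \<phi> \<psi>"
abbreviation "P \<equiv> amalg_product A B C \<phi> \<psi>"

lemma in_words_iff [simp]:
  "[] \<in> W" "Inl a # w \<in> W \<longleftrightarrow> a \<in> carrier A \<and> w \<in> W"
  "Inr b # w \<in> W \<longleftrightarrow> b \<in> carrier B \<and> w \<in> W"
  "v @ w \<in> W \<longleftrightarrow> v \<in> W \<and> w \<in> W"
  by (auto simp: amalg_words_def)

lemma step_words: "step v w \<Longrightarrow> v \<in> W \<longleftrightarrow> w \<in> W"
  by (induction rule: amalg_step.induct) (auto simp: glue_left glue_right)

lemma equivclp_words: "equivclp step v w \<Longrightarrow> v \<in> W \<longleftrightarrow> w \<in> W"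
  by (induction rule: equivclp_induct) (auto dest: step_words)

lemma step_context: "step v w \<Longrightarrow> step (x @ v @ y) (x @ w @ y)"
proof (induction rule: amalg_step.induct)
  case (mult_left a a' u v)
  then show ?case using amalg_step.mult_left[of a A a' B C \<phi> \<psi> "x @ u" "v @ y"] by simp
next
  case (mult_right b b' u v)
  then show ?case using amalg_step.mult_right[of b B b' A C \<phi> \<psi> "x @ u" "v @ y"] by simp
next
  case (one_left u v)
  then show ?case using amalg_step.one_left[of A B C \<phi> \<psi> "x @ u" "v @ y"] by simp
next
  case (one_right u v)
  then show ?case using amalg_step.one_right[of A B C \<phi> \<psi> "x @ u" "v @ y"] by simp
next
  case (glue c u v)
  then show ?case using amalg_step.glue[of c C A B \<phi> \<psi> "x @ u" "v @ y"] by simp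
qed

lemma equivclp_context: "equivclp step v w \<Longrightarrow> equivclp step (x @ v @ y) (x @ w @ y)"
proof (induction rule: equivclp_induct)
  case base
  then show ?case by simp
next
  case (step w z)
  then have "equivclp step (x @ w @ y) (x @ z @ y)"
    by (meson r_into_equivclp equivclp_sym step_context)
  with step.IH show ?case by (rule equivclp_trans)
qed

lemma rel_iff: "(v, w) \<in> R \<longleftrightarrow> v \<in> W \<and> w \<in> W \<and> equivclp step v w"
  by (simp add: amalg_rel_def)

lemma equiv_rel: "equiv W R"
  unfolding equiv_def
  by (auto simp: refl_on_def sym_def trans_def rel_iff intro: equivclp_sym equivclp_trans)

lemma rel_append:
  assumes "(v, v') \<in> R" "(w, w') \<in> R"
  shows "(v @ w, v' @ w') \<in> R"
proof -
  have "equivclp step (v @ w) (v' @ w)"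
    using equivclp_context[of v v' "[]" w] assms by (simp add: rel_iff)
  moreover have "equivclp step (v' @ w) (v' @ w')"
    using equivclp_context[of w w' v' "[]"] assms by (simp add: rel_iff)
  ultimately show ?thesis
    using assms by (auto simp: rel_iff intro: equivclp_trans)
qed

lemma step_rel: "step v w \<Longrightarrow> v \<in> W \<Longrightarrow> (v, w) \<in> R"
  using step_words by (auto simp: rel_iff)

lemma class_eq_iff: "v \<in> W \<Longrightarrow> w \<in> W \<Longrightarrow> R `` {v} = R `` {w} \<longleftrightarrow> (v, w) \<in> R"
  by (rule eq_equiv_class_iff[OF equiv_rel])

lemma carrier_product: "carrier P = (\<lambda>w. R `` {w}) ` W"
  by (auto simp: amalg_product_def Let_def quotient_def)

lemma one_product: "\<one>\<^bsub>P\<^esub> = R `` {[]}"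
  by (simp add: amalg_product_def Let_def)

lemma mult_product:
  assumes "v \<in> W" "w \<in> W"
  shows "R `` {v} \<otimes>\<^bsub>P\<^esub> R `` {w} = R `` {v @ w}"
proof -
  have "(\<Union>v'\<in>R `` {v}. \<Union>w'\<in>R `` {w}. R `` {v' @ w'}) = R `` {v @ w}"
  proof -
    have "R `` {v' @ w'} = R `` {v @ w}" if "v' \<in> R `` {v}" "w' \<in> R `` {w}" for v' w'
      using that rel_append[of v v' w w'] equiv_class_eq[OF equiv_rel] by auto
    moreover have "v \<in> R `` {v}" "w \<in> R `` {w}"
      using assms equiv_class_self[OF equiv_rel] by auto
    ultimately show ?thesis by blast
  qed
  then show ?thesis by (simp add: amalg_product_def Let_def)
qed

fun inv_letter :: "'a + 'b \<Rightarrow> 'a + 'b" where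
  "inv_letter (Inl a) = Inl (inv\<^bsub>A\<^esub> a)"
| "inv_letter (Inr b) = Inr (inv\<^bsub>B\<^esub> b)"

lemma letter_cases:
  assumes "l \<in> carrier A <+> carrier B"
  obtains a where "l = Inl a" "a \<in> carrier A" | b where "l = Inr b" "b \<in> carrier B"
  using assms by auto

lemma words_Cons_iff: "l # w \<in> W \<longleftrightarrow> l \<in> carrier A <+> carrier B \<and> w \<in> W"
  by (auto simp: amalg_words_def)

lemma inv_letter_rel:
  assumes "l \<in> carrier A <+> carrier B"
  shows "inv_letter l \<in> carrier A <+> carrier B" "([inv_letter l, l], []) \<in> R"
proof -
  show "inv_letter l \<in> carrier A <+> carrier B"
    using assms by auto
  show "([inv_letter l, l], []) \<in> R"
    using assms
  proof (cases rule: letter_cases)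
    case (1 a)
    have "([inv_letter l, l], [Inl \<one>\<^bsub>A\<^esub>]) \<in> R"
      using amalg_step.mult_left[of "inv\<^bsub>A\<^esub> a" A a B C \<phi> \<psi> "[]" "[]"] 1
      by (auto intro!: step_rel)
    moreover have "([Inl \<one>\<^bsub>A\<^esub>], []) \<in> R"
      using amalg_step.one_left[of A B C \<phi> \<psi> "[]" "[]"] by (auto intro!: step_rel)
    ultimately show ?thesis
      using equiv_rel by (meson equivE transE)
  next
    case (2 b)
    have "([inv_letter l, l], [Inr \<one>\<^bsub>B\<^esub>]) \<in> R"
      using amalg_step.mult_right[of "inv\<^bsub>B\<^esub> b" B b A C \<phi> \<psi> "[]" "[]"] 2
      by (auto intro!: step_rel)
    moreover have "([Inr \<one>\<^bsub>B\<^esub>], []) \<in> R"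
      using amalg_step.one_right[of A B C \<phi> \<psi> "[]" "[]"] by (auto intro!: step_rel)
    ultimately show ?thesis
      using equiv_rel by (meson equivE transE)
  qed
qed

lemma inverse_word: "w \<in> W \<Longrightarrow> \<exists>v\<in>W. (v @ w, []) \<in> R"
proof (induction w)
  case Nil
  show ?case using equiv_class_self[OF equiv_rel, of "[]"] by force
next
  case (Cons l w)
  then have l: "l \<in> carrier A <+> carrier B" and "w \<in> W" by (simp_all add: words_Cons_iff)
  then obtain v where v: "v \<in> W" "(v @ w, []) \<in> R" using Cons.IH by auto
  have "(v @ [inv_letter l, l] @ w, v @ [] @ w) \<in> R"
    using v \<open>w \<in> W\<close> inv_letter_rel[OF l] equiv_rel
    by (intro rel_append) (auto simp: equiv_def refl_on_def)
  then have "((v @ [inv_letter l]) @ l # w, []) \<in> R"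
    using v(2) equiv_rel by (simp add: equiv_def) (meson transE)
  then show ?case
    using v(1) inv_letter_rel(1)[OF l] by (metis in_words_iff(1,4) words_Cons_iff)
qed

lemma group_product: "group P"
proof (rule groupI)
  fix x y z assume "x \<in> carrier P" "y \<in> carrier P" "z \<in> carrier P"
  then show "x \<otimes>\<^bsub>P\<^esub> y \<otimes>\<^bsub>P\<^esub> z = x \<otimes>\<^bsub>P\<^esub> (y \<otimes>\<^bsub>P\<^esub> z)"
    by (auto simp: carrier_product mult_product)
next
  fix x assume "x \<in> carrier P"
  then obtain w where w: "w \<in> W" "x = R `` {w}" by (auto simp: carrier_product)
  obtain v where v: "v \<in> W" "(v @ w, []) \<in> R" using inverse_word[OF w(1)] by auto
  show "\<exists>y\<in>carrier P. y \<otimes>\<^bsub>P\<^esub> x = \<one>\<^bsub>P\<^esub>"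
    using v w by (intro bexI[of _ "R `` {v}"])
      (auto simp: carrier_product mult_product one_product class_eq_iff)
qed (auto simp: carrier_product mult_product one_product)

text \<open>The device for telling words apart without a normal form: each generating relation is
  checked once on a set \<open>Y\<close>. It later yields both the retraction onto a factor and the
  action on the tree.\<close>

lemma rel_action:
  assumes Y: "\<And>l y. l \<in> carrier A <+> carrier B \<Longrightarrow> y \<in> Y \<Longrightarrow> act l y \<in> Y"
    and mult_left: "\<And>a a' y. a \<in> carrier A \<Longrightarrow> a' \<in> carrier A \<Longrightarrow> y \<in> Y \<Longrightarrow>
       act (Inl (a \<otimes>\<^bsub>A\<^esub> a')) y = act (Inl a) (act (Inl a') y)"
    and mult_right: "\<And>b b' y. b \<in> carrier B \<Longrightarrow> b' \<in> carrier B \<Longrightarrow> y \<in> Y \<Longrightarrow>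
       act (Inr (b \<otimes>\<^bsub>B\<^esub> b')) y = act (Inr b) (act (Inr b') y)"
    and one_left: "\<And>y. y \<in> Y \<Longrightarrow> act (Inl \<one>\<^bsub>A\<^esub>) y = y"
    and one_right: "\<And>y. y \<in> Y \<Longrightarrow> act (Inr \<one>\<^bsub>B\<^esub>) y = y"
    and glue: "\<And>c y. c \<in> C \<Longrightarrow> y \<in> Y \<Longrightarrow> act (Inl (\<phi> c)) y = act (Inr (\<psi> c)) y"
    and rel: "(v, w) \<in> R" and y: "y \<in> Y"
  shows "foldr act v y = foldr act w y"
proof -
  have closed: "foldr act v y \<in> Y" if "v \<in> W" for v
    using that by (induction v) (auto simp: y words_Cons_iff Y simp del: in_words_iff)
  have same: "foldr act v y = foldr act w y" if "step v w" "v \<in> W" for v w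
    using that by (induction rule: amalg_step.induct)
      (auto simp: closed mult_left mult_right one_left one_right glue)
  have "equivclp step v w" "v \<in> W" using rel by (auto simp: rel_iff)
  then show ?thesis
  proof (induction rule: equivclp_induct)
    case (step w z)
    have "w \<in> W" using step.hyps(1) step.prems equivclp_words by blast
    then have "foldr act w y = foldr act z y"
      using step.hyps(2) same[of w z] same[of z w] step_words by auto
    then show ?case using step.IH step.prems by simp
  qed simp
qed

end

lemma countable_amalg_words:
  "countable (carrier A) \<Longrightarrow> countable (carrier B) \<Longrightarrow> countable (amalg_words A B)"
  unfolding amalg_words_def Plus_def by auto

text \<open>
  \<open>E\<close> is the amalgam transported along \<open>encode_class\<close>, which is injective on classes because
  it picks representatives.
\<close>

locale encoded_amalgam = amalgam A B C \<phi> \<psi>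
  for A :: "('a, 'b) tower monoid" and B :: "'b monoid"
    and C :: "'c set" and \<phi> :: "'c \<Rightarrow> ('a, 'b) tower" and \<psi> :: "'c \<Rightarrow> 'b"
begin

definition E :: "('a, 'b) tower monoid" where
  "E = image_group encode_class P"

definition cls :: "(('a, 'b) tower + 'b) list \<Rightarrow> ('a, 'b) tower" where
  "cls w = encode_class (R `` {w})"

lemma inj_encode: "inj_on encode_class (carrier P)"
proof (rule inj_onI)
  fix X Y assume X: "X \<in> carrier P" and Y: "Y \<in> carrier P" and eq: "encode_class X = encode_class Y"
  have *: "(SOME w. w \<in> X) \<in> X" if X: "X \<in> carrier P" for X
  proof -
    obtain w where "w \<in> W" "X = R `` {w}" using X by (auto simp: carrier_product)
    then have "w \<in> X" using equiv_class_self[OF equiv_rel] by auto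
    then show ?thesis by (rule someI)
  qed
  have "X \<inter> Y \<noteq> {}" using *[OF X] *[OF Y] eq by (auto simp: encode_class_def)
  moreover have "X \<in> W // R" "Y \<in> W // R"
    using X Y by (simp_all add: amalg_product_def Let_def)
  ultimately show "X = Y" using quotient_disj[OF equiv_rel] by blast
qed

lemma encode_iso: "encode_class \<in> iso P E"
  unfolding E_def by (rule inj_imp_image_group_iso[OF inj_encode])

lemma group_E: "group E"
  unfolding E_def using group.inj_imp_image_group_is_group[OF group_product inj_encode] .

lemma carrier_E: "carrier E = cls ` W"
  by (auto simp: E_def image_group_carrier carrier_product cls_def)

lemma cls_closed [simp]: "w \<in> W \<Longrightarrow> cls w \<in> carrier E"
  by (simp add: carrier_E)

lemma cls_Nil: "cls [] = \<one>\<^bsub>E\<^esub>"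
  by (simp add: E_def cls_def image_group_one one_product)

lemma cls_append: "v \<in> W \<Longrightarrow> w \<in> W \<Longrightarrow> cls (v @ w) = cls v \<otimes>\<^bsub>E\<^esub> cls w"
  using encode_iso by (auto simp: iso_def hom_def cls_def carrier_product simp flip: mult_product)

lemma cls_eq_iff: "v \<in> W \<Longrightarrow> w \<in> W \<Longrightarrow> cls v = cls w \<longleftrightarrow> (v, w) \<in> R"
  unfolding cls_def class_eq_iff[symmetric] using inj_encode
  by (auto simp: inj_on_def carrier_product)

lemma cls_step: "step v w \<Longrightarrow> v \<in> W \<Longrightarrow> cls v = cls w"
  using step_rel step_words cls_eq_iff by metis

definition inl :: "('a, 'b) tower \<Rightarrow> ('a, 'b) tower" where "inl a = cls [Inl a]"
definition inr :: "'b \<Rightarrow> ('a, 'b) tower" where "inr b = cls [Inr b]"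

lemma inl_eq: "inl a = encode_class (amalg_inl A B C \<phi> \<psi> a)"
  by (simp add: inl_def cls_def amalg_inl_def)

lemma inl_hom: "inl \<in> hom A E"
proof (rule homI)
  fix a a' assume "a \<in> carrier A" "a' \<in> carrier A"
  then show "inl (a \<otimes>\<^bsub>A\<^esub> a') = inl a \<otimes>\<^bsub>E\<^esub> inl a'"
    using cls_step[OF amalg_step.mult_left[of a A a' B C \<phi> \<psi> "[]" "[]"]]
      cls_append[of "[Inl a]" "[Inl a']"] by (simp add: inl_def)
qed (simp add: inl_def)

lemma inr_hom: "inr \<in> hom B E"
proof (rule homI)
  fix b b' assume "b \<in> carrier B" "b' \<in> carrier B"
  then show "inr (b \<otimes>\<^bsub>B\<^esub> b') = inr b \<otimes>\<^bsub>E\<^esub> inr b'"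
    using cls_step[OF amalg_step.mult_right[of b B b' A C \<phi> \<psi> "[]" "[]"]]
      cls_append[of "[Inr b]" "[Inr b']"] by (simp add: inr_def)
qed (simp add: inr_def)

lemma inl_glue: "c \<in> C \<Longrightarrow> inl (\<phi> c) = inr (\<psi> c)"
  using cls_step[OF amalg_step.glue[of c C A B \<phi> \<psi> "[]" "[]"]] glue_left
  by (simp add: inl_def inr_def)

lemma cls_Cons:
  "a \<in> carrier A \<Longrightarrow> w \<in> W \<Longrightarrow> cls (Inl a # w) = inl a \<otimes>\<^bsub>E\<^esub> cls w"
  "b \<in> carrier B \<Longrightarrow> w \<in> W \<Longrightarrow> cls (Inr b # w) = inr b \<otimes>\<^bsub>E\<^esub> cls w"
  using cls_append[of "[Inl a]" w] cls_append[of "[Inr b]" w] by (simp_all add: inl_def inr_def)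

lemma E_induct [consumes 1, case_names one inl inr]:
  assumes "g \<in> carrier E" and "Q \<one>\<^bsub>E\<^esub>"
    and "\<And>a h. a \<in> carrier A \<Longrightarrow> h \<in> carrier E \<Longrightarrow> Q h \<Longrightarrow> Q (inl a \<otimes>\<^bsub>E\<^esub> h)"
    and "\<And>b h. b \<in> carrier B \<Longrightarrow> h \<in> carrier E \<Longrightarrow> Q h \<Longrightarrow> Q (inr b \<otimes>\<^bsub>E\<^esub> h)"
  shows "Q g"
proof -
  have "Q (cls w)" if "w \<in> W" for w
    using that
  proof (induction w)
    case Nil
    then show ?case using assms(2) by (simp add: cls_Nil)
  next
    case (Cons l w)
    then have w: "w \<in> W" "Q (cls w)" by (simp_all add: words_Cons_iff)
    have "l \<in> carrier A <+> carrier B" using Cons.prems by (simp add: words_Cons_iff)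
    then show ?case
      using w assms(3,4) by (cases rule: letter_cases) (simp_all add: cls_Cons)
  qed
  then show ?thesis using assms(1) by (auto simp: carrier_E)
qed

text \<open>Evaluation along an arbitrary representing word; under the relations of
  \<open>amalgam_action\<close> the choice is harmless, see \<open>E_act_cls\<close>.\<close>

definition E_act :: "(('a, 'b) tower + 'b \<Rightarrow> 'y \<Rightarrow> 'y) \<Rightarrow> ('a, 'b) tower \<Rightarrow> 'y \<Rightarrow> 'y" where
  "E_act act g = foldr act (SOME w. w \<in> W \<and> cls w = g)"

end

locale amalgam_action = encoded_amalgam A B C \<phi> \<psi>
  for A :: "('a, 'b) tower monoid" and B :: "'b monoid"
    and C :: "'c set" and \<phi> :: "'c \<Rightarrow> ('a, 'b) tower" and \<psi> :: "'c \<Rightarrow> 'b" +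
  fixes Y :: "'y set" and act :: "('a, 'b) tower + 'b \<Rightarrow> 'y \<Rightarrow> 'y"
  assumes act_closed: "\<And>l y. l \<in> carrier A <+> carrier B \<Longrightarrow> y \<in> Y \<Longrightarrow> act l y \<in> Y"
    and act_mult_left: "\<And>a a' y. a \<in> carrier A \<Longrightarrow> a' \<in> carrier A \<Longrightarrow> y \<in> Y \<Longrightarrow>
       act (Inl (a \<otimes>\<^bsub>A\<^esub> a')) y = act (Inl a) (act (Inl a') y)"
    and act_mult_right: "\<And>b b' y. b \<in> carrier B \<Longrightarrow> b' \<in> carrier B \<Longrightarrow> y \<in> Y \<Longrightarrow>
       act (Inr (b \<otimes>\<^bsub>B\<^esub> b')) y = act (Inr b) (act (Inr b') y)"
    and act_one_left: "\<And>y. y \<in> Y \<Longrightarrow> act (Inl \<one>\<^bsub>A\<^esub>) y = y"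
    and act_one_right: "\<And>y. y \<in> Y \<Longrightarrow> act (Inr \<one>\<^bsub>B\<^esub>) y = y"
    and act_glue: "\<And>c y. c \<in> C \<Longrightarrow> y \<in> Y \<Longrightarrow> act (Inl (\<phi> c)) y = act (Inr (\<psi> c)) y"
begin

lemma E_act_cls:
  assumes "w \<in> W" "y \<in> Y"
  shows "E_act act (cls w) y = foldr act w y"
proof -
  let ?v = "SOME v. v \<in> W \<and> cls v = cls w"
  have "\<exists>v. v \<in> W \<and> cls v = cls w" using assms by auto
  then have "?v \<in> W \<and> cls ?v = cls w" by (rule someI_ex)
  then have "(?v, w) \<in> R" using assms cls_eq_iff by blast
  then show ?thesis unfolding E_act_def
    by (intro rel_action[of Y act])
      (use assms act_closed act_mult_left act_mult_right act_one_left act_one_right act_glue in auto)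
qed

lemma foldr_act_closed: "w \<in> W \<Longrightarrow> y \<in> Y \<Longrightarrow> foldr act w y \<in> Y"
  by (induction w) (auto simp: words_Cons_iff act_closed simp del: in_words_iff)

lemma E_act_closed: "g \<in> carrier E \<Longrightarrow> y \<in> Y \<Longrightarrow> E_act act g y \<in> Y"
  by (auto simp only: carrier_E E_act_cls foldr_act_closed image_iff)

lemma E_act_one: "y \<in> Y \<Longrightarrow> E_act act \<one>\<^bsub>E\<^esub> y = y"
  using E_act_cls[of "[]"] by (simp only: cls_Nil in_words_iff foldr_Nil id_apply)

lemma E_act_mult:
  assumes "g \<in> carrier E" "h \<in> carrier E" "y \<in> Y"
  shows "E_act act (g \<otimes>\<^bsub>E\<^esub> h) y = E_act act g (E_act act h y)"
proof -
  obtain v w where v: "v \<in> W" "g = cls v" and w: "w \<in> W" "h = cls w"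
    using assms by (auto simp only: carrier_E image_iff)
  have "E_act act (cls (v @ w)) y = foldr act v (foldr act w y)"
    using E_act_cls[of "v @ w" y] v(1) w(1) assms(3) by (simp only: in_words_iff foldr_append comp_apply)
  also have "\<dots> = E_act act (cls v) (E_act act (cls w) y)"
    using v(1) w(1) assms(3) by (simp only: E_act_cls foldr_act_closed)
  finally show ?thesis
    unfolding v(2) w(2) cls_append[OF v(1) w(1)] .
qed

lemma E_act_inl: "a \<in> carrier A \<Longrightarrow> y \<in> Y \<Longrightarrow> E_act act (inl a) y = act (Inl a) y"
  using E_act_cls[of "[Inl a]" y] by (simp add: inl_def)

lemma E_act_inr: "b \<in> carrier B \<Longrightarrow> y \<in> Y \<Longrightarrow> E_act act (inr b) y = act (Inr b) y"
  using E_act_cls[of "[Inr b]" y] by (simp add: inr_def)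

end

section \<open>Inductive limits of groups\<close>

locale group_sequence =
  fixes G :: "nat \<Rightarrow> ('a, 'm) monoid_scheme" and \<iota> :: "nat \<Rightarrow> 'a \<Rightarrow> 'a"
  assumes group_G: "group (G n)"
    and hom_\<iota>: "\<iota> n \<in> hom (G n) (G (Suc n))"
    and inj_\<iota>: "inj_on (\<iota> n) (carrier (G n))"
begin

abbreviation "L \<equiv> inductive_limit G \<iota>"
abbreviation "R \<equiv> limit_rel G \<iota>"
abbreviation "tr \<equiv> transition \<iota>"

lemma tr_hom: "tr N k \<in> hom (G N) (G (N + k))"
proof (induction k)
  case 0
  show ?case by (simp add: hom_def)
next
  case (Suc k)
  show ?case using hom_compose[OF Suc hom_\<iota>] by (simp add: comp_def hom_def)
qed

lemma tr_closed [simp]: "x \<in> carrier (G N) \<Longrightarrow> tr N k x \<in> carrier (G (N + k))"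
  using tr_hom by (auto simp: hom_def)

lemma tr_closed': "x \<in> carrier (G N) \<Longrightarrow> N + k = M \<Longrightarrow> tr N k x \<in> carrier (G M)"
  using tr_closed by blast

lemma tr_mult: "x \<in> carrier (G N) \<Longrightarrow> y \<in> carrier (G N) \<Longrightarrow> N + k = M \<Longrightarrow>
    tr N k (x \<otimes>\<^bsub>G N\<^esub> y) = tr N k x \<otimes>\<^bsub>G M\<^esub> tr N k y"
  using tr_hom[of N k] by (auto simp: hom_def)

lemma tr_inj: "inj_on (tr N k) (carrier (G N))"
proof (induction k)
  case (Suc k)
  have "inj_on (\<iota> (N + k) \<circ> tr N k) (carrier (G N))"
    using Suc by (rule comp_inj_on) (rule inj_on_subset[OF inj_\<iota>], auto)
  then show ?case by (simp add: comp_def)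
qed (simp add: inj_on_def)

lemma tr_add: "tr N (k + l) x = tr (N + k) l (tr N k x)"
  by (induction l) (auto simp: add.assoc)

lemma rel_iff: "((N, x), (M, y)) \<in> R \<longleftrightarrow> x \<in> carrier (G N) \<and> y \<in> carrier (G M) \<and>
    (\<exists>k l. N + k = M + l \<and> tr N k x = tr M l y)"
  by (simp add: limit_rel_def)

lemma rel_tr:
  assumes "x \<in> carrier (G N)" "N + k = M"
  shows "((N, x), (M, tr N k x)) \<in> R"
proof -
  have "\<exists>k' l'. N + k' = M + l' \<and> tr N k' x = tr M l' (tr N k x)"
    using assms by (intro exI[of _ k] exI[of _ 0]) simp
  then show ?thesis using assms tr_closed'[of x N k M] by (simp add: rel_iff)
qed

lemma equiv_rel: "equiv (SIGMA N:UNIV. carrier (G N)) R"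
  unfolding equiv_def
proof (intro conjI)
  show "R \<subseteq> (SIGMA N:UNIV. carrier (G N)) \<times> (SIGMA N:UNIV. carrier (G N))"
    by (auto simp: rel_iff)
  show "refl_on (SIGMA N:UNIV. carrier (G N)) R"
    by (auto simp: refl_on_def rel_iff)
  show "sym R"
    by (auto simp: sym_def rel_iff) metis
  show "trans R"
  proof (clarsimp simp: trans_def rel_iff)
    fix a b aa ba ab bb k l ka la
    assume 1: "a + k = aa + l" "tr a k b = tr aa l ba"
      and 2: "aa + ka = ab + la" "tr aa ka ba = tr ab la bb"
    have "tr a (k + ka) b = tr (aa + l) ka (tr aa l ba)" using 1 by (simp add: tr_add)
    also have "\<dots> = tr aa (ka + l) ba" by (simp add: tr_add[symmetric] add.commute)
    also have "\<dots> = tr ab (la + l) bb" using 2 by (simp add: tr_add)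
    finally show "\<exists>k l. a + k = ab + l \<and> tr a k b = tr ab l bb"
      using 1 2 by (intro exI[of _ "k + ka"] exI[of _ "la + l"]) auto
  qed
qed

definition j :: "nat \<Rightarrow> 'a \<Rightarrow> (nat \<times> 'a) set" where
  "j N x = R `` {(N, x)}"

lemma carrier_limit: "carrier L = (\<Union>N. j N ` carrier (G N))"
  by (auto simp: inductive_limit_def Let_def quotient_def j_def)

lemma j_eq_iff: "x \<in> carrier (G N) \<Longrightarrow> y \<in> carrier (G M) \<Longrightarrow>
    j N x = j M y \<longleftrightarrow> ((N, x), (M, y)) \<in> R"
  unfolding j_def by (rule eq_equiv_class_iff[OF equiv_rel]) auto

lemma j_closed [simp]: "x \<in> carrier (G N) \<Longrightarrow> j N x \<in> carrier L"
  by (auto simp: carrier_limit)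

lemma j_tr: "x \<in> carrier (G N) \<Longrightarrow> N + k = M \<Longrightarrow> j M (tr N k x) = j N x"
  using rel_tr j_eq_iff tr_closed by metis

lemma j_\<iota>: "x \<in> carrier (G N) \<Longrightarrow> j (Suc N) (\<iota> N x) = j N x"
  using j_tr[of x N "Suc 0" "Suc N"] by simp

lemma j_inj: "inj_on (j N) (carrier (G N))"
  using tr_inj by (auto simp: inj_on_def j_eq_iff rel_iff)

lemma mult_limit:
  assumes x: "x \<in> carrier (G N)" and y: "y \<in> carrier (G M)"
  shows "j N x \<otimes>\<^bsub>L\<^esub> j M y = j (N + M) (tr N M x \<otimes>\<^bsub>G (N + M)\<^esub> tr M N y)"
proof -
  have *: "R `` {(N' + M', tr N' M' x' \<otimes>\<^bsub>G (N' + M')\<^esub> tr M' N' y')} =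
      R `` {(N + M, tr N M x \<otimes>\<^bsub>G (N + M)\<^esub> tr M N y)}"
    if "(N', x') \<in> j N x" "(M', y') \<in> j M y" for N' x' M' y'
  proof -
    obtain k l where x': "x' \<in> carrier (G N')" "N + k = N' + l" "tr N k x = tr N' l x'"
      using \<open>(N', x') \<in> j N x\<close> by (auto simp: j_def rel_iff)
    obtain k' l' where y': "y' \<in> carrier (G M')" "M + k' = M' + l'" "tr M k' y = tr M' l' y'"
      using \<open>(M', y') \<in> j M y\<close> by (auto simp: j_def rel_iff)
    \<comment> \<open>A common stage for both products: the shifts \<open>k + k'\<close> and
      \<open>l + l'\<close> arrive there because the two index equations add up.\<close>
    let ?T = "N + M + (k + k')"
    have e: "N + M + (k + k') = ?T" "N' + M' + (l + l') = ?T" using x' y' by auto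
    have "tr (N + M) (k + k') (tr N M x) = tr N (k + (M + k')) x"
      by (metis tr_add add.commute add.left_commute)
    also have "\<dots> = tr (N' + l) (M + k') (tr N' l x')" unfolding tr_add using x' by simp
    also have "\<dots> = tr N' (M' + (l + l')) x'" using y'(2)
      by (metis tr_add add.left_commute)
    also have "\<dots> = tr (N' + M') (l + l') (tr N' M' x')" by (simp add: tr_add)
    finally have 1: "tr (N + M) (k + k') (tr N M x) = tr (N' + M') (l + l') (tr N' M' x')" .
    have "tr (N + M) (k + k') (tr M N y) = tr M (k' + (N + k)) y"
      by (metis tr_add add.commute add.assoc add.left_commute)
    also have "\<dots> = tr (M' + l') (N + k) (tr M' l' y')" unfolding tr_add using y' by simp
    also have "\<dots> = tr M' (N' + (l + l')) y'" using x'(2)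
      by (metis tr_add add.left_commute add.commute)
    also have "\<dots> = tr (N' + M') (l + l') (tr M' N' y')"
      by (metis tr_add add.commute)
    finally have 2: "tr (N + M) (k + k') (tr M N y) = tr (N' + M') (l + l') (tr M' N' y')" .
    have c: "tr M N y \<in> carrier (G (N + M))" "tr M' N' y' \<in> carrier (G (N' + M'))"
      using y y' by (auto intro: tr_closed')
    have m: "tr N M x \<otimes>\<^bsub>G (N + M)\<^esub> tr M N y \<in> carrier (G (N + M))"
      "tr N' M' x' \<otimes>\<^bsub>G (N' + M')\<^esub> tr M' N' y' \<in> carrier (G (N' + M'))"
      using x x' c group_G by (auto intro!: monoid.m_closed group.is_monoid)
    have "tr (N + M) (k + k') (tr N M x \<otimes>\<^bsub>G (N + M)\<^esub> tr M N y) =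
        tr (N' + M') (l + l') (tr N' M' x' \<otimes>\<^bsub>G (N' + M')\<^esub> tr M' N' y')"
      using x x' c 1 2 e by (simp add: tr_mult[where M = ?T])
    then have "((N' + M', tr N' M' x' \<otimes>\<^bsub>G (N' + M')\<^esub> tr M' N' y'),
        (N + M, tr N M x \<otimes>\<^bsub>G (N + M)\<^esub> tr M N y)) \<in> R"
      unfolding rel_iff using m e by metis
    then show ?thesis by (rule equiv_class_eq[OF equiv_rel])
  qed
  have self: "(N, x) \<in> j N x" "(M, y) \<in> j M y"
    using x y equiv_class_self[OF equiv_rel] unfolding j_def by simp_all
  have "j N x \<otimes>\<^bsub>L\<^esub> j M y = (\<Union>(N', x')\<in>j N x. \<Union>(M', y')\<in>j M y.
      R `` {(N' + M', tr N' M' x' \<otimes>\<^bsub>G (N' + M')\<^esub> tr M' N' y')})"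
    by (simp add: inductive_limit_def Let_def)
  also have "\<dots> = j (N + M) (tr N M x \<otimes>\<^bsub>G (N + M)\<^esub> tr M N y)"
    using * self unfolding j_def[of "N + M"] by (fastforce intro!: set_eqI)
  finally show ?thesis .
qed

lemma mult_j:
  assumes "x \<in> carrier (G N)" "y \<in> carrier (G N)"
  shows "j N x \<otimes>\<^bsub>L\<^esub> j N y = j N (x \<otimes>\<^bsub>G N\<^esub> y)"
  using assms group_G
  by (simp add: mult_limit j_tr monoid.m_closed group.is_monoid flip: tr_mult)

lemma common_stage:
  assumes "X \<in> carrier L" "Y \<in> carrier L"
  obtains N x y where "x \<in> carrier (G N)" "y \<in> carrier (G N)" "X = j N x" "Y = j N y"
proof -
  obtain N x where x: "x \<in> carrier (G N)" "X = j N x" using assms(1) by (auto simp: carrier_limit)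
  obtain M y where y: "y \<in> carrier (G M)" "Y = j M y" using assms(2) by (auto simp: carrier_limit)
  have "tr N M x \<in> carrier (G (N + M))" "tr M N y \<in> carrier (G (N + M))"
    using x y by (auto intro: tr_closed')
  then show ?thesis
    using that[of "tr N M x" "N + M" "tr M N y"] x y by (simp add: j_tr add.commute)
qed

lemma j_one: "j N \<one>\<^bsub>G N\<^esub> = \<one>\<^bsub>L\<^esub>"
proof -
  have "tr 0 N \<one>\<^bsub>G 0\<^esub> = \<one>\<^bsub>G N\<^esub>"
    using hom_one[OF tr_hom[of 0 N]] group_G by simp
  then have "j N \<one>\<^bsub>G N\<^esub> = j 0 \<one>\<^bsub>G 0\<^esub>"
    using j_tr[of "\<one>\<^bsub>G 0\<^esub>" 0 N N] group_G by (simp add: group.is_monoid monoid.one_closed)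
  then show ?thesis by (simp add: inductive_limit_def Let_def j_def)
qed

lemma group_limit: "group L"
proof (rule groupI)
  fix X Y assume "X \<in> carrier L" "Y \<in> carrier L"
  then show "X \<otimes>\<^bsub>L\<^esub> Y \<in> carrier L"
    by (rule common_stage) (auto simp: mult_j group_G monoid.m_closed group.is_monoid)
next
  show "\<one>\<^bsub>L\<^esub> \<in> carrier L"
    using j_closed[of "\<one>\<^bsub>G 0\<^esub>" 0] group_G by (simp add: j_one group.is_monoid monoid.one_closed)
next
  fix X Y Z assume XYZ: "X \<in> carrier L" "Y \<in> carrier L" "Z \<in> carrier L"
  obtain N x y where xy: "x \<in> carrier (G N)" "y \<in> carrier (G N)" "X = j N x" "Y = j N y"
    using XYZ(1,2) by (rule common_stage)
  obtain M z where z: "z \<in> carrier (G M)" "Z = j M z" using XYZ(3) by (auto simp: carrier_limit)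
  have e: "X = j (N + M) (tr N M x)" "Y = j (N + M) (tr N M y)" "Z = j (N + M) (tr M N z)"
    using xy z by (simp_all add: j_tr add.commute)
  have "tr N M x \<in> carrier (G (N + M))" "tr N M y \<in> carrier (G (N + M))"
    "tr M N z \<in> carrier (G (N + M))"
    using xy z by (auto intro: tr_closed')
  then show "X \<otimes>\<^bsub>L\<^esub> Y \<otimes>\<^bsub>L\<^esub> Z = X \<otimes>\<^bsub>L\<^esub> (Y \<otimes>\<^bsub>L\<^esub> Z)"
    unfolding e by (simp add: mult_j group_G monoid.m_closed group.is_monoid monoid.m_assoc)
next
  fix X assume "X \<in> carrier L"
  then obtain N x where x: "x \<in> carrier (G N)" "X = j N x" by (auto simp: carrier_limit)
  interpret GN: group "G N" by (rule group_G)
  show "\<one>\<^bsub>L\<^esub> \<otimes>\<^bsub>L\<^esub> X = X"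
    using x by (simp add: mult_j flip: j_one[of N])
  show "\<exists>Y\<in>carrier L. Y \<otimes>\<^bsub>L\<^esub> X = \<one>\<^bsub>L\<^esub>"
    using x by (intro bexI[of _ "j N (inv\<^bsub>G N\<^esub> x)"]) (auto simp: mult_j j_one)
qed

lemma j_hom: "j N \<in> hom (G N) L"
  by (rule homI) (auto simp: mult_j)

lemma j_range_mono: "N \<le> M \<Longrightarrow> j N ` carrier (G N) \<subseteq> j M ` carrier (G M)"
proof
  fix X assume "N \<le> M" "X \<in> j N ` carrier (G N)"
  then obtain x where x: "x \<in> carrier (G N)" "X = j N x" by auto
  then show "X \<in> j M ` carrier (G M)"
    using \<open>N \<le> M\<close> by (intro image_eqI[of _ _ "tr N (M - N) x"]) (auto simp: j_tr intro: tr_closed')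
qed

end

section \<open>The group \<open>K \<rtimes> SL(3, \<int>)\<close>\<close>

definition elem :: "3 \<Rightarrow> 3 \<Rightarrow> int^3^3" where
  "elem i j = (\<chi> k l. if k = l \<or> (k = i \<and> l = j) then 1 else 0)"

lemma det_elem: "i \<noteq> j \<Longrightarrow> det (elem i j) = 1"
  using exhaust_3[of i] exhaust_3[of j] by (auto simp: elem_def det_3)

lemma elem_mult: "i \<noteq> j \<Longrightarrow> (elem i j ** A) $ k $ l = A $ k $ l + (if k = i then A $ j $ l else 0)"
  using exhaust_3[of i] exhaust_3[of j] exhaust_3[of k]
  by (auto simp: elem_def matrix_matrix_mult_def sum_3)

lemma mult_elem: "i \<noteq> j \<Longrightarrow> (A ** elem i j) $ k $ l = A $ k $ l + (if l = j then A $ k $ i else 0)"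
  using exhaust_3[of i] exhaust_3[of j] exhaust_3[of l]
  by (auto simp: elem_def matrix_matrix_mult_def sum_3)

lemma elem_mult_vec: "i \<noteq> j \<Longrightarrow> (elem i j *v v) $ k = v $ k + (if k = i then v $ j else 0)"
  using exhaust_3[of i] exhaust_3[of j] exhaust_3[of k]
  by (auto simp: elem_def matrix_vector_mult_def sum_3)

text \<open>Written out entry by entry so that the inverse of an integer matrix of determinant one
  is visibly integral.\<close>

definition adjugate3 :: "int^3^3 \<Rightarrow> int^3^3" where
  "adjugate3 A = vector
    [vector [A$2$2 * A$3$3 - A$2$3 * A$3$2, A$1$3 * A$3$2 - A$1$2 * A$3$3, A$1$2 * A$2$3 - A$1$3 * A$2$2],
     vector [A$2$3 * A$3$1 - A$2$1 * A$3$3, A$1$1 * A$3$3 - A$1$3 * A$3$1, A$1$3 * A$2$1 - A$1$1 * A$2$3],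
     vector [A$2$1 * A$3$2 - A$2$2 * A$3$1, A$1$2 * A$3$1 - A$1$1 * A$3$2, A$1$1 * A$2$2 - A$1$2 * A$2$1]]"

lemma adjugate3:
  assumes "det A = 1"
  shows "adjugate3 A ** A = mat 1"
proof -
  have "(adjugate3 A ** A) $ i $ j = (if i = j then det A else 0)" for i j
    using exhaust_3[of i] exhaust_3[of j]
    by (auto simp: adjugate3_def matrix_matrix_mult_def sum_3 det_3 algebra_simps)
  then show ?thesis using assms by (simp add: vec_eq_iff mat_def)
qed

lemma SL3Z_simps [simp]:
  "carrier SL3Z = {A. det A = 1}" "x \<otimes>\<^bsub>SL3Z\<^esub> y = x ** y" "\<one>\<^bsub>SL3Z\<^esub> = mat 1"
  by (simp_all add: SL3Z_def)

lemma group_SL3Z: "group SL3Z"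
proof (rule groupI)
  fix A assume "A \<in> carrier SL3Z"
  then have A: "det A = 1" by simp
  have "det (adjugate3 A) * det A = 1"
    unfolding det_mul[symmetric] adjugate3[OF A] by simp
  then show "\<exists>B\<in>carrier SL3Z. B \<otimes>\<^bsub>SL3Z\<^esub> A = \<one>\<^bsub>SL3Z\<^esub>"
    using A adjugate3[OF A] by (intro bexI[of _ "adjugate3 A"]) auto
qed (auto simp: det_mul matrix_mul_assoc)

lemma SL3Z_inverse:
  assumes "det A = 1"
  obtains B :: "int^3^3" where "det B = 1" "B ** A = mat 1" "A ** B = mat 1"
proof -
  interpret group SL3Z by (rule group_SL3Z)
  show ?thesis
    using that[of "inv\<^bsub>SL3Z\<^esub> A"] l_inv[of A] r_inv[of A] inv_closed[of A] assms by simp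
qed

section \<open>The direct sum K, its tails, and the semidirect product\<close>

locale prime_seq =
  fixes p :: "nat \<Rightarrow> nat"
  assumes prime_p: "prime (p n)"
begin

abbreviation "K \<equiv> K_group p"
abbreviation "T \<equiv> K_tail p"
abbreviation "G0 \<equiv> G0_group p"
abbreviation "zero_K \<equiv> (\<lambda>n i. 0) :: k_elem"

lemma p_pos [simp]: "0 < p n" "0 < int (p n)" "p n \<noteq> 0"
  using prime_gt_0_nat[OF prime_p[of n]] by simp_all

lemma H_group [simp]: "group (H_group q)"
  by (simp add: H_group_def)

lemma carrier_H: "carrier (H_group (p n)) = {x. \<forall>i. 0 \<le> x i \<and> x i < int (p n)}"
  by (auto simp: H_group_def carrier_integer_mod_group PiE_iff)

lemma one_H: "\<one>\<^bsub>H_group q\<^esub> = (\<lambda>i. 0)"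
  by (simp add: H_group_def restrict_def)

lemma group_K: "group K"
  by (simp add: K_group_def)

lemma carrier_K: "x \<in> carrier K \<longleftrightarrow>
    (\<forall>n i. 0 \<le> x n i \<and> x n i < int (p n)) \<and> finite {n. x n \<noteq> (\<lambda>i. 0)}"
  by (auto simp: K_group_def carrier_sum_group carrier_H one_H PiE_iff)

lemma one_K: "\<one>\<^bsub>K\<^esub> = zero_K"
  by (auto simp: K_group_def one_H)

lemma mult_K: "x \<otimes>\<^bsub>K\<^esub> y = (\<lambda>n i. (x n i + y n i) mod int (p n))"
  by (auto simp: K_group_def H_group_def restrict_def)

lemma K_tail_iff: "x \<in> T N \<longleftrightarrow> x \<in> carrier K \<and> (\<forall>n<N. x n = (\<lambda>i. 0))"
  by (simp add: K_tail_def one_H)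

lemma K_tail_mono: "N \<le> M \<Longrightarrow> T M \<subseteq> T N"
  by (auto simp: K_tail_iff)

lemma zero_in_tail [simp]: "zero_K \<in> T N" "zero_K \<in> carrier K"
  by (auto simp: K_tail_iff carrier_K)

lemma K_comm: "x \<otimes>\<^bsub>K\<^esub> y = y \<otimes>\<^bsub>K\<^esub> x"
  by (simp add: mult_K add.commute)

lemma subgroup_tail: "subgroup (T N) K"
proof -
  interpret group K by (rule group_K)
  show ?thesis
  proof (rule subgroupI)
    show "T N \<subseteq> carrier K" by (auto simp: K_tail_iff)
    show "T N \<noteq> {}" using zero_in_tail by blast
  next
    fix a assume a: "a \<in> T N"
    have "inv\<^bsub>K\<^esub> a = (\<lambda>n i. (- a n i) mod int (p n))"
    proof (rule inv_equality)
      show "(\<lambda>n i. (- a n i) mod int (p n)) \<otimes>\<^bsub>K\<^esub> a = \<one>\<^bsub>K\<^esub>"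
        by (auto simp: mult_K one_K mod_simps)
      have "{n. (\<lambda>i. (- a n i) mod int (p n)) \<noteq> (\<lambda>i. 0)} \<subseteq> {n. a n \<noteq> (\<lambda>i. 0)}" by auto
      then show "(\<lambda>n i. (- a n i) mod int (p n)) \<in> carrier K"
        using a finite_subset by (auto simp: carrier_K K_tail_iff)
    qed (use a in \<open>simp add: K_tail_iff\<close>)
    then show "inv\<^bsub>K\<^esub> a \<in> T N"
      using a inv_closed[of a] by (auto simp: K_tail_iff)
  next
    fix a b assume "a \<in> T N" "b \<in> T N"
    then show "a \<otimes>\<^bsub>K\<^esub> b \<in> T N"
      using m_closed[of a b] by (auto simp: K_tail_iff mult_K)
  qed
qed

lemma K_act_apply: "K_act p g x n i = (\<Sum>j\<in>UNIV. g $ i $ j * x n j) mod int (p n)"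
  by (simp add: K_act_def H_act_def)

lemma K_act_zero: "x n = (\<lambda>i. 0) \<Longrightarrow> K_act p g x n = (\<lambda>i. 0)"
  by (auto simp: K_act_apply)

lemma K_act_closed: "x \<in> carrier K \<Longrightarrow> K_act p g x \<in> carrier K"
proof -
  assume x: "x \<in> carrier K"
  have "{n. K_act p g x n \<noteq> (\<lambda>i. 0)} \<subseteq> {n. x n \<noteq> (\<lambda>i. 0)}"
    using K_act_zero by blast
  then show ?thesis
    using x by (auto simp: carrier_K K_act_apply intro: finite_subset)
qed

lemma K_act_tail: "x \<in> T N \<Longrightarrow> K_act p g x \<in> T N"
  using K_act_closed K_act_zero by (auto simp: K_tail_iff)

lemma K_act_mult: "K_act p g (x \<otimes>\<^bsub>K\<^esub> y) = K_act p g x \<otimes>\<^bsub>K\<^esub> K_act p g y"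
proof (intro ext)
  fix n i
  have "(\<Sum>j\<in>UNIV. g $ i $ j * ((x n j + y n j) mod int (p n))) mod int (p n) =
      (\<Sum>j\<in>UNIV. g $ i $ j * (x n j + y n j)) mod int (p n)"
    by (subst (1 2) mod_sum_eq[symmetric]) (simp add: mod_mult_right_eq)
  then show "K_act p g (x \<otimes>\<^bsub>K\<^esub> y) n i = (K_act p g x \<otimes>\<^bsub>K\<^esub> K_act p g y) n i"
    by (simp add: K_act_apply mult_K mod_add_eq distrib_left sum.distrib)
qed

lemma K_act_act: "K_act p (g ** h) x = K_act p g (K_act p h x)"
proof (intro ext)
  fix n i
  have "(\<Sum>j\<in>UNIV. g $ i $ j * ((\<Sum>k\<in>UNIV. h $ j $ k * x n k) mod int (p n))) mod int (p n) =
      (\<Sum>j\<in>UNIV. g $ i $ j * (\<Sum>k\<in>UNIV. h $ j $ k * x n k)) mod int (p n)"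
    by (subst (1 2) mod_sum_eq[symmetric]) (simp add: mod_mult_right_eq)
  also have "(\<Sum>j\<in>UNIV. g $ i $ j * (\<Sum>k\<in>UNIV. h $ j $ k * x n k)) =
      (\<Sum>k\<in>UNIV. (\<Sum>j\<in>UNIV. g $ i $ j * h $ j $ k) * x n k)"
    unfolding sum_distrib_left sum_distrib_right mult.assoc by (rule sum.swap)
  finally show "K_act p (g ** h) x n i = K_act p g (K_act p h x) n i"
    by (simp add: K_act_apply matrix_matrix_mult_def)
qed

lemma K_act_one: "x \<in> carrier K \<Longrightarrow> K_act p (mat 1) x = x"
  by (auto simp: K_act_apply mat_def carrier_K fun_eq_iff if_distrib[of "\<lambda>c. c * _"] cong: if_cong)

lemma K_act_surj:
  assumes "det g = 1" "x \<in> T N"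
  obtains y where "y \<in> T N" "K_act p g y = x"
proof -
  obtain h where "g ** h = mat 1" using SL3Z_inverse[OF assms(1)] by metis
  then have "K_act p g (K_act p h x) = x"
    using assms(2) by (simp add: K_act_one K_tail_iff flip: K_act_act)
  then show ?thesis using that K_act_tail[OF assms(2)] by blast
qed

lemma G0_simps [simp]:
  "carrier G0 = carrier K \<times> {A. det A = 1}"
  "(x, g) \<otimes>\<^bsub>G0\<^esub> (y, h) = (x \<otimes>\<^bsub>K\<^esub> K_act p g y, g ** h)"
  "\<one>\<^bsub>G0\<^esub> = (zero_K, mat 1)"
  by (simp_all add: G0_group_def semidirect_product_def one_K)

lemma K_act_zero_K [simp]: "K_act p g zero_K = zero_K"
  using K_act_zero[of zero_K] by auto

lemma K_mult_zero [simp]: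
  "x \<in> carrier K \<Longrightarrow> x \<otimes>\<^bsub>K\<^esub> zero_K = x" "x \<in> carrier K \<Longrightarrow> zero_K \<otimes>\<^bsub>K\<^esub> x = x"
  using group_K by (simp_all flip: one_K add: group.is_monoid monoid.l_one monoid.r_one)

lemma group_G0: "group G0"
proof -
  interpret K: group K by (rule group_K)
  show ?thesis
  proof (rule groupI)
    fix a assume "a \<in> carrier G0"
    then obtain x g where a: "a = (x, g)" "x \<in> carrier K" "det g = 1" by auto
    obtain h where h: "det h = 1" "h ** g = mat 1" using SL3Z_inverse[OF a(3)] by metis
    let ?y = "inv\<^bsub>K\<^esub> (K_act p h x)"
    have "?y \<in> carrier K" "?y \<otimes>\<^bsub>K\<^esub> K_act p h x = zero_K"
      using K_act_closed[OF a(2)] by (auto simp: one_K)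
    then show "\<exists>b\<in>carrier G0. b \<otimes>\<^bsub>G0\<^esub> a = \<one>\<^bsub>G0\<^esub>"
      using a h by (intro bexI[of _ "(?y, h)"]) auto
  qed (auto simp: K_act_closed K_act_one K_act_mult K_act_act det_mul matrix_mul_assoc K.m_assoc)
qed

lemma countable_G0: "countable (carrier G0)"
proof -
  \<comment> \<open>A finitely supported element is encoded by a finite list of vectors, continued
    by zero.\<close>
  have "carrier K \<subseteq> (\<lambda>xs n. if n < length xs then (\<lambda>i. vec_nth (xs ! n) i) else (\<lambda>i. 0)) ` (UNIV :: (int^3) list set)"
  proof
    fix x assume x: "x \<in> carrier K"
    then obtain m where m: "\<And>n. x n \<noteq> (\<lambda>i. 0) \<Longrightarrow> n < m"
      using finite_nat_set_iff_bounded[of "{n. x n \<noteq> (\<lambda>i. 0)}"] by (auto simp: carrier_K)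
    have "x = (\<lambda>n. if n < length (map (\<lambda>n. \<chi> i. x n i) [0..<m])
        then (\<lambda>i. vec_nth (map (\<lambda>n. \<chi> i. x n i) [0..<m] ! n) i) else (\<lambda>i. 0))"
      using m by (auto simp: fun_eq_iff)
    then show "x \<in> (\<lambda>xs n. if n < length xs then (\<lambda>i. vec_nth (xs ! n) i) else (\<lambda>i. 0)) ` (UNIV :: (int^3) list set)"
      by blast
  qed
  then have "countable (carrier K)"
    by (rule countable_subset) simp
  then show ?thesis by simp
qed

end

section \<open>One step of the construction\<close>

text \<open>
  \<open>A\<close> is the current group, \<open>e\<close> the embedding of \<open>G0\<close>, and
  \<open>\<rho>\<close> the retraction of \<open>A\<close> onto \<open>G0\<close> that kills the generators added so far.
\<close>

locale stage_group = prime_seq p for p :: "nat \<Rightarrow> nat" +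
  fixes N :: nat and A :: "g_elem monoid" and e :: "g0_elem \<Rightarrow> g_elem" and \<rho> :: "g_elem \<Rightarrow> g0_elem"
  assumes group_A: "group A"
    and e_hom: "e \<in> hom G0 A" and \<rho>_hom: "\<rho> \<in> hom A G0"
    and \<rho>_e: "z \<in> carrier G0 \<Longrightarrow> \<rho> (e z) = z"
    and normalize: "g \<in> carrier A \<Longrightarrow> x \<in> T N \<Longrightarrow>
      g \<otimes>\<^bsub>A\<^esub> e (x, mat 1) = e (K_act p (snd (\<rho> g)) x, mat 1) \<otimes>\<^bsub>A\<^esub> g"
begin

abbreviation "B \<equiv> K_tail_times_Z p N"

definition \<epsilon> :: "k_elem \<Rightarrow> g_elem" where "\<epsilon> x = e (x, mat 1)"

lemma \<epsilon>_eq: "(\<lambda>x. e (x, mat 1)) = \<epsilon>"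
  by (simp add: \<epsilon>_def fun_eq_iff)

lemma e_closed [simp]: "x \<in> carrier K \<Longrightarrow> det g = 1 \<Longrightarrow> e (x, g) \<in> carrier A"
  using e_hom by (auto simp: hom_def Pi_iff)

lemma tail_K [simp]: "x \<in> T N \<Longrightarrow> x \<in> carrier K"
  by (simp add: K_tail_iff)

lemma \<epsilon>_closed [simp]: "x \<in> carrier K \<Longrightarrow> \<epsilon> x \<in> carrier A"
  by (simp add: \<epsilon>_def)

lemma \<epsilon>_mult: "x \<in> carrier K \<Longrightarrow> y \<in> carrier K \<Longrightarrow> \<epsilon> (x \<otimes>\<^bsub>K\<^esub> y) = \<epsilon> x \<otimes>\<^bsub>A\<^esub> \<epsilon> y"
proof -
  assume "x \<in> carrier K" "y \<in> carrier K"
  then show ?thesis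
    using hom_mult[OF e_hom, of "(x, mat 1)" "(y, mat 1)"] by (simp add: \<epsilon>_def K_act_one)
qed

lemma group_B: "group B"
  unfolding K_tail_times_Z_def
  by (intro DirProd_group subgroup.subgroup_is_group[OF subgroup_tail group_K] group_integer_group)

lemma B_simps [simp]:
  "carrier B = T N \<times> UNIV" "(x, m) \<otimes>\<^bsub>B\<^esub> (y, n) = (x \<otimes>\<^bsub>K\<^esub> y, m + n)" "\<one>\<^bsub>B\<^esub> = (zero_K, 0)"
  by (simp_all add: K_tail_times_Z_def one_K integer_group_def)

lemma encoded: "encoded_amalgam A B (T N) \<epsilon> (\<lambda>x. (x, 0))"
  by (intro encoded_amalgam.intro amalgam.intro amalgam_axioms.intro group_A group_B) auto

sublocale encoded_amalgam A B "T N" \<epsilon> "\<lambda>x. (x, 0)"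
  by (rule encoded)

sublocale A: group A by (rule group_A)
sublocale E: group E by (rule group_E)

lemma next_stage_eq:
  "next_stage p N (A, e) = (E, inl \<circ> e)" "stage_inl p N (A, e) = inl"
proof -
  show 2: "stage_inl p N (A, e) = inl"
    by (simp add: stage_inl_def inl_eq fun_eq_iff \<epsilon>_eq)
  show "next_stage p N (A, e) = (E, inl \<circ> e)"
    unfolding next_stage_def prod.case 2 by (simp add: E_def comp_def \<epsilon>_eq)
qed

lemma inl_closed [simp]: "a \<in> carrier A \<Longrightarrow> inl a \<in> carrier E"
  using inl_hom by (auto simp: hom_def)

lemma inr_closed [simp]: "k \<in> T N \<Longrightarrow> inr (k, n) \<in> carrier E"
  using inr_hom by (auto simp: hom_def)

lemma inl_mult: "a \<in> carrier A \<Longrightarrow> b \<in> carrier A \<Longrightarrow> inl (a \<otimes>\<^bsub>A\<^esub> b) = inl a \<otimes>\<^bsub>E\<^esub> inl b"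
  using inl_hom by (auto simp: hom_def)

lemma inr_mult: "k \<in> T N \<Longrightarrow> l \<in> T N \<Longrightarrow> inr (k \<otimes>\<^bsub>K\<^esub> l, m + n) = inr (k, m) \<otimes>\<^bsub>E\<^esub> inr (l, n)"
  using inr_hom by (force simp: hom_def)

lemma inl_one [simp]: "inl \<one>\<^bsub>A\<^esub> = \<one>\<^bsub>E\<^esub>"
  using hom_one[OF inl_hom A.is_group E.is_group] .

lemma inr_one [simp]: "inr (zero_K, 0) = \<one>\<^bsub>E\<^esub>"
  using hom_one[OF inr_hom group_B E.is_group] by simp

lemma \<epsilon>_zero: "\<epsilon> zero_K = \<one>\<^bsub>A\<^esub>"
  using hom_one[OF e_hom group_G0 A.is_group] by (simp add: \<epsilon>_def)

lemma \<rho>_mult: "a \<in> carrier A \<Longrightarrow> b \<in> carrier A \<Longrightarrow> \<rho> (a \<otimes>\<^bsub>A\<^esub> b) = \<rho> a \<otimes>\<^bsub>G0\<^esub> \<rho> b"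
  using \<rho>_hom by (auto simp: hom_def)

lemma \<rho>_closed: "a \<in> carrier A \<Longrightarrow> \<rho> a \<in> carrier K \<times> {A. det A = 1}"
  using \<rho>_hom by (auto simp: hom_def Pi_iff)

lemma det_\<rho>: "a \<in> carrier A \<Longrightarrow> det (snd (\<rho> a)) = 1"
  using \<rho>_closed[of a] by auto

lemma snd_\<rho>_mult: "a \<in> carrier A \<Longrightarrow> b \<in> carrier A \<Longrightarrow>
    snd (\<rho> (a \<otimes>\<^bsub>A\<^esub> b)) = snd (\<rho> a) ** snd (\<rho> b)"
  unfolding \<rho>_mult by (cases "\<rho> a"; cases "\<rho> b") simp

lemma snd_\<rho>_\<epsilon>: "x \<in> carrier K \<Longrightarrow> snd (\<rho> (\<epsilon> x)) = mat 1"
  by (simp add: \<epsilon>_def \<rho>_e)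

lemma normalize_\<epsilon>:
  "g \<in> carrier A \<Longrightarrow> x \<in> T N \<Longrightarrow> g \<otimes>\<^bsub>A\<^esub> \<epsilon> x = \<epsilon> (K_act p (snd (\<rho> g)) x) \<otimes>\<^bsub>A\<^esub> g"
  unfolding \<epsilon>_def by (rule normalize)

subsection \<open>The retraction onto the previous stage\<close>

text \<open>Left multiplication of \<open>A\<close> on itself, extended so that the new generator
  acts trivially; the orbit of the identity is the retraction.\<close>

fun retr_act :: "g_elem + k_elem \<times> int \<Rightarrow> g_elem \<Rightarrow> g_elem" where
  "retr_act (Inl a) y = a \<otimes>\<^bsub>A\<^esub> y"
| "retr_act (Inr (k, n)) y = \<epsilon> k \<otimes>\<^bsub>A\<^esub> y"

lemma retr_action: "amalgam_action A B (T N) \<epsilon> (\<lambda>x. (x, 0)) (carrier A) retr_act"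
  by unfold_locales (auto simp: A.m_assoc \<epsilon>_mult \<epsilon>_zero)

interpretation retr: amalgam_action A B "T N" \<epsilon> "\<lambda>x. (x, 0)" "carrier A" retr_act
  by (rule retr_action)

definition r :: "g_elem \<Rightarrow> g_elem" where "r g = E_act retr_act g \<one>\<^bsub>A\<^esub>"

lemma r_closed: "g \<in> carrier E \<Longrightarrow> r g \<in> carrier A"
  by (simp add: r_def retr.E_act_closed)

lemma r_inl: "a \<in> carrier A \<Longrightarrow> r (inl a) = a"
  by (simp add: r_def retr.E_act_inl)

lemma r_inr: "k \<in> T N \<Longrightarrow> r (inr (k, n)) = \<epsilon> k"
  by (simp add: r_def retr.E_act_inr)

text \<open>The action commutes with right multiplications, hence is determined by its value at the
  identity. This is what makes \<open>r\<close> multiplicative.\<close>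

lemma E_act_retr: "g \<in> carrier E \<Longrightarrow> y \<in> carrier A \<Longrightarrow> E_act retr_act g y = r g \<otimes>\<^bsub>A\<^esub> y"
proof (induction g arbitrary: y rule: E_induct)
  case one
  then show ?case by (simp add: r_def retr.E_act_one)
next
  case (inl a h)
  have "E_act retr_act (inl a \<otimes>\<^bsub>E\<^esub> h) z = a \<otimes>\<^bsub>A\<^esub> (r h \<otimes>\<^bsub>A\<^esub> z)" if "z \<in> carrier A" for z
    using inl.hyps inl.IH[OF that] that retr.E_act_closed
    by (simp add: retr.E_act_mult retr.E_act_inl r_closed)
  from this[OF \<open>y \<in> carrier A\<close>] this[of "\<one>\<^bsub>A\<^esub>"] inl show ?case
    by (simp add: r_closed A.m_assoc r_def[of "inl a \<otimes>\<^bsub>E\<^esub> h"])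
next
  case (inr b h)
  obtain k n where b: "b = (k, n)" "k \<in> T N" using inr.hyps by auto
  have "E_act retr_act (inr b \<otimes>\<^bsub>E\<^esub> h) z = \<epsilon> k \<otimes>\<^bsub>A\<^esub> (r h \<otimes>\<^bsub>A\<^esub> z)" if "z \<in> carrier A" for z
    using inr.hyps inr.IH[OF that] that retr.E_act_closed b
    by (simp add: retr.E_act_mult retr.E_act_inr r_closed)
  from this[OF \<open>y \<in> carrier A\<close>] this[of "\<one>\<^bsub>A\<^esub>"] inr b show ?case
    by (simp add: r_closed A.m_assoc r_def[of "inr (k, n) \<otimes>\<^bsub>E\<^esub> h"])
qed

lemma r_hom: "r \<in> hom E A"
proof (rule homI)
  fix g h assume gh: "g \<in> carrier E" "h \<in> carrier E"
  then have "r (g \<otimes>\<^bsub>E\<^esub> h) = E_act retr_act g (r h)"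
    unfolding r_def by (simp add: retr.E_act_mult)
  also have "\<dots> = r g \<otimes>\<^bsub>A\<^esub> r h"
    using gh by (simp add: E_act_retr r_closed)
  finally show "r (g \<otimes>\<^bsub>E\<^esub> h) = r g \<otimes>\<^bsub>A\<^esub> r h" .
qed (rule r_closed)

text \<open>A factor embeds because it is a retract.\<close>

lemma inl_inj: "inj_on inl (carrier A)"
  by (rule inj_on_inverseI[of _ r]) (rule r_inl)

lemma inl_\<epsilon>: "x \<in> T N \<Longrightarrow> inl (\<epsilon> x) = inr (x, 0)"
  by (rule inl_glue)

lemma inr_comm: "k \<in> T N \<Longrightarrow> l \<in> T N \<Longrightarrow> inr (k, m) \<otimes>\<^bsub>E\<^esub> inr (l, n) = inr (l, n) \<otimes>\<^bsub>E\<^esub> inr (k, m)"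
  by (simp flip: inr_mult add: K_comm add.commute)

text \<open>Letters of \<open>A\<close> obey the hypothesis \<open>normalize\<close>; letters of
  \<open>B\<close> commute with \<open>T N\<close> because \<open>B\<close> is abelian, and the
  retraction gives them matrix part one. So \<open>T N\<close> stays normal in the amalgam, with
  \<open>E\<close> acting on it through matrices, which carries the induction to the next
  stage.\<close>

lemma normalize_E:
  assumes "g \<in> carrier E" "x \<in> T N"
  shows "g \<otimes>\<^bsub>E\<^esub> inl (\<epsilon> x) = inl (\<epsilon> (K_act p (snd (\<rho> (r g))) x)) \<otimes>\<^bsub>E\<^esub> g"
  using assms
proof (induction g arbitrary: x rule: E_induct)
  case one
  have "r \<one>\<^bsub>E\<^esub> = \<one>\<^bsub>A\<^esub>" "\<rho> \<one>\<^bsub>A\<^esub> = \<one>\<^bsub>G0\<^esub>"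
    using hom_one[OF r_hom E.is_group A.is_group] hom_one[OF \<rho>_hom A.is_group group_G0] by simp_all
  then show ?case using one by (simp add: K_act_one)
next
  case (inl a h)
  have rr: "r (inl a \<otimes>\<^bsub>E\<^esub> h) = a \<otimes>\<^bsub>A\<^esub> r h"
    using inl.hyps r_hom by (auto simp: hom_def r_inl)
  let ?y = "K_act p (snd (\<rho> (r h))) x"
  have y: "?y \<in> T N" using inl.prems by (rule K_act_tail)
  have "inl a \<otimes>\<^bsub>E\<^esub> h \<otimes>\<^bsub>E\<^esub> inl (\<epsilon> x) = inl a \<otimes>\<^bsub>E\<^esub> (inl (\<epsilon> ?y) \<otimes>\<^bsub>E\<^esub> h)"
    using inl.hyps inl.prems inl.IH by (simp add: E.m_assoc)
  also have "\<dots> = inl (a \<otimes>\<^bsub>A\<^esub> \<epsilon> ?y) \<otimes>\<^bsub>E\<^esub> h"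
    using inl.hyps y by (simp add: E.m_assoc inl_mult)
  also have "\<dots> = inl (\<epsilon> (K_act p (snd (\<rho> a)) ?y)) \<otimes>\<^bsub>E\<^esub> (inl a \<otimes>\<^bsub>E\<^esub> h)"
    using inl.hyps y K_act_tail[OF y] by (simp add: normalize_\<epsilon> E.m_assoc inl_mult)
  finally show ?case
    using inl.hyps by (simp add: rr snd_\<rho>_mult r_closed K_act_act)
next
  case (inr b h)
  obtain k n where b: "b = (k, n)" "k \<in> T N" using inr.hyps by auto
  have rr: "r (inr b \<otimes>\<^bsub>E\<^esub> h) = \<epsilon> k \<otimes>\<^bsub>A\<^esub> r h"
    using inr.hyps r_hom b by (auto simp: hom_def r_inr)
  let ?y = "K_act p (snd (\<rho> (r h))) x"
  have y: "?y \<in> T N" using inr.prems by (rule K_act_tail)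
  have "inr b \<otimes>\<^bsub>E\<^esub> h \<otimes>\<^bsub>E\<^esub> inl (\<epsilon> x) = inr b \<otimes>\<^bsub>E\<^esub> (inl (\<epsilon> ?y) \<otimes>\<^bsub>E\<^esub> h)"
    using inr.hyps inr.prems inr.IH b by (simp add: E.m_assoc)
  also have "\<dots> = inr b \<otimes>\<^bsub>E\<^esub> inr (?y, 0) \<otimes>\<^bsub>E\<^esub> h"
    using inr.hyps y b by (simp add: E.m_assoc inl_\<epsilon>)
  also have "\<dots> = inr (?y, 0) \<otimes>\<^bsub>E\<^esub> (inr b \<otimes>\<^bsub>E\<^esub> h)"
    using inr.hyps y b by (simp add: E.m_assoc inr_comm[of k])
  moreover have "snd (\<rho> (r (inr b \<otimes>\<^bsub>E\<^esub> h))) = snd (\<rho> (r h))"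
    unfolding rr using inr.hyps b by (simp add: snd_\<rho>_mult snd_\<rho>_\<epsilon> r_closed)
  ultimately show ?case
    using y by (simp add: inl_\<epsilon>)
qed

lemma next_stage: "stage_group p (Suc N) E (inl \<circ> e) (\<rho> \<circ> r)"
proof (intro stage_group.intro stage_group_axioms.intro)
  show "inl \<circ> e \<in> hom G0 E" "\<rho> \<circ> r \<in> hom E G0"
    using hom_compose[OF e_hom inl_hom] hom_compose[OF r_hom \<rho>_hom] by auto
  show "(\<rho> \<circ> r) ((inl \<circ> e) x) = x" if "x \<in> carrier G0" for x
    using that e_hom by (auto simp: r_inl \<rho>_e)
  show "g \<otimes>\<^bsub>E\<^esub> (inl \<circ> e) (x, mat 1) = (inl \<circ> e) (K_act p (snd ((\<rho> \<circ> r) g)) x, mat 1) \<otimes>\<^bsub>E\<^esub> g"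
    if "g \<in> carrier E" "x \<in> T (Suc N)" for g x
    using normalize_E[of g x] K_tail_mono[of N "Suc N"] that by (auto simp: \<epsilon>_def)
qed (fact prime_seq_axioms group_E)+

subsection \<open>The action on the Bass--Serre tree\<close>

text \<open>
  A list \<open>[(\<gamma>\<^sub>1, n\<^sub>1), \<dots>, (\<gamma>\<^sub>k, n\<^sub>k)]\<close> of cosets \<open>\<gamma>\<^sub>i = a\<^sub>i N\<^sub>0\<close> and nonzero integers stands for the vertex
  \<open>a\<^sub>1 t\<^bsup>n\<^sub>1\<^esup> \<dots> a\<^sub>k t\<^bsup>n\<^sub>k\<^esup> A\<close>; the base vertex \<open>A\<close> is the empty list.
\<close>

definition N0 :: "g_elem set" where "N0 = \<epsilon> ` T N"

definition cosets :: "g_elem set set" where "cosets = {a <#\<^bsub>A\<^esub> N0 | a. a \<in> carrier A}"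

text \<open>Reduced lists: an \<open>N0\<close> behind the head would let two neighbouring powers of
  the stable letter merge. At the head it is allowed and records a path that starts with such a
  power.\<close>

definition vertices :: "(g_elem set \<times> int) list set" where
  "vertices = {ys. (\<forall>y\<in>set ys. fst y \<in> cosets \<and> snd y \<noteq> 0) \<and> (\<forall>y\<in>set (tl ys). fst y \<noteq> N0)}"

text \<open>Left multiplication by the n-th power of the stable letter, followed by the only
  possible reduction, which is at the head.\<close>

fun push :: "int \<Rightarrow> (g_elem set \<times> int) list \<Rightarrow> (g_elem set \<times> int) list" where
  "push n [] = (if n = 0 then [] else [(N0, n)])"
| "push n ((\<gamma>, m) # zs) = (if \<gamma> = N0 then (if n + m = 0 then zs else (N0, n + m) # zs)
     else (if n = 0 then (\<gamma>, m) # zs else (N0, n) # (\<gamma>, m) # zs))"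

text \<open>The component \<open>k\<close> of a letter of \<open>B\<close> is dropped because
  \<open>T N\<close> is normal in \<open>A\<close> and therefore fixes every coset, see
  \<open>\<epsilon>_coset\<close>.\<close>

fun tree_act :: "g_elem + k_elem \<times> int \<Rightarrow> (g_elem set \<times> int) list \<Rightarrow> (g_elem set \<times> int) list" where
  "tree_act (Inl a) [] = []"
| "tree_act (Inl a) ((\<gamma>, n) # zs) = (a <#\<^bsub>A\<^esub> \<gamma>, n) # zs"
| "tree_act (Inr (k, n)) ys = push n ys"

lemma N0_subset: "N0 \<subseteq> carrier A"
  by (auto simp: N0_def)

lemma coset_iff: "x \<in> a <#\<^bsub>A\<^esub> N0 \<longleftrightarrow> (\<exists>k\<in>T N. x = a \<otimes>\<^bsub>A\<^esub> \<epsilon> k)"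
  by (auto simp: l_coset_def N0_def)

lemma coset_\<epsilon>: "a \<in> carrier A \<Longrightarrow> k \<in> T N \<Longrightarrow> (a \<otimes>\<^bsub>A\<^esub> \<epsilon> k) <#\<^bsub>A\<^esub> N0 = a <#\<^bsub>A\<^esub> N0"
proof -
  assume a: "a \<in> carrier A" and k: "k \<in> T N"
  interpret K: group K by (rule group_K)
  interpret TN: subgroup "T N" K by (rule subgroup_tail)
  have "\<epsilon> k <#\<^bsub>A\<^esub> N0 = N0"
  proof (intro equalityI subsetI)
    fix x assume "x \<in> \<epsilon> k <#\<^bsub>A\<^esub> N0"
    then obtain l where "l \<in> T N" "x = \<epsilon> k \<otimes>\<^bsub>A\<^esub> \<epsilon> l" by (auto simp: coset_iff)
    then show "x \<in> N0" using k by (auto simp: N0_def \<epsilon>_mult[symmetric])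
  next
    fix x assume "x \<in> N0"
    then obtain l where l: "l \<in> T N" "x = \<epsilon> l" by (auto simp: N0_def)
    have "k \<otimes>\<^bsub>K\<^esub> (inv\<^bsub>K\<^esub> k \<otimes>\<^bsub>K\<^esub> l) = l" "inv\<^bsub>K\<^esub> k \<otimes>\<^bsub>K\<^esub> l \<in> T N"
      using k l by (auto simp flip: K.m_assoc)
    then show "x \<in> \<epsilon> k <#\<^bsub>A\<^esub> N0"
      using k l \<epsilon>_mult[of k "inv\<^bsub>K\<^esub> k \<otimes>\<^bsub>K\<^esub> l"] by (auto simp: coset_iff)
  qed
  then show ?thesis
    using A.lcos_m_assoc[OF N0_subset a, of "\<epsilon> k"] k by simp
qed

lemma \<epsilon>_coset:
  assumes "k \<in> T N" "\<gamma> \<in> cosets"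
  shows "\<epsilon> k <#\<^bsub>A\<^esub> \<gamma> = \<gamma>"
proof -
  obtain a where a: "a \<in> carrier A" "\<gamma> = a <#\<^bsub>A\<^esub> N0" using assms(2) by (auto simp: cosets_def)
  obtain l where l: "l \<in> T N" "K_act p (snd (\<rho> a)) l = k"
    using K_act_surj[OF det_\<rho>[OF a(1)] assms(1)] .
  have "\<epsilon> k <#\<^bsub>A\<^esub> \<gamma> = (\<epsilon> k \<otimes>\<^bsub>A\<^esub> a) <#\<^bsub>A\<^esub> N0"
    using a assms A.lcos_m_assoc[OF N0_subset] by simp
  also have "\<dots> = (a \<otimes>\<^bsub>A\<^esub> \<epsilon> l) <#\<^bsub>A\<^esub> N0"
    using normalize_\<epsilon>[OF a(1) l(1)] l by simp
  also have "\<dots> = \<gamma>" using a l by (simp add: coset_\<epsilon>)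
  finally show ?thesis .
qed

lemma one_coset: "\<gamma> \<in> cosets \<Longrightarrow> \<one>\<^bsub>A\<^esub> <#\<^bsub>A\<^esub> \<gamma> = \<gamma>"
  using \<epsilon>_coset[of zero_K] by (simp add: \<epsilon>_zero)

lemma N0_coset: "N0 = \<one>\<^bsub>A\<^esub> <#\<^bsub>A\<^esub> N0"
  using A.lcos_mult_one[OF N0_subset] by simp

lemma N0_in_cosets: "N0 \<in> cosets"
  unfolding cosets_def using N0_coset A.one_closed by blast

lemma coset_mult: "a \<in> carrier A \<Longrightarrow> b \<in> carrier A \<Longrightarrow> \<gamma> \<in> cosets \<Longrightarrow>
    a <#\<^bsub>A\<^esub> (b <#\<^bsub>A\<^esub> \<gamma>) = (a \<otimes>\<^bsub>A\<^esub> b) <#\<^bsub>A\<^esub> \<gamma>"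
  by (rule A.lcos_m_assoc) (auto simp: cosets_def coset_iff)

lemma coset_closed: "a \<in> carrier A \<Longrightarrow> \<gamma> \<in> cosets \<Longrightarrow> a <#\<^bsub>A\<^esub> \<gamma> \<in> cosets"
  using A.lcos_m_assoc[OF N0_subset] unfolding cosets_def by blast

lemma push_add: "ys \<in> vertices \<Longrightarrow> push (m + n) ys = push m (push n ys)"
proof (induction n ys rule: push.induct)
  case (1 n)
  show ?case by simp
next
  case (2 n \<gamma> k zs)
  show ?case
  proof (cases "\<gamma> = N0")
    case True
    \<comment> \<open>If \<open>n + k = 0\<close>, the remaining list is empty or starts with a
      coset other than \<open>N0\<close>, so the second push opens a new pair.\<close>
    then show ?thesis using 2 by (cases zs; cases "hd zs") (auto simp: vertices_def add.assoc)
  next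
    case False
    then show ?thesis by simp
  qed
qed

lemma push_closed: "ys \<in> vertices \<Longrightarrow> push n ys \<in> vertices"
  by (cases ys; cases "hd ys"; cases "tl ys") (simp_all add: vertices_def N0_in_cosets)

lemma push_zero: "ys \<in> vertices \<Longrightarrow> push 0 ys = ys"
  by (cases ys) (auto simp: vertices_def)

lemma tree_action: "amalgam_action A B (T N) \<epsilon> (\<lambda>x. (x, 0)) vertices tree_act"
proof unfold_locales
  fix l ys assume "l \<in> carrier A <+> carrier B" "ys \<in> vertices"
  then show "tree_act l ys \<in> vertices"
    by (cases "(l, ys)" rule: tree_act.cases) (auto simp: push_closed, auto simp: vertices_def coset_closed)
next
  fix a b ys assume "a \<in> carrier A" "b \<in> carrier A" "ys \<in> vertices"
  then show "tree_act (Inl (a \<otimes>\<^bsub>A\<^esub> b)) ys = tree_act (Inl a) (tree_act (Inl b) ys)"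
    by (cases ys) (auto simp: vertices_def coset_mult)
next
  fix b b' ys assume "b \<in> carrier B" "b' \<in> carrier B" "ys \<in> vertices"
  then show "tree_act (Inr (b \<otimes>\<^bsub>B\<^esub> b')) ys = tree_act (Inr b) (tree_act (Inr b') ys)"
    by (cases b; cases b') (simp add: push_add)
next
  fix ys assume "ys \<in> vertices"
  then show "tree_act (Inl \<one>\<^bsub>A\<^esub>) ys = ys"
    by (cases ys; cases "hd ys") (auto simp: vertices_def one_coset)
  show "tree_act (Inr \<one>\<^bsub>B\<^esub>) ys = ys"
    using \<open>ys \<in> vertices\<close> by (simp add: push_zero)
next
  fix c ys assume "c \<in> T N" "ys \<in> vertices"
  then show "tree_act (Inl (\<epsilon> c)) ys = tree_act (Inr (c, 0)) ys"
    by (cases ys) (auto simp: push_zero simp del: push.simps, auto simp: vertices_def \<epsilon>_coset)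
qed

interpretation tree: amalgam_action A B "T N" \<epsilon> "\<lambda>x. (x, 0)" vertices tree_act
  by (rule tree_action)

lemma Nil_vertex [simp]: "[] \<in> vertices"
  by (simp add: vertices_def)

abbreviation "t \<equiv> inr (zero_K, 1)"

lemma coset_eq_N0_iff: "a \<in> carrier A \<Longrightarrow> a <#\<^bsub>A\<^esub> N0 = N0 \<longleftrightarrow> a \<in> N0"
proof
  assume a: "a \<in> carrier A"
  have "a \<in> a <#\<^bsub>A\<^esub> N0" using a by (auto simp: coset_iff \<epsilon>_zero intro!: bexI[of _ zero_K])
  then show "a \<in> N0" if "a <#\<^bsub>A\<^esub> N0 = N0" using that by simp
  show "a <#\<^bsub>A\<^esub> N0 = N0" if "a \<in> N0"
    using that \<epsilon>_coset[OF _ N0_in_cosets] by (auto simp: N0_def)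
qed

lemma t_moves:
  assumes a: "a \<in> carrier A" and b: "b \<in> carrier A"
    and eq: "t \<otimes>\<^bsub>E\<^esub> inl a = inl b \<otimes>\<^bsub>E\<^esub> t"
  shows "a \<in> N0"
proof (rule ccontr)
  assume "a \<notin> N0"
  then have n: "a <#\<^bsub>A\<^esub> N0 \<noteq> N0" using coset_eq_N0_iff a by simp
  \<comment> \<open>The vertex reached from the base by the inverse of \<open>t\<close>. On the
    right side \<open>t\<close> brings it back to the base, which \<open>inl b\<close> fixes; on the
    left side \<open>a\<close> turns it away unless it lies in \<open>N0\<close>, and
    \<open>t\<close> moves it further out.\<close>
  let ?y = "[(N0, -1)]"
  have y: "?y \<in> vertices" by (simp add: vertices_def N0_in_cosets)
  have z: "[(a <#\<^bsub>A\<^esub> N0, -1)] \<in> vertices"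
    using a by (auto simp: vertices_def coset_closed N0_in_cosets)
  have "E_act tree_act (t \<otimes>\<^bsub>E\<^esub> inl a) ?y = [(N0, 1), (a <#\<^bsub>A\<^esub> N0, -1)]"
    using a y z n by (simp add: tree.E_act_mult tree.E_act_inl tree.E_act_inr)
  moreover have "E_act tree_act (inl b \<otimes>\<^bsub>E\<^esub> t) ?y = []"
    using b y by (simp add: tree.E_act_mult tree.E_act_inl tree.E_act_inr)
  ultimately show False using eq by simp
qed

subsection \<open>The stabilizer of the base vertex\<close>

definition same_vertex :: "g_elem \<Rightarrow> g_elem \<Rightarrow> bool" (infix \<open>\<doteq>\<close> 50) where
  "g \<doteq> h \<longleftrightarrow> g \<in> carrier E \<and> h \<in> carrier E \<and> (\<exists>a\<in>carrier A. g = h \<otimes>\<^bsub>E\<^esub> inl a)"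

lemma same_vertex_refl: "g \<in> carrier E \<Longrightarrow> g \<doteq> g"
  unfolding same_vertex_def by (auto intro!: bexI[of _ "\<one>\<^bsub>A\<^esub>"])

lemma same_vertex_trans [trans]: "g \<doteq> h \<Longrightarrow> h \<doteq> k \<Longrightarrow> g \<doteq> k"
  unfolding same_vertex_def by (auto simp: E.m_assoc simp flip: inl_mult)

lemma same_vertex_sym: "g \<doteq> h \<Longrightarrow> h \<doteq> g"
proof -
  assume "g \<doteq> h"
  then obtain a where a: "a \<in> carrier A" "g = h \<otimes>\<^bsub>E\<^esub> inl a" "g \<in> carrier E" "h \<in> carrier E"
    by (auto simp: same_vertex_def)
  then have "h = g \<otimes>\<^bsub>E\<^esub> inl (inv\<^bsub>A\<^esub> a)" by (simp add: E.m_assoc flip: inl_mult)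
  then show ?thesis using a by (auto simp: same_vertex_def intro!: bexI[of _ "inv\<^bsub>A\<^esub> a"])
qed

lemma same_vertex_mult: "k \<in> carrier E \<Longrightarrow> g \<doteq> h \<Longrightarrow> k \<otimes>\<^bsub>E\<^esub> g \<doteq> k \<otimes>\<^bsub>E\<^esub> h"
  unfolding same_vertex_def by (auto simp: E.m_assoc)

text \<open>By normality the factor from \<open>T N\<close> can be moved to the right of
  \<open>h\<close>, where \<open>A\<close> absorbs it.\<close>

lemma same_vertex_\<epsilon>:
  assumes "x \<in> T N" "h \<in> carrier E"
  shows "inl (\<epsilon> x) \<otimes>\<^bsub>E\<^esub> h \<doteq> h"
proof -
  obtain y where y: "y \<in> T N" "K_act p (snd (\<rho> (r h))) y = x"
    using K_act_surj[OF det_\<rho>[OF r_closed[OF assms(2)]] assms(1)] .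
  then have "inl (\<epsilon> x) \<otimes>\<^bsub>E\<^esub> h = h \<otimes>\<^bsub>E\<^esub> inl (\<epsilon> y)"
    using normalize_E[OF assms(2) y(1)] by simp
  then show ?thesis using assms y by (auto simp: same_vertex_def)
qed

definition rep :: "g_elem set \<Rightarrow> g_elem" where "rep \<gamma> = (SOME a. a \<in> \<gamma>)"

text \<open>A section of the orbit map: \<open>sec ys\<close> carries the base vertex to
  \<open>ys\<close>. The choices made by \<open>rep\<close> change it only by a right factor from
  \<open>A\<close>, which the relation \<open>\<doteq>\<close> ignores.\<close>

fun sec :: "(g_elem set \<times> int) list \<Rightarrow> g_elem" where
  "sec [] = \<one>\<^bsub>E\<^esub>"
| "sec ((\<gamma>, n) # zs) = inl (rep \<gamma>) \<otimes>\<^bsub>E\<^esub> (inr (zero_K, n) \<otimes>\<^bsub>E\<^esub> sec zs)"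

lemma rep_coset:
  assumes "a \<in> carrier A"
  obtains k where "k \<in> T N" "rep (a <#\<^bsub>A\<^esub> N0) = a \<otimes>\<^bsub>A\<^esub> \<epsilon> k"
proof -
  have "a \<otimes>\<^bsub>A\<^esub> \<epsilon> zero_K \<in> a <#\<^bsub>A\<^esub> N0" unfolding coset_iff using zero_in_tail by blast
  then have "rep (a <#\<^bsub>A\<^esub> N0) \<in> a <#\<^bsub>A\<^esub> N0" unfolding rep_def by (rule someI)
  then show ?thesis using that unfolding coset_iff by blast
qed

lemma sec_closed: "ys \<in> vertices \<Longrightarrow> sec ys \<in> carrier E"
proof (induction ys rule: sec.induct)
  case (2 \<gamma> n zs)
  then have "zs \<in> vertices" by (cases zs) (auto simp: vertices_def)
  moreover obtain a where a: "a \<in> carrier A" "\<gamma> = a <#\<^bsub>A\<^esub> N0"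
    using 2 by (auto simp: vertices_def cosets_def)
  moreover obtain k where "k \<in> T N" "rep \<gamma> = a \<otimes>\<^bsub>A\<^esub> \<epsilon> k" using rep_coset[OF a(1)] a(2) by metis
  ultimately show ?case using 2 by simp
qed simp

lemma sec_Cons:
  assumes "a \<in> carrier A" "sec zs \<in> carrier E"
  shows "sec ((a <#\<^bsub>A\<^esub> N0, n) # zs) \<doteq> inl a \<otimes>\<^bsub>E\<^esub> (inr (zero_K, n) \<otimes>\<^bsub>E\<^esub> sec zs)"
proof -
  obtain k where k: "k \<in> T N" "rep (a <#\<^bsub>A\<^esub> N0) = a \<otimes>\<^bsub>A\<^esub> \<epsilon> k" using rep_coset[OF assms(1)] .
  have "inl (\<epsilon> k) \<otimes>\<^bsub>E\<^esub> (inr (zero_K, n) \<otimes>\<^bsub>E\<^esub> sec zs) \<doteq> inr (zero_K, n) \<otimes>\<^bsub>E\<^esub> sec zs"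
    using assms k by (intro same_vertex_\<epsilon>) auto
  then have "inl a \<otimes>\<^bsub>E\<^esub> (inl (\<epsilon> k) \<otimes>\<^bsub>E\<^esub> (inr (zero_K, n) \<otimes>\<^bsub>E\<^esub> sec zs)) \<doteq>
      inl a \<otimes>\<^bsub>E\<^esub> (inr (zero_K, n) \<otimes>\<^bsub>E\<^esub> sec zs)"
    using assms by (intro same_vertex_mult) auto
  then show ?thesis using assms k by (simp add: inl_mult E.m_assoc)
qed

lemma sec_push:
  assumes "ys \<in> vertices"
  shows "inr (zero_K, n) \<otimes>\<^bsub>E\<^esub> sec ys \<doteq> sec (push n ys)"
proof -
  have c: "sec ys \<in> carrier E" "inr (zero_K, n) \<in> carrier E"
    using assms by (auto intro: sec_closed)
  have N0_Cons: "sec ((N0, m) # zs) \<doteq> inr (zero_K, m) \<otimes>\<^bsub>E\<^esub> sec zs" if "sec zs \<in> carrier E" for m zs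
    using sec_Cons[of "\<one>\<^bsub>A\<^esub>" zs m] that by (simp flip: N0_coset)
  show ?thesis
  proof (cases "\<exists>m zs. ys = (N0, m) # zs")
    case True
    then obtain m zs where ys: "ys = (N0, m) # zs" by blast
    then have zs: "sec zs \<in> carrier E"
      using assms by (intro sec_closed) (cases zs; auto simp: vertices_def)
    have "inr (zero_K, n) \<otimes>\<^bsub>E\<^esub> sec ys \<doteq> inr (zero_K, n) \<otimes>\<^bsub>E\<^esub> (inr (zero_K, m) \<otimes>\<^bsub>E\<^esub> sec zs)"
      unfolding ys using N0_Cons[OF zs] by (intro same_vertex_mult) auto
    also have "inr (zero_K, n) \<otimes>\<^bsub>E\<^esub> (inr (zero_K, m) \<otimes>\<^bsub>E\<^esub> sec zs) = inr (zero_K, n + m) \<otimes>\<^bsub>E\<^esub> sec zs"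
      using inr_mult[of zero_K zero_K n m] zs by (simp add: E.m_assoc)
    also have "inr (zero_K, n + m) \<otimes>\<^bsub>E\<^esub> sec zs \<doteq> sec (push n ys)"
      using N0_Cons[OF zs, of "n + m"] zs
      by (auto simp: ys same_vertex_refl intro: same_vertex_sym simp del: sec.simps(2))
    finally show ?thesis .
  next
    case False
    then have "push n ys = (if n = 0 then ys else (N0, n) # ys)" by (cases ys) auto
    then show ?thesis
      using N0_Cons[OF c(1), of n] c
      by (auto simp: same_vertex_refl intro: same_vertex_sym simp del: sec.simps(2))
  qed
qed

text \<open>Equivariance of the section is what identifies the stabilizer: at the empty list it says
  that an element fixing the base vertex differs from the identity by a right factor from
  \<open>A\<close>.\<close>

lemma sec_tree_act:
  assumes "g \<in> carrier E" "ys \<in> vertices"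
  shows "g \<otimes>\<^bsub>E\<^esub> sec ys \<doteq> sec (E_act tree_act g ys)"
  using assms
proof (induction g rule: E_induct)
  case one
  then show ?case by (simp add: tree.E_act_one sec_closed same_vertex_refl)
next
  case (inl a h)
  let ?zs = "E_act tree_act h ys"
  have zs: "?zs \<in> vertices" using inl by (intro tree.E_act_closed)
  have "inl a \<otimes>\<^bsub>E\<^esub> h \<otimes>\<^bsub>E\<^esub> sec ys \<doteq> inl a \<otimes>\<^bsub>E\<^esub> sec ?zs"
    using inl sec_closed[of ys] same_vertex_mult[of "inl a"] by (simp add: E.m_assoc)
  also have "inl a \<otimes>\<^bsub>E\<^esub> sec ?zs \<doteq> sec (tree_act (Inl a) ?zs)"
  proof (cases ?zs)
    case Nil
    then show ?thesis using inl by (auto simp: same_vertex_def)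
  next
    case (Cons y ws)
    obtain \<gamma> n where y: "y = (\<gamma>, n)" by (cases y)
    obtain b where b: "b \<in> carrier A" "\<gamma> = b <#\<^bsub>A\<^esub> N0"
      using zs Cons y by (auto simp: vertices_def cosets_def)
    have ws: "sec ws \<in> carrier E"
      using zs Cons by (intro sec_closed) (cases ws; auto simp: vertices_def)
    have "inl a \<otimes>\<^bsub>E\<^esub> sec ?zs \<doteq> inl a \<otimes>\<^bsub>E\<^esub> (inl b \<otimes>\<^bsub>E\<^esub> (inr (zero_K, n) \<otimes>\<^bsub>E\<^esub> sec ws))"
      unfolding Cons y b(2) using inl b ws by (intro same_vertex_mult sec_Cons) auto
    also have "\<dots> = inl (a \<otimes>\<^bsub>A\<^esub> b) \<otimes>\<^bsub>E\<^esub> (inr (zero_K, n) \<otimes>\<^bsub>E\<^esub> sec ws)"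
      using inl b ws by (simp add: inl_mult E.m_assoc)
    also have "\<dots> \<doteq> sec (((a \<otimes>\<^bsub>A\<^esub> b) <#\<^bsub>A\<^esub> N0, n) # ws)"
      using inl b ws by (intro same_vertex_sym[OF sec_Cons]) auto
    also have "((a \<otimes>\<^bsub>A\<^esub> b) <#\<^bsub>A\<^esub> N0, n) # ws = tree_act (Inl a) ?zs"
      using inl b by (simp add: Cons y coset_mult N0_in_cosets)
    finally show ?thesis .
  qed
  finally show ?case
    using inl zs by (simp add: tree.E_act_mult tree.E_act_inl)
next
  case (inr b h)
  obtain k n where b: "b = (k, n)" "k \<in> T N" using inr.hyps by auto
  let ?zs = "E_act tree_act h ys"
  have zs: "?zs \<in> vertices" using inr by (intro tree.E_act_closed)
  have "inr b \<otimes>\<^bsub>E\<^esub> h \<otimes>\<^bsub>E\<^esub> sec ys \<doteq> inr b \<otimes>\<^bsub>E\<^esub> sec ?zs"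
    using inr b sec_closed[of ys] same_vertex_mult[of "inr b"] by (simp add: E.m_assoc)
  also have "inr b \<otimes>\<^bsub>E\<^esub> sec ?zs = inl (\<epsilon> k) \<otimes>\<^bsub>E\<^esub> (inr (zero_K, n) \<otimes>\<^bsub>E\<^esub> sec ?zs)"
    using b sec_closed[OF zs] inr_mult[of k zero_K 0 n] by (simp add: inl_\<epsilon> E.m_assoc)
  also have "\<dots> \<doteq> inr (zero_K, n) \<otimes>\<^bsub>E\<^esub> sec ?zs"
    using b sec_closed[OF zs] by (intro same_vertex_\<epsilon>) auto
  also have "\<dots> \<doteq> sec (push n ?zs)" using zs by (rule sec_push)
  finally show ?case
    using inr zs b by (simp add: tree.E_act_mult tree.E_act_inr)
qed

lemma base_stabilizer:
  assumes "g \<in> carrier E" "E_act tree_act g [] = []"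
  shows "g \<in> inl ` carrier A"
  using sec_tree_act[OF assms(1), of "[]"] assms by (auto simp: same_vertex_def)

text \<open>The path from the base to the vertex of \<open>g\<close> begins with a coset of
  \<open>N0\<close>, whose elements all have the same matrix part. Left factors from
  \<open>A\<close> move that coset, right factors do not change the vertex. The first column is
  taken only to turn an invertible matrix into a nonzero vector.\<close>

definition head_vec :: "g_elem \<Rightarrow> int^3" where
  "head_vec g = snd (\<rho> (rep (fst (hd (E_act tree_act g []))))) *v axis 1 1"

lemma snd_\<rho>_rep: "a \<in> carrier A \<Longrightarrow> snd (\<rho> (rep (a <#\<^bsub>A\<^esub> N0))) = snd (\<rho> a)"
  using rep_coset[of a] by (metis \<epsilon>_closed matrix_mul_rid snd_\<rho>_\<epsilon> snd_\<rho>_mult tail_K)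

lemma head_vec:
  assumes g: "g \<in> carrier E" "g \<notin> inl ` carrier A"
  shows head_vec_nonzero: "head_vec g \<noteq> 0"
    and head_vec_mult: "a \<in> carrier A \<Longrightarrow> b \<in> carrier A \<Longrightarrow>
      head_vec (inl a \<otimes>\<^bsub>E\<^esub> g \<otimes>\<^bsub>E\<^esub> inl b) = snd (\<rho> a) *v head_vec g"
proof -
  have "E_act tree_act g [] \<in> vertices" "E_act tree_act g [] \<noteq> []"
    using g tree.E_act_closed base_stabilizer by auto
  then obtain c n zs where c: "c \<in> carrier A" "E_act tree_act g [] = (c <#\<^bsub>A\<^esub> N0, n) # zs"
    by (cases "E_act tree_act g []") (auto simp: vertices_def cosets_def)
  have v: "head_vec g = snd (\<rho> c) *v axis 1 1"
    by (simp add: head_vec_def c snd_\<rho>_rep)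
  show "head_vec g \<noteq> 0"
  proof
    assume 0: "head_vec g = 0"
    obtain M where M: "M ** snd (\<rho> c) = mat 1" using SL3Z_inverse[OF det_\<rho>[OF c(1)]] by metis
    have "axis 1 1 = M *v head_vec g"
      unfolding v matrix_vector_mul_assoc M by simp
    also have "\<dots> = 0" by (simp add: 0)
    finally have "(axis 1 1 :: int^3) $ 1 = 0 $ 1" by simp
    then show False by simp
  qed
  assume a: "a \<in> carrier A" and b: "b \<in> carrier A"
  have "E_act tree_act (inl a \<otimes>\<^bsub>E\<^esub> g \<otimes>\<^bsub>E\<^esub> inl b) [] = tree_act (Inl a) (E_act tree_act g [])"
    using a b g tree.E_act_closed by (simp add: tree.E_act_mult tree.E_act_inl)
  then show "head_vec (inl a \<otimes>\<^bsub>E\<^esub> g \<otimes>\<^bsub>E\<^esub> inl b) = snd (\<rho> a) *v head_vec g"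
    unfolding v using a c
    by (simp add: head_vec_def coset_mult N0_in_cosets snd_\<rho>_rep snd_\<rho>_mult matrix_vector_mul_assoc)
qed

end

section \<open>The limit group\<close>

text \<open>The interface between algebra and analysis. Of the stable letters only
  \<open>t_moves\<close> is kept, of the normality of the tails only \<open>conj_tail\<close>, and
  of the trees only the equivariant vector \<open>\<phi>\<close>.\<close>

locale vaes_group = prime_seq p + group G
  for p :: "nat \<Rightarrow> nat" and G :: "('a, 'm) monoid_scheme" (structure) +
  fixes e :: "g0_elem \<Rightarrow> 'a" and t :: "nat \<Rightarrow> 'a" and \<phi> :: "'a \<Rightarrow> int^3"
  assumes inj_p: "inj p"
    and countable_G: "countable (carrier G)"
    and e_hom: "e \<in> hom G0 G" and e_inj: "inj_on e (carrier G0)"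
    and t_closed: "t N \<in> carrier G"
    and conj_tail: "g \<in> carrier G \<Longrightarrow> \<exists>N M. det M = 1 \<and>
      (\<forall>x\<in>T N. g \<otimes> e (x, mat 1) \<otimes> inv g = e (K_act p M x, mat 1))"
    and t_moves: "x \<in> carrier K \<Longrightarrow> x \<notin> T N \<Longrightarrow> y \<in> carrier K \<Longrightarrow>
      t N \<otimes> e (x, mat 1) \<otimes> inv (t N) \<noteq> e (y, mat 1)"
    and \<phi>_nonzero: "g \<in> carrier G \<Longrightarrow> g \<notin> e ` carrier G0 \<Longrightarrow> \<phi> g \<noteq> 0"
    and \<phi>_conj: "g \<in> carrier G \<Longrightarrow> g \<notin> e ` carrier G0 \<Longrightarrow> det M = 1 \<Longrightarrow>
      \<phi> (e (zero_K, M) \<otimes> g \<otimes> inv (e (zero_K, M))) = M *v \<phi> g"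

section \<open>The tower of stages and its limit\<close>

context prime_seq
begin

definition stages :: "nat \<Rightarrow> g_elem monoid" where "stages N = fst (stage p N)"
definition embed :: "nat \<Rightarrow> g0_elem \<Rightarrow> g_elem" where "embed N = snd (stage p N)"
definition link :: "nat \<Rightarrow> g_elem \<Rightarrow> g_elem" where "link N = stage_inl p N (stage p N)"

fun un_Base :: "g_elem \<Rightarrow> g0_elem" where
  "un_Base (Base x) = x"
| "un_Base (Word w) = undefined"

lemma stage_group_zero: "stage_group p 0 (image_group Base G0) Base un_Base"
proof (intro stage_group.intro stage_group_axioms.intro)
  have inj: "inj_on (Base :: g0_elem \<Rightarrow> g_elem) (carrier G0)" by (auto simp: inj_on_def)
  show "group (image_group (Base :: g0_elem \<Rightarrow> g_elem) G0)"
    by (rule group.inj_imp_image_group_is_group[OF group_G0 inj])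
  show hom: "(Base :: g0_elem \<Rightarrow> g_elem) \<in> hom G0 (image_group Base G0)"
    using inj_imp_image_group_iso[OF inj] by (simp add: iso_def del: G0_simps)
  show "un_Base \<in> hom (image_group Base G0) G0"
  proof (rule homI)
    fix a b :: g_elem
    assume "a \<in> carrier (image_group Base G0)" "b \<in> carrier (image_group Base G0)"
    then obtain x y where "a = Base x" "x \<in> carrier G0" "b = Base y" "y \<in> carrier G0"
      unfolding image_group_carrier by blast
    then show "un_Base (a \<otimes>\<^bsub>image_group Base G0\<^esub> b) =
        un_Base a \<otimes>\<^bsub>G0\<^esub> un_Base b"
      by (simp flip: hom_mult[OF hom] del: G0_simps)
  qed (auto simp: image_group_carrier)
  fix g :: g_elem and x assume "g \<in> carrier (image_group Base G0)" and x: "x \<in> T 0"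
  then obtain y M where g: "g = Base (y, M)" "y \<in> carrier K" "det M = 1"
    unfolding image_group_carrier by auto
  have x': "x \<in> carrier K" using x by (simp add: K_tail_iff)
  show "g \<otimes>\<^bsub>image_group Base G0\<^esub> Base (x, mat 1) =
      Base (K_act p (snd (un_Base g)) x, mat 1) \<otimes>\<^bsub>image_group Base G0\<^esub> g"
    using g x' K_act_closed[OF x', of M] hom_mult[OF hom, of "(y, M)" "(x, mat 1)"]
      hom_mult[OF hom, of "(K_act p M x, mat 1)" "(y, M)"]
    by (simp add: K_act_one K_comm)
qed (auto intro: prime_seq_axioms)

text \<open>Each retraction is built inside the locale of the previous stage, so the induction
  carries mere existence; \<open>retraction\<close> then fixes one per stage.\<close>

lemma ex_retraction: "\<exists>\<rho>. stage_group p N (stages N) (embed N) \<rho>"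
proof (induction N)
  case 0
  show ?case using stage_group_zero by (auto simp: stages_def embed_def)
next
  case (Suc N)
  then obtain \<rho> where "stage_group p N (stages N) (embed N) \<rho>" by blast
  then interpret stage_group p N "stages N" "embed N" \<rho> .
  have "stages (Suc N) = E" "embed (Suc N) = inl \<circ> embed N"
    using next_stage_eq(1) by (simp_all add: stages_def embed_def)
  then show ?case using next_stage by metis
qed

definition retraction :: "nat \<Rightarrow> g_elem \<Rightarrow> g0_elem" where
  "retraction N = (SOME \<rho>. stage_group p N (stages N) (embed N) \<rho>)"

lemma stage_group: "stage_group p N (stages N) (embed N) (retraction N)"
  unfolding retraction_def by (rule someI_ex[OF ex_retraction])

sublocale S: stage_group p N "stages N" "embed N" "retraction N" for N
  by (rule stage_group)

lemma link_eq: "S.inl N = link N" and stages_Suc: "S.E N = stages (Suc N)"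
  and embed_Suc: "embed (Suc N) = link N \<circ> embed N"
  using S.next_stage_eq[of N] by (simp_all add: stages_def embed_def link_def)

sublocale seq: group_sequence stages link
proof (rule group_sequence.intro)
  show "group (stages n)" for n by (rule S.group_A)
  show "link n \<in> hom (stages n) (stages (Suc n))" for n
    using S.inl_hom[of n] by (simp add: link_eq stages_Suc)
  show "inj_on (link n) (carrier (stages n))" for n
    using S.inl_inj[of n] by (simp add: link_eq)
qed

lemma G_group_eq: "G_group p = seq.L"
  by (simp add: G_group_def stages_def[abs_def] link_def[abs_def])

lemma countable_stages: "countable (carrier (stages N))"
proof (induction N)
  case 0
  have "stages 0 = image_group Base G0" by (simp add: stages_def)
  then show ?case using countable_G0 by (simp add: image_group_carrier del: G0_simps)
next
  case (Suc N)
  have "carrier K \<subseteq> fst ` carrier G0"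
  proof
    fix x assume "x \<in> carrier K"
    then show "x \<in> fst ` carrier G0" by (intro image_eqI[of _ _ "(x, mat 1)"]) auto
  qed
  then have "countable (T N)"
    using countable_G0 by (meson K_tail_iff countable_image countable_subset subsetI)
  then show ?case
    unfolding stages_Suc[symmetric] S.carrier_E
    by (intro countable_image countable_amalg_words Suc) simp
qed

abbreviation "limit_e \<equiv> \<lambda>x. seq.j 0 (Base x)"
abbreviation "limit_t \<equiv> \<lambda>N. seq.j (Suc N) (S.inr N (zero_K, 1))"

lemma embed_closed: "x \<in> carrier G0 \<Longrightarrow> embed N x \<in> carrier (stages N)"
  using S.e_hom[of N] by (rule hom_in_carrier)

lemma j_embed: "x \<in> carrier G0 \<Longrightarrow> seq.j N (embed N x) = limit_e x"
proof (induction N)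
  case 0
  show ?case by (simp add: embed_def)
next
  case (Suc N)
  then show ?case using seq.j_\<iota>[OF embed_closed] by (simp add: embed_Suc)
qed

text \<open>The shift by one matters: an element outside \<open>G0\<close> with level
  \<open>n\<close> lies in stage \<open>n + 1\<close> but not in stage \<open>n\<close>, which is
  exactly where \<open>head_vec\<close> of stage \<open>n\<close> is nonzero and equivariant. For
  \<open>n = 0\<close> this uses that stage 0 is \<open>G0\<close>.\<close>

definition level :: "(nat \<times> g_elem) set \<Rightarrow> nat" where
  "level X = (LEAST N. X \<in> seq.j (Suc N) ` carrier (stages (Suc N)))"

definition limit_\<phi> :: "(nat \<times> g_elem) set \<Rightarrow> int^3" where
  "limit_\<phi> X = S.head_vec (level X)
     (inv_into (carrier (stages (Suc (level X)))) (seq.j (Suc (level X))) X)"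

lemma limit_\<phi>:
  assumes X: "X \<in> carrier seq.L" "X \<notin> limit_e ` carrier G0"
  shows "limit_\<phi> X \<noteq> 0"
    and "det M = 1 \<Longrightarrow> limit_\<phi> (limit_e (zero_K, M) \<otimes>\<^bsub>seq.L\<^esub> X \<otimes>\<^bsub>seq.L\<^esub> inv\<^bsub>seq.L\<^esub> limit_e (zero_K, M)) =
      M *v limit_\<phi> X"
proof -
  interpret L: group seq.L by (rule seq.group_limit)
  define n where "n = level X"
  let ?im = "\<lambda>N. seq.j N ` carrier (stages N)"
  obtain k where "X \<in> ?im k" using X by (auto simp: seq.carrier_limit)
  then have "X \<in> ?im (Suc k)" using seq.j_range_mono[of k "Suc k"] by auto
  then have N: "X \<in> ?im (Suc n)" unfolding n_def level_def by (rule LeastI)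
  have notN: "X \<notin> ?im n"
  proof (cases n)
    case 0
    have "carrier (stages 0) = Base ` carrier G0" by (simp add: stages_def image_group_carrier)
    then show ?thesis using X(2) 0 by auto
  next
    case (Suc m)
    then show ?thesis using not_less_Least[of m "\<lambda>N. X \<in> ?im (Suc N)"] by (auto simp: n_def level_def)
  qed
  obtain x where x: "x \<in> carrier (stages (Suc n))" "X = seq.j (Suc n) x" using N by auto
  have xE: "x \<in> carrier (S.E n)" using x by (simp add: stages_Suc)
  have xnot: "x \<notin> S.inl n ` carrier (stages n)"
    using notN x(2) seq.j_\<iota> by (auto simp: link_eq)
  have \<phi>X: "limit_\<phi> X = S.head_vec n x"
    unfolding limit_\<phi>_def n_def[symmetric] inv_into_f_eq[OF seq.j_inj x(1) x(2)[symmetric]] ..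
  show "limit_\<phi> X \<noteq> 0" unfolding \<phi>X by (rule S.head_vec_nonzero[OF xE xnot])
  assume M: "det M = 1"
  define a where "a = embed n (zero_K, M)"
  have a: "a \<in> carrier (stages n)" using M by (simp add: a_def)
  interpret A: group "stages n" by (rule S.group_A)
  interpret E: group "S.E n" by (rule S.group_E)
  let ?c = "limit_e (zero_K, M)"
  have c: "?c = seq.j n a" "?c = seq.j (Suc n) (S.inl n a)"
    using M a j_embed[of "(zero_K, M)"] seq.j_\<iota>[OF a] by (simp_all add: a_def link_eq)
  have inv_c: "inv\<^bsub>seq.L\<^esub> ?c = seq.j n (inv\<^bsub>stages n\<^esub> a)"
    "inv\<^bsub>seq.L\<^esub> ?c = seq.j (Suc n) (S.inl n (inv\<^bsub>stages n\<^esub> a))"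
  proof -
    show "inv\<^bsub>seq.L\<^esub> ?c = seq.j n (inv\<^bsub>stages n\<^esub> a)"
      unfolding c(1) using a by (intro L.inv_equality) (simp_all add: seq.mult_j seq.j_one)
    then show "inv\<^bsub>seq.L\<^esub> ?c = seq.j (Suc n) (S.inl n (inv\<^bsub>stages n\<^esub> a))"
      unfolding link_eq using seq.j_\<iota>[of "inv\<^bsub>stages n\<^esub> a" n] a by simp
  qed
  let ?Y = "?c \<otimes>\<^bsub>seq.L\<^esub> X \<otimes>\<^bsub>seq.L\<^esub> inv\<^bsub>seq.L\<^esub> ?c"
  let ?y = "S.inl n a \<otimes>\<^bsub>S.E n\<^esub> x \<otimes>\<^bsub>S.E n\<^esub> S.inl n (inv\<^bsub>stages n\<^esub> a)"
  have y: "?y \<in> carrier (stages (Suc n))" "?Y = seq.j (Suc n) ?y"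
  proof -
    have "S.inl n a \<in> carrier (stages (Suc n))" "S.inl n (inv\<^bsub>stages n\<^esub> a) \<in> carrier (stages (Suc n))"
      using a by (simp_all flip: stages_Suc)
    then show "?y \<in> carrier (stages (Suc n))" "?Y = seq.j (Suc n) ?y"
      unfolding inv_c(2) unfolding c(2) x(2) using x(1)
      by (simp_all add: stages_Suc seq.mult_j seq.group_G group.is_monoid monoid.m_closed)
  qed
  \<comment> \<open>The conjugating element comes from \<open>G0\<close> and so lies in every stage;
    undoing the conjugation stays in stage \<open>m\<close>. Hence conjugation cannot lower the
    level.\<close>
  have lev: "Z \<in> ?im m" if Z: "?c \<otimes>\<^bsub>seq.L\<^esub> Z \<otimes>\<^bsub>seq.L\<^esub> inv\<^bsub>seq.L\<^esub> ?c \<in> ?im m" "Z \<in> carrier seq.L" for Z m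
  proof -
    define b where "b = embed m (zero_K, M)"
    interpret Am: group "stages m" by (rule S.group_A)
    have b: "b \<in> carrier (stages m)" "?c = seq.j m b"
      using M j_embed[of "(zero_K, M)" m] by (simp_all add: b_def)
    have ib: "inv\<^bsub>seq.L\<^esub> ?c = seq.j m (inv\<^bsub>stages m\<^esub> b)"
      unfolding b(2) using b(1) by (intro L.inv_equality) (simp_all add: seq.mult_j seq.j_one)
    obtain w where w: "?c \<otimes>\<^bsub>seq.L\<^esub> Z \<otimes>\<^bsub>seq.L\<^esub> inv\<^bsub>seq.L\<^esub> ?c = seq.j m w" "w \<in> carrier (stages m)"
      using Z(1) by (rule imageE)
    have cc: "?c \<in> carrier seq.L" using b by simp
    have "Z = inv\<^bsub>seq.L\<^esub> ?c \<otimes>\<^bsub>seq.L\<^esub> (?c \<otimes>\<^bsub>seq.L\<^esub> Z \<otimes>\<^bsub>seq.L\<^esub> inv\<^bsub>seq.L\<^esub> ?c) \<otimes>\<^bsub>seq.L\<^esub> ?c"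
      using Z(2) cc by (simp add: L.m_assoc) (simp flip: L.m_assoc)
    also have "\<dots> = seq.j m (inv\<^bsub>stages m\<^esub> b) \<otimes>\<^bsub>seq.L\<^esub> seq.j m w \<otimes>\<^bsub>seq.L\<^esub> seq.j m b"
      by (simp only: w(1), simp only: ib, simp only: b(2))
    also have "\<dots> \<in> ?im m"
      using w b by (simp add: seq.mult_j)
    finally show ?thesis .
  qed
  have levY: "level ?Y = n"
    unfolding level_def[of ?Y]
  proof (rule Least_equality)
    show "?Y \<in> ?im (Suc n)" using y by simp
    fix k assume "?Y \<in> ?im (Suc k)"
    then have "X \<in> ?im (Suc k)" using X lev by blast
    then show "n \<le> k" unfolding n_def level_def by (rule Least_le)
  qed
  have inv_Y: "inv_into (carrier (stages (Suc n))) (seq.j (Suc n)) ?Y = ?y"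
    using seq.j_inj y(1) by (rule inv_into_f_eq) (rule y(2)[symmetric])
  have "limit_\<phi> ?Y = S.head_vec n (inv_into (carrier (stages (Suc n))) (seq.j (Suc n)) ?Y)"
    by (rule limit_\<phi>_def[of ?Y, unfolded levY])
  also have "\<dots> = S.head_vec n ?y"
    by (rule arg_cong[OF inv_Y])
  also have "\<dots> = M *v limit_\<phi> X"
    unfolding \<phi>X using S.head_vec_mult[OF xE xnot a, of "inv\<^bsub>stages n\<^esub> a"] a M S.\<rho>_e[of "(zero_K, M)" n]
    by (simp add: a_def)
  finally show "limit_\<phi> ?Y = M *v limit_\<phi> X" .
qed

lemma vaes_group:
  assumes "inj p"
  shows "vaes_group p (G_group p) limit_e limit_t limit_\<phi>"
proof -
  interpret L: group seq.L by (rule seq.group_limit)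
  have e_closed: "limit_e x \<in> carrier seq.L" if "x \<in> carrier G0" for x
    using embed_closed[OF that, of 0] seq.j_closed by (simp add: embed_def)
  have t_closed: "S.inr N (zero_K, 1) \<in> carrier (stages (Suc N))" for N
    by (simp flip: stages_Suc)
  have conj: "\<exists>N M. det M = 1 \<and> (\<forall>x\<in>T N. g \<otimes>\<^bsub>seq.L\<^esub> limit_e (x, mat 1) \<otimes>\<^bsub>seq.L\<^esub> inv\<^bsub>seq.L\<^esub> g =
      limit_e (K_act p M x, mat 1))" if g: "g \<in> carrier seq.L" for g
  proof -
    obtain N a where a: "a \<in> carrier (stages N)" "g = seq.j N a"
      using g by (auto simp: seq.carrier_limit)
    let ?M = "snd (retraction N a)"
    have "g \<otimes>\<^bsub>seq.L\<^esub> limit_e (x, mat 1) \<otimes>\<^bsub>seq.L\<^esub> inv\<^bsub>seq.L\<^esub> g = limit_e (K_act p ?M x, mat 1)"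
      if x: "x \<in> T N" for x
    proof -
      have x': "x \<in> carrier K" "K_act p ?M x \<in> carrier K"
        using x K_act_tail[OF x] by (simp_all add: K_tail_iff)
      have "g \<otimes>\<^bsub>seq.L\<^esub> limit_e (x, mat 1) = limit_e (K_act p ?M x, mat 1) \<otimes>\<^bsub>seq.L\<^esub> g"
        using S.normalize[OF a(1) x] a x' j_embed[of "(x, mat 1)" N, symmetric]
          j_embed[of "(K_act p ?M x, mat 1)" N, symmetric]
        by (simp add: seq.mult_j)
      then show ?thesis
        using g x' e_closed by (simp add: L.m_assoc)
    qed
    then show ?thesis using S.det_\<rho>[OF a(1)] by blast
  qed
  have moves: "limit_t N \<otimes>\<^bsub>seq.L\<^esub> limit_e (x, mat 1) \<otimes>\<^bsub>seq.L\<^esub> inv\<^bsub>seq.L\<^esub> limit_t N \<noteq> limit_e (y, mat 1)"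
    if x: "x \<in> carrier K" "x \<notin> T N" and y: "y \<in> carrier K" for x y N
  proof
    assume eq: "limit_t N \<otimes>\<^bsub>seq.L\<^esub> limit_e (x, mat 1) \<otimes>\<^bsub>seq.L\<^esub> inv\<^bsub>seq.L\<^esub> limit_t N = limit_e (y, mat 1)"
    interpret E: group "stages (Suc N)" by (rule S.group_A)
    have c: "limit_t N \<in> carrier seq.L" "limit_e (x, mat 1) \<in> carrier seq.L"
      using x y t_closed e_closed[of "(x, mat 1)"] by simp_all
    have xy: "embed N (x, mat 1) \<in> carrier (stages N)" "embed N (y, mat 1) \<in> carrier (stages N)"
      using x y by simp_all
    have l: "link N (embed N (x, mat 1)) \<in> carrier (stages (Suc N))"
        "link N (embed N (y, mat 1)) \<in> carrier (stages (Suc N))"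
      using hom_in_carrier[OF seq.hom_\<iota>] xy by blast+
    have "limit_t N \<otimes>\<^bsub>seq.L\<^esub> limit_e (x, mat 1) = limit_e (y, mat 1) \<otimes>\<^bsub>seq.L\<^esub> limit_t N"
      unfolding eq[symmetric] using c by (simp add: L.m_assoc)
    moreover have "limit_e (x, mat 1) = seq.j (Suc N) (link N (embed N (x, mat 1)))"
      "limit_e (y, mat 1) = seq.j (Suc N) (link N (embed N (y, mat 1)))"
      using j_embed[of "(x, mat 1)" "Suc N"] j_embed[of "(y, mat 1)" "Suc N"] x y
      by (simp_all add: embed_Suc)
    ultimately have "seq.j (Suc N) (S.inr N (zero_K, 1) \<otimes>\<^bsub>stages (Suc N)\<^esub> link N (embed N (x, mat 1))) =
        seq.j (Suc N) (link N (embed N (y, mat 1)) \<otimes>\<^bsub>stages (Suc N)\<^esub> S.inr N (zero_K, 1))"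
      using seq.mult_j[OF t_closed l(1)] seq.mult_j[OF l(2) t_closed] by simp
    then have "S.inr N (zero_K, 1) \<otimes>\<^bsub>stages (Suc N)\<^esub> link N (embed N (x, mat 1)) =
        link N (embed N (y, mat 1)) \<otimes>\<^bsub>stages (Suc N)\<^esub> S.inr N (zero_K, 1)"
      using seq.j_inj[of "Suc N"] l t_closed by (auto simp: inj_on_def)
    then have "embed N (x, mat 1) \<in> S.N0 N"
      using S.t_moves[OF xy] by (simp add: stages_Suc link_eq)
    then obtain z where "z \<in> T N" "embed N (x, mat 1) = embed N (z, mat 1)"
      by (auto simp: S.N0_def S.\<epsilon>_def)
    moreover have "retraction N (embed N (x, mat 1)) = (x, mat 1)"
      using x by (intro S.\<rho>_e) simp
    moreover have "retraction N (embed N (z, mat 1)) = (z, mat 1)"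
      using \<open>z \<in> T N\<close> by (intro S.\<rho>_e) (simp add: K_tail_iff)
    ultimately have "x = z" by (metis prod.inject)
    then show False using \<open>z \<in> T N\<close> x by simp
  qed
  have countable: "countable (carrier seq.L)"
    unfolding seq.carrier_limit by (intro countable_UN countable_image countable_stages) simp
  have e_hom: "limit_e \<in> hom G0 seq.L"
    using hom_compose[OF S.e_hom[of 0] seq.j_hom[of 0]] by (simp add: embed_def comp_def)
  have e_inj: "inj_on limit_e (carrier G0)"
    using seq.j_inj[of 0] embed_closed[of _ 0] by (auto simp: inj_on_def embed_def)
  show ?thesis
    unfolding G_group_eq
    by (intro vaes_group.intro vaes_group_axioms.intro prime_seq_axioms L.is_group assms countable e_hom
      e_inj conj moves limit_\<phi>) (use t_closed in auto)
qed

end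

section \<open>Operators on square summable functions\<close>

abbreviation "mass f X \<equiv> \<Sum>\<^sub>\<infinity>x\<in>X. (cmod (f x))\<^sup>2"

lemma l2_norm_sq: "(l2_norm S f)\<^sup>2 = mass f S"
  by (simp add: l2_norm_def infsum_nonneg)

lemma l2_norm_nonneg [simp]: "0 \<le> l2_norm S f"
  by (simp add: l2_norm_def infsum_nonneg)

lemma l2_summable: "f \<in> l2 S \<Longrightarrow> (\<lambda>x. (cmod (f x))\<^sup>2) summable_on S"
  by (simp add: l2_def)

lemma finite_mass_le:
  assumes "f \<in> l2 S" "finite F" "F \<subseteq> S"
  shows "(\<Sum>x\<in>F. (cmod (f x))\<^sup>2) \<le> (l2_norm S f)\<^sup>2"
  unfolding l2_norm_sq using assms by (intro finite_sum_le_infsum l2_summable) auto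

lemma finite_L2_le: "f \<in> l2 S \<Longrightarrow> finite F \<Longrightarrow> F \<subseteq> S \<Longrightarrow> L2_set (\<lambda>x. cmod (f x)) F \<le> l2_norm S f"
  using real_sqrt_le_mono[OF finite_mass_le] by (simp add: L2_set_def)

lemma l2I:
  assumes "\<And>x. x \<notin> S \<Longrightarrow> f x = 0" "\<And>F. finite F \<Longrightarrow> F \<subseteq> S \<Longrightarrow> L2_set (\<lambda>x. cmod (f x)) F \<le> B"
  shows "f \<in> l2 S" "l2_norm S f \<le> B"
proof -
  have "0 \<le> B" using assms(2)[of "{}"] by simp
  have *: "(\<Sum>x\<in>F. (cmod (f x))\<^sup>2) \<le> B\<^sup>2" if "finite F" "F \<subseteq> S" for F
  proof -
    have "(L2_set (\<lambda>x. cmod (f x)) F)\<^sup>2 \<le> B\<^sup>2"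
      using assms(2)[OF that] by (intro power_mono) (auto simp: L2_set_nonneg)
    then show ?thesis by (simp add: L2_set_def sum_nonneg)
  qed
  then have "(\<lambda>x. (cmod (f x))\<^sup>2) summable_on S"
    by (intro nonneg_bdd_above_summable_on) (auto intro!: bdd_aboveI[of _ "B\<^sup>2"])
  then show "f \<in> l2 S" using assms(1) by (simp add: l2_def)
  have "mass f S \<le> B\<^sup>2"
    using \<open>(\<lambda>x. (cmod (f x))\<^sup>2) summable_on S\<close> * by (intro infsum_le_finite_sums) auto
  then show "l2_norm S f \<le> B"
    unfolding l2_norm_def using \<open>0 \<le> B\<close> by (intro real_le_lsqrt) auto
qed

lemma l2_add:
  assumes "f \<in> l2 S" "g \<in> l2 S"
  shows "(\<lambda>x. f x + g x) \<in> l2 S" "l2_norm S (\<lambda>x. f x + g x) \<le> l2_norm S f + l2_norm S g"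
proof -
  have "L2_set (\<lambda>x. cmod (f x + g x)) F \<le> l2_norm S f + l2_norm S g" if "finite F" "F \<subseteq> S" for F
  proof -
    have "L2_set (\<lambda>x. cmod (f x + g x)) F \<le> L2_set (\<lambda>x. cmod (f x) + cmod (g x)) F"
      by (intro L2_set_mono norm_triangle_ineq) auto
    also have "\<dots> \<le> L2_set (\<lambda>x. cmod (f x)) F + L2_set (\<lambda>x. cmod (g x)) F"
      by (rule L2_set_triangle_ineq)
    also have "\<dots> \<le> l2_norm S f + l2_norm S g"
      using assms that by (intro add_mono finite_L2_le)
    finally show ?thesis .
  qed
  moreover have "f x + g x = 0" if "x \<notin> S" for x
    using that assms by (simp add: l2_def)
  ultimately show "(\<lambda>x. f x + g x) \<in> l2 S" "l2_norm S (\<lambda>x. f x + g x) \<le> l2_norm S f + l2_norm S g"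
    using l2I[of S "\<lambda>x. f x + g x"] by blast+
qed

lemma l2_scale:
  assumes "f \<in> l2 S"
  shows "(\<lambda>x. c * f x) \<in> l2 S" "l2_norm S (\<lambda>x. c * f x) = cmod c * l2_norm S f"
  using assms
  by (auto simp: l2_def l2_norm_def norm_mult power_mult_distrib infsum_cmult_right' real_sqrt_mult
      intro: summable_on_cmult_right)

lemma l2_diff:
  assumes "f \<in> l2 S" "g \<in> l2 S"
  shows "(\<lambda>x. f x - g x) \<in> l2 S" "l2_norm S (\<lambda>x. f x - g x) \<le> l2_norm S f + l2_norm S g"
proof -
  have g: "(\<lambda>x. - 1 * g x) \<in> l2 S" "l2_norm S (\<lambda>x. - 1 * g x) = l2_norm S g"
    using l2_scale[OF assms(2), of "-1"] by auto
  show "(\<lambda>x. f x - g x) \<in> l2 S" "l2_norm S (\<lambda>x. f x - g x) \<le> l2_norm S f + l2_norm S g"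
    using l2_add[OF assms(1) g(1)] g(2) by simp_all
qed

lemma l2_zero [simp]: "(\<lambda>x. 0) \<in> l2 S" "l2_norm S (\<lambda>x. 0) = 0"
  by (simp_all add: l2_def l2_norm_def)

lemma l2_sum: "finite I \<Longrightarrow> (\<And>i. i \<in> I \<Longrightarrow> f i \<in> l2 S) \<Longrightarrow> (\<lambda>x. \<Sum>i\<in>I. f i x) \<in> l2 S"
  by (induction I rule: finite_induct) (auto intro: l2_add)

lemma l2_delta: "a \<in> S \<Longrightarrow> l2_delta a \<in> l2 S" "a \<in> S \<Longrightarrow> l2_norm S (l2_delta a) = 1"
proof -
  assume a: "a \<in> S"
  have "((\<lambda>x. (cmod (l2_delta a x))\<^sup>2) has_sum 1) S"
    by (rule has_sum_finite_neutralI[of "{a}"]) (use a in \<open>auto simp: l2_delta_def\<close>)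
  then show "l2_delta a \<in> l2 S" "l2_norm S (l2_delta a) = 1"
    using a by (auto simp: l2_def l2_norm_def infsumI has_sum_imp_summable l2_delta_def)
qed

lemma cmod_le_l2_norm: "f \<in> l2 S \<Longrightarrow> x \<in> S \<Longrightarrow> cmod (f x) \<le> l2_norm S f"
  using finite_L2_le[of f S "{x}"] by (simp add: L2_set_def)

lemma l2_finite_support:
  assumes "finite F" "F \<subseteq> S" "\<And>x. x \<notin> F \<Longrightarrow> f x = 0"
  shows "f \<in> l2 S" "l2_norm S f = sqrt (\<Sum>x\<in>F. (cmod (f x))\<^sup>2)"
proof -
  have "((\<lambda>x. (cmod (f x))\<^sup>2) has_sum (\<Sum>x\<in>F. (cmod (f x))\<^sup>2)) S"
    by (rule has_sum_finite_neutralI[of F]) (use assms in auto)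
  then show "f \<in> l2 S" "l2_norm S f = sqrt (\<Sum>x\<in>F. (cmod (f x))\<^sup>2)"
    using assms by (auto simp: l2_def l2_norm_def infsumI has_sum_imp_summable)
qed

lemma l2_inner_summable:
  assumes "f \<in> l2 S" "g \<in> l2 S"
  shows "(\<lambda>x. cmod (cnj (f x) * g x)) summable_on S" "(\<lambda>x. cnj (f x) * g x) summable_on S"
    "cmod (l2_inner S f g) \<le> l2_norm S f * l2_norm S g"
proof -
  have *: "(\<Sum>x\<in>F. cmod (cnj (f x) * g x)) \<le> l2_norm S f * l2_norm S g" if "finite F" "F \<subseteq> S" for F
  proof -
    have "(\<Sum>x\<in>F. cmod (cnj (f x) * g x)) = (\<Sum>x\<in>F. \<bar>cmod (f x)\<bar> * \<bar>cmod (g x)\<bar>)"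
      by (simp add: norm_mult)
    also have "\<dots> \<le> L2_set (\<lambda>x. cmod (f x)) F * L2_set (\<lambda>x. cmod (g x)) F"
      by (rule L2_set_mult_ineq)
    also have "\<dots> \<le> l2_norm S f * l2_norm S g"
      using assms that by (intro mult_mono finite_L2_le) (auto simp: L2_set_nonneg)
    finally show ?thesis .
  qed
  show abs: "(\<lambda>x. cmod (cnj (f x) * g x)) summable_on S"
    by (rule nonneg_bdd_above_summable_on)
      (auto intro!: bdd_aboveI[of _ "l2_norm S f * l2_norm S g"] *)
  then show "(\<lambda>x. cnj (f x) * g x) summable_on S" by (rule abs_summable_summable)
  have "cmod (l2_inner S f g) \<le> (\<Sum>\<^sub>\<infinity>x\<in>S. cmod (cnj (f x) * g x))"
    unfolding l2_inner_def using abs by (rule norm_infsum_bound)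
  also have "\<dots> \<le> l2_norm S f * l2_norm S g"
    using abs * by (intro infsum_le_finite_sums) auto
  finally show "cmod (l2_inner S f g) \<le> l2_norm S f * l2_norm S g" .
qed

lemma l2_inner_add:
  assumes "f \<in> l2 S" "g \<in> l2 S" "h \<in> l2 S"
  shows "l2_inner S f (\<lambda>x. g x + h x) = l2_inner S f g + l2_inner S f h"
    "l2_inner S (\<lambda>x. g x + h x) f = l2_inner S g f + l2_inner S h f"
  using infsum_add[OF l2_inner_summable(2)[OF assms(1,2)] l2_inner_summable(2)[OF assms(1,3)]]
    infsum_add[OF l2_inner_summable(2)[OF assms(2,1)] l2_inner_summable(2)[OF assms(3,1)]]
  by (simp_all add: l2_inner_def distrib_left distrib_right)

lemma l2_inner_scale:
  "l2_inner S f (\<lambda>x. c * g x) = c * l2_inner S f g"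
  "l2_inner S (\<lambda>x. c * f x) g = cnj c * l2_inner S f g"
  by (simp_all add: l2_inner_def infsum_cmult_right' mult.left_commute mult.assoc)

lemma l2_inner_cnj: "l2_inner S g f = cnj (l2_inner S f g)"
  unfolding l2_inner_def by (simp flip: infsum_cnj add: mult.commute)

lemma l2_inner_self: "f \<in> l2 S \<Longrightarrow> l2_inner S f f = complex_of_real ((l2_norm S f)\<^sup>2)"
proof -
  assume f: "f \<in> l2 S"
  have "l2_inner S f f = (\<Sum>\<^sub>\<infinity>x\<in>S. complex_of_real ((cmod (f x))\<^sup>2))"
    unfolding l2_inner_def by (intro infsum_cong) (metis complex_norm_square mult.commute)
  also have "\<dots> = complex_of_real (mass f S)"
    using has_sum_of_real[OF has_sum_infsum[OF l2_summable[OF f]]] by (rule infsumI)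
  finally show ?thesis by (simp add: l2_norm_sq)
qed

lemma l2_inner_delta:
  "a \<in> S \<Longrightarrow> l2_inner S (l2_delta a) f = f a"
  "a \<in> S \<Longrightarrow> l2_inner S f (l2_delta a) = cnj (f a)"
proof -
  have *: "(\<Sum>\<^sub>\<infinity>x\<in>S. if x = a then c else 0) = c" if "a \<in> S" for c :: complex
    by (rule infsumI, rule has_sum_finite_neutralI[of "{a}"]) (use that in auto)
  show "a \<in> S \<Longrightarrow> l2_inner S (l2_delta a) f = f a" "a \<in> S \<Longrightarrow> l2_inner S f (l2_delta a) = cnj (f a)"
    using *[of "f a"] *[of "cnj (f a)"]
    by (auto simp: l2_inner_def l2_delta_def if_distrib if_distribR cong: if_cong)
qed

lemma l2_eqI:
  assumes "f \<in> l2 S" "g \<in> l2 S" "\<And>x. x \<in> S \<Longrightarrow> f x = g x"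
  shows "f = g"
  using assms by (fastforce simp: l2_def)

subsection \<open>Bounded operators\<close>

lemma bounded_opersD:
  assumes "T \<in> bounded_opers S"
  shows "T \<in> l2 S \<rightarrow>\<^sub>E l2 S" "f \<in> l2 S \<Longrightarrow> T f \<in> l2 S" "f \<notin> l2 S \<Longrightarrow> T f = undefined"
    "f \<in> l2 S \<Longrightarrow> g \<in> l2 S \<Longrightarrow> T (\<lambda>x. f x + g x) = (\<lambda>x. T f x + T g x)"
    "f \<in> l2 S \<Longrightarrow> T (\<lambda>x. c * f x) = (\<lambda>x. c * T f x)"
  using assms by (auto simp: bounded_opers_def PiE_iff extensional_def)

lemma bounded_opers_bound:
  assumes "T \<in> bounded_opers S"
  obtains B where "0 \<le> B" "\<And>f. f \<in> l2 S \<Longrightarrow> l2_norm S (T f) \<le> B * l2_norm S f"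
proof -
  obtain B where B: "\<forall>f\<in>l2 S. l2_norm S (T f) \<le> B * l2_norm S f"
    using assms unfolding bounded_opers_def by blast
  have "l2_norm S (T f) \<le> max 0 B * l2_norm S f" if "f \<in> l2 S" for f
    using B that mult_right_mono[of B "max 0 B" "l2_norm S f"] by fastforce
  then show ?thesis using that[of "max 0 B"] by auto
qed

lemma bounded_opersI:
  assumes "\<And>f. f \<in> l2 S \<Longrightarrow> T f \<in> l2 S" "\<And>f. f \<notin> l2 S \<Longrightarrow> T f = undefined"
    "\<And>f g. f \<in> l2 S \<Longrightarrow> g \<in> l2 S \<Longrightarrow> T (\<lambda>x. f x + g x) = (\<lambda>x. T f x + T g x)"
    "\<And>c f. f \<in> l2 S \<Longrightarrow> T (\<lambda>x. c * f x) = (\<lambda>x. c * T f x)"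
    "\<And>f. f \<in> l2 S \<Longrightarrow> l2_norm S (T f) \<le> B * l2_norm S f"
  shows "T \<in> bounded_opers S"
proof -
  have "\<exists>B. \<forall>f\<in>l2 S. l2_norm S (T f) \<le> B * l2_norm S f" using assms(5) by blast
  then show ?thesis using assms(1-4) unfolding bounded_opers_def PiE_iff extensional_def by auto
qed

lemma bounded_oper_zero: "T \<in> bounded_opers S \<Longrightarrow> T (\<lambda>x. 0) = (\<lambda>x. 0)"
  using bounded_opersD(5)[of T S "\<lambda>x. 0" 0] by simp

lemma bounded_oper_sum:
  assumes "T \<in> bounded_opers S" "finite I" "\<And>i. i \<in> I \<Longrightarrow> f i \<in> l2 S"
  shows "T (\<lambda>x. \<Sum>i\<in>I. c i * f i x) = (\<lambda>x. \<Sum>i\<in>I. c i * T (f i) x)"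
  using assms(2,3)
proof (induction I rule: finite_induct)
  case empty
  then show ?case using bounded_oper_zero[OF assms(1)] by simp
next
  case (insert i I)
  have "(\<lambda>x. \<Sum>i\<in>I. c i * f i x) \<in> l2 S" "(\<lambda>x. c i * f i x) \<in> l2 S"
    using insert by (auto intro!: l2_sum l2_scale)
  then show ?case
    using insert bounded_opersD(4)[OF assms(1), of "\<lambda>x. c i * f i x" "\<lambda>x. \<Sum>i\<in>I. c i * f i x"]
      bounded_opersD(5)[OF assms(1), of "f i" "c i"] by simp
qed

text \<open>The adjoint is constructed from its matrix coefficients, without the Riesz representation theorem.\<close>

lemma adjoint_exists:
  assumes T: "T \<in> bounded_opers S"
  shows "\<exists>!U. U \<in> bounded_opers S \<and> (\<forall>f\<in>l2 S. \<forall>g\<in>l2 S. l2_inner S (U f) g = l2_inner S f (T g))"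
proof -
  obtain B where B: "0 \<le> B" "\<And>f. f \<in> l2 S \<Longrightarrow> l2_norm S (T f) \<le> B * l2_norm S f"
    using bounded_opers_bound[OF T, of thesis] by simp
  define U where "U = (\<lambda>f\<in>l2 S. \<lambda>x. if x \<in> S then l2_inner S (T (l2_delta x)) f else 0)"
  have delta: "T (l2_delta x) \<in> l2 S" if "x \<in> S" for x
    by (rule bounded_opersD(2)[OF T l2_delta(1)[OF that]])
  have fin: "l2_inner S f (T (\<lambda>x. \<Sum>y\<in>F. c y * l2_delta y x)) = (\<Sum>y\<in>F. c y * cnj (U f y))"
    if "finite F" "F \<subseteq> S" "f \<in> l2 S" for F c f
  proof -
    have "T (\<lambda>x. \<Sum>y\<in>F. c y * l2_delta y x) = (\<lambda>x. \<Sum>y\<in>F. c y * T (l2_delta y) x)"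
      using \<open>F \<subseteq> S\<close> by (intro bounded_oper_sum[OF T \<open>finite F\<close>] l2_delta(1)) auto
    moreover have "l2_inner S f (\<lambda>x. \<Sum>y\<in>F. c y * T (l2_delta y) x) =
        (\<Sum>y\<in>F. c y * l2_inner S f (T (l2_delta y)))"
      using that(1,2)
    proof (induction F rule: finite_induct)
      case empty
      then show ?case by (simp add: l2_inner_def)
    next
      case (insert y F)
      have "(\<lambda>x. \<Sum>y\<in>F. c y * T (l2_delta y) x) \<in> l2 S" "(\<lambda>x. c y * T (l2_delta y) x) \<in> l2 S"
        using insert delta by (auto intro!: l2_sum l2_scale)
      then show ?case
        using insert \<open>f \<in> l2 S\<close> by (simp add: l2_inner_add l2_inner_scale)
    qed
    moreover have "l2_inner S f (T (l2_delta y)) = cnj (U f y)" if "y \<in> F" for y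
      using that \<open>F \<subseteq> S\<close> \<open>f \<in> l2 S\<close> l2_inner_cnj[of S f "T (l2_delta y)"] by (auto simp: U_def)
    ultimately show ?thesis by simp
  qed
  have U_l2: "U f \<in> l2 S" "l2_norm S (U f) \<le> B * l2_norm S f" if f: "f \<in> l2 S" for f
  proof -
    have "L2_set (\<lambda>x. cmod (U f x)) F \<le> B * l2_norm S f" if F: "finite F" "F \<subseteq> S" for F
    proof -
      \<comment> \<open>Testing against the truncation of \<open>U f\<close> to \<open>F\<close>
        turns \<open>?s\<^sup>2\<close> into an inner product with \<open>T ?v\<close>, so that one
        factor \<open>?s\<close> cancels.\<close>
      let ?v = "\<lambda>x. \<Sum>y\<in>F. U f y * l2_delta y x"
      let ?s = "L2_set (\<lambda>x. cmod (U f x)) F"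
      have v: "?v x = (if x \<in> F then U f x else 0)" for x
        using F by (simp add: l2_delta_def if_distrib cong: if_cong)
      have v2: "?v \<in> l2 S" "l2_norm S ?v = ?s"
        using l2_finite_support[OF F, of ?v] by (auto simp: v L2_set_def)
      have "?s\<^sup>2 = (\<Sum>y\<in>F. (cmod (U f y))\<^sup>2)"
        by (simp add: L2_set_def sum_nonneg)
      then have "complex_of_real (?s\<^sup>2) = (\<Sum>y\<in>F. U f y * cnj (U f y))"
        by (simp only: of_real_sum complex_norm_square)
      also have "\<dots> = l2_inner S f (T ?v)" using fin[OF F f] by simp
      finally have "?s\<^sup>2 = cmod (l2_inner S f (T ?v))"
        by (metis abs_power2 norm_of_real)
      also have "\<dots> \<le> l2_norm S f * (B * ?s)"
        using l2_inner_summable(3)[OF f bounded_opersD(2)[OF T v2(1)]] B(2)[OF v2(1)] v2(2)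
          mult_left_mono[of "l2_norm S (T ?v)" "B * ?s" "l2_norm S f"] by simp
      finally have "?s * ?s \<le> (B * l2_norm S f) * ?s" by (simp add: power2_eq_square ac_simps)
      then show ?thesis
        using B(1) by (cases "?s = 0") (auto simp: L2_set_nonneg order_less_le)
    qed
    then show "U f \<in> l2 S" "l2_norm S (U f) \<le> B * l2_norm S f"
      using f l2I[of S "U f" "B * l2_norm S f"] by (auto simp: U_def)
  qed
  have U: "U \<in> bounded_opers S"
  proof (rule bounded_opersI)
    fix f g c assume f: "f \<in> l2 S"
    show "U (\<lambda>x. c * f x) = (\<lambda>x. c * U f x)"
      using l2_scale(1)[OF f, of c] f by (auto simp: U_def l2_inner_scale)
    assume g: "g \<in> l2 S"
    show "U (\<lambda>x. f x + g x) = (\<lambda>x. U f x + U g x)"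
      using f g l2_add(1)[OF f g] delta by (auto simp: U_def l2_inner_add)
  qed (use U_l2 in \<open>auto simp: U_def\<close>)
  have adj: "l2_inner S (U f) g = l2_inner S f (T g)" if f: "f \<in> l2 S" and g: "g \<in> l2 S" for f g
  proof -
    \<comment> \<open>Both sides agree exactly on the truncation of \<open>g\<close> to a large
      finite set. The remainder \<open>?w\<close> has norm at most \<epsilon> and enters once on
      each side, hence the factor 2.\<close>
    have bound: "cmod (l2_inner S (U f) g - l2_inner S f (T g)) \<le> \<epsilon> * (2 * B * l2_norm S f)"
      if eps: "0 < \<epsilon>" for \<epsilon>
    proof -
      obtain F where F: "finite F" "F \<subseteq> S" "mass g S - (\<Sum>x\<in>F. (cmod (g x))\<^sup>2) \<le> \<epsilon>\<^sup>2"
      proof -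
        have "0 < \<epsilon>\<^sup>2" using eps by simp
        from infsum_finite_approximation[OF l2_summable[OF g] this]
        obtain F where "finite F" "F \<subseteq> S" "dist (\<Sum>x\<in>F. (cmod (g x))\<^sup>2) (mass g S) \<le> \<epsilon>\<^sup>2"
          by blast
        then show ?thesis using that by (auto simp: dist_real_def)
      qed
      let ?v = "\<lambda>x. \<Sum>y\<in>F. g y * l2_delta y x"
      let ?w = "\<lambda>x. g x - ?v x"
      have v: "?v x = (if x \<in> F then g x else 0)" for x
        using F by (simp add: l2_delta_def if_distrib cong: if_cong)
      have v2: "?v \<in> l2 S" by (rule l2_finite_support[OF F(1,2)]) (simp add: v)
      have w2: "?w \<in> l2 S" using l2_diff(1)[OF g v2] .
      have "mass ?w S = mass g (S - F)"
        by (rule infsum_cong_neutral) (auto simp: v)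
      also have "\<dots> = mass g S - mass g F"
        using F l2_summable[OF g] by (intro infsum_Diff) auto
      finally have "mass ?w S \<le> \<epsilon>\<^sup>2" using F by simp
      then have w: "l2_norm S ?w \<le> \<epsilon>"
        unfolding l2_norm_def using \<open>0 < \<epsilon>\<close> by (intro real_le_lsqrt) auto
      have gv: "g = (\<lambda>x. ?v x + ?w x)" by simp
      have "l2_inner S (U f) ?v = (\<Sum>y\<in>F. g y * cnj (U f y))"
      proof -
        have "l2_inner S (U f) ?v = (\<Sum>x\<in>F. cnj (U f x) * ?v x)"
          unfolding l2_inner_def by (rule infsumI, rule has_sum_finite_neutralI[of F]) (use F in \<open>auto simp: v\<close>)
        also have "\<dots> = (\<Sum>y\<in>F. g y * cnj (U f y))"
          by (rule sum.cong) (auto simp: v mult.commute)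
        finally show ?thesis .
      qed
      then have "l2_inner S (U f) ?v = l2_inner S f (T ?v)" using fin[OF F(1,2) f] by simp
      moreover have "l2_inner S (U f) g = l2_inner S (U f) ?v + l2_inner S (U f) ?w"
        by (subst gv) (rule l2_inner_add(1)[OF U_l2(1)[OF f] v2 w2])
      moreover have "l2_inner S f (T g) = l2_inner S f (T ?v) + l2_inner S f (T ?w)"
      proof -
        have "T g = (\<lambda>x. T ?v x + T ?w x)"
          by (subst gv) (rule bounded_opersD(4)[OF T v2 w2])
        then show ?thesis
          using l2_inner_add(1)[OF f bounded_opersD(2)[OF T v2] bounded_opersD(2)[OF T w2]] by (simp only:)
      qed
      ultimately have eq: "l2_inner S (U f) g - l2_inner S f (T g) =
          l2_inner S (U f) ?w - l2_inner S f (T ?w)"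
        by simp
      have "cmod (l2_inner S (U f) g - l2_inner S f (T g)) \<le>
          cmod (l2_inner S (U f) ?w) + cmod (l2_inner S f (T ?w))"
        unfolding eq by (rule norm_triangle_ineq4)
      also have "\<dots> \<le> (B * l2_norm S f) * \<epsilon> + l2_norm S f * (B * \<epsilon>)"
      proof (intro add_mono)
        show "cmod (l2_inner S (U f) ?w) \<le> (B * l2_norm S f) * \<epsilon>"
          by (rule order_trans[OF l2_inner_summable(3)[OF U_l2(1)[OF f] w2]])
            (intro mult_mono U_l2(2)[OF f] w mult_nonneg_nonneg B(1) l2_norm_nonneg)
        have "l2_norm S (T ?w) \<le> B * \<epsilon>"
          by (rule order_trans[OF B(2)[OF w2]]) (intro mult_left_mono w B(1))
        then show "cmod (l2_inner S f (T ?w)) \<le> l2_norm S f * (B * \<epsilon>)"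
          by (intro order_trans[OF l2_inner_summable(3)[OF f bounded_opersD(2)[OF T w2]]]
              mult_left_mono l2_norm_nonneg)
      qed
      finally show ?thesis by (simp add: algebra_simps)
    qed
    let ?d = "cmod (l2_inner S (U f) g - l2_inner S f (T g))" and ?C = "2 * B * l2_norm S f"
    have "?d \<le> 0"
    proof (rule field_le_epsilon)
      fix \<epsilon> :: real assume "0 < \<epsilon>"
      \<comment> \<open>Dividing by \<open>?C + 1\<close> covers the case where \<open>?C\<close> is
        zero.\<close>
      then have "?d \<le> \<epsilon> / (?C + 1) * ?C"
        using bound[of "\<epsilon> / (?C + 1)"] B(1) by (simp add: add_nonneg_pos)
      also have "\<dots> \<le> \<epsilon>"
        using \<open>0 < \<epsilon>\<close> B(1) by (simp add: divide_simps add_nonneg_pos)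
      finally show "?d \<le> 0 + \<epsilon>" by simp
    qed
    then show ?thesis by simp
  qed
  show ?thesis
  proof (rule ex1I[of _ U])
    show "U \<in> bounded_opers S \<and> (\<forall>f\<in>l2 S. \<forall>g\<in>l2 S. l2_inner S (U f) g = l2_inner S f (T g))"
      using U adj by blast
    fix V assume V: "V \<in> bounded_opers S \<and> (\<forall>f\<in>l2 S. \<forall>g\<in>l2 S. l2_inner S (V f) g = l2_inner S f (T g))"
    show "V = U"
    proof
      fix f show "V f = U f"
      proof (cases "f \<in> l2 S")
        case True
        show ?thesis
        proof (rule l2_eqI[of _ S])
          show "V f \<in> l2 S" "U f \<in> l2 S" using V U True bounded_opersD(2) by blast+
          fix x assume x: "x \<in> S"
          have "cnj (V f x) = cnj (U f x)"
            using V adj[OF True l2_delta(1)[OF x]] True l2_delta(1)[OF x] x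
            by (metis l2_inner_delta(2))
          then show "V f x = U f x" by simp
        qed
      next
        case False
        then show ?thesis using V U bounded_opersD(3) by metis
      qed
    qed
  qed
qed

lemma op_adj:
  assumes "T \<in> bounded_opers S"
  shows "op_adj S T \<in> bounded_opers S"
    "f \<in> l2 S \<Longrightarrow> g \<in> l2 S \<Longrightarrow> l2_inner S (op_adj S T f) g = l2_inner S f (T g)"
  using theI'[OF adjoint_exists[OF assms]] unfolding op_adj_def by blast+

lemma op_adj_coeff:
  assumes "T \<in> bounded_opers S" "x \<in> S" "y \<in> S"
  shows "op_adj S T (l2_delta y) x = cnj (T (l2_delta x) y)"
  using op_adj(2)[OF assms(1) l2_delta(1)[OF assms(3)] l2_delta(1)[OF assms(2)]] assms
  by (metis complex_cnj_cnj l2_inner_delta)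

text \<open>Evaluation at \<open>x\<close> is the inner product with a point mass, and the adjoint
  moves the operator onto that point mass. Bounded operators are thereby determined by their
  matrices.\<close>

lemma oper_coeff:
  assumes "T \<in> bounded_opers S" "f \<in> l2 S" "x \<in> S"
  shows "T f x = (\<Sum>\<^sub>\<infinity>y\<in>S. T (l2_delta y) x * f y)"
proof -
  have "T f x = l2_inner S (op_adj S T (l2_delta x)) f"
    using op_adj(2)[OF assms(1) l2_delta(1)[OF assms(3)] assms(2)] assms by (simp add: l2_inner_delta)
  also have "\<dots> = (\<Sum>\<^sub>\<infinity>y\<in>S. T (l2_delta y) x * f y)"
    unfolding l2_inner_def by (rule infsum_cong) (simp add: op_adj_coeff assms)
  finally show ?thesis .
qed

lemma oper_eqI:
  assumes "T \<in> bounded_opers S" "U \<in> bounded_opers S"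
    "\<And>x y. x \<in> S \<Longrightarrow> y \<in> S \<Longrightarrow> T (l2_delta y) x = U (l2_delta y) x"
  shows "T = U"
proof
  fix f show "T f = U f"
  proof (cases "f \<in> l2 S")
    case True
    show ?thesis
      by (rule l2_eqI[of _ S])
        (use True assms bounded_opersD(2) in \<open>auto simp: oper_coeff cong: infsum_cong\<close>)
  next
    case False
    then show ?thesis using assms bounded_opersD(3) by metis
  qed
qed

lemma bounded_op_id: "op_id S \<in> bounded_opers S"
  by (rule bounded_opersI[of _ _ 1]) (auto simp: op_id_def l2_add l2_scale)

lemma bounded_op_add:
  assumes "T \<in> bounded_opers S" "U \<in> bounded_opers S"
  shows "op_add S T U \<in> bounded_opers S"
proof -
  obtain B C where B: "\<And>f. f \<in> l2 S \<Longrightarrow> l2_norm S (T f) \<le> B * l2_norm S f"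
    and C: "\<And>f. f \<in> l2 S \<Longrightarrow> l2_norm S (U f) \<le> C * l2_norm S f"
    using bounded_opers_bound assms by metis
  note D = bounded_opersD[OF assms(1)] bounded_opersD[OF assms(2)]
  show ?thesis
  proof (rule bounded_opersI)
    fix f assume f: "f \<in> l2 S"
    show "op_add S T U f \<in> l2 S" using f D by (simp add: op_add_def l2_add)
    show "l2_norm S (op_add S T U f) \<le> (B + C) * l2_norm S f"
      using l2_add(2)[OF D(2)[OF f] D(7)[OF f]] B[OF f] C[OF f] f
      by (simp add: op_add_def distrib_right)
  qed (auto simp: op_add_def D l2_add l2_scale algebra_simps)
qed

lemma bounded_op_scale:
  assumes "T \<in> bounded_opers S"
  shows "op_scale S c T \<in> bounded_opers S"
proof -
  obtain B where B: "\<And>f. f \<in> l2 S \<Longrightarrow> l2_norm S (T f) \<le> B * l2_norm S f"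
    using bounded_opers_bound assms by metis
  note D = bounded_opersD[OF assms]
  show ?thesis
  proof (rule bounded_opersI)
    fix f assume f: "f \<in> l2 S"
    show "op_scale S c T f \<in> l2 S" using f D by (simp add: op_scale_def l2_scale)
    show "l2_norm S (op_scale S c T f) \<le> (cmod c * B) * l2_norm S f"
      using mult_left_mono[OF B[OF f], of "cmod c"] f D(2)[OF f]
      by (simp add: op_scale_def l2_scale(2) mult.assoc)
  qed (auto simp: op_scale_def D l2_add l2_scale algebra_simps)
qed

lemma bounded_op_mult:
  assumes "T \<in> bounded_opers S" "U \<in> bounded_opers S"
  shows "op_mult S T U \<in> bounded_opers S"
proof -
  obtain B C where B: "0 \<le> B" "\<And>f. f \<in> l2 S \<Longrightarrow> l2_norm S (T f) \<le> B * l2_norm S f"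
    and C: "\<And>f. f \<in> l2 S \<Longrightarrow> l2_norm S (U f) \<le> C * l2_norm S f"
    using bounded_opers_bound assms by metis
  note D = bounded_opersD[OF assms(1)] bounded_opersD[OF assms(2)]
  show ?thesis
  proof (rule bounded_opersI)
    fix f assume f: "f \<in> l2 S"
    show "op_mult S T U f \<in> l2 S" using f D by (simp add: op_mult_def compose_def)
    show "l2_norm S (op_mult S T U f) \<le> (B * C) * l2_norm S f"
      using B(2)[OF D(7)[OF f]] mult_left_mono[OF C[OF f] B(1)] f
      by (simp add: op_mult_def compose_def mult.assoc)
  qed (auto simp: op_mult_def compose_def D l2_add l2_scale)
qed

lemma von_neumann_algebra_bounded_opers: "von_neumann_algebra S (bounded_opers S)"
  by (auto simp: von_neumann_algebra_def wot_closed_def bounded_op_id bounded_op_add bounded_op_scale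
      bounded_op_mult op_adj)

lemma von_neumann_algebra_generated:
  assumes "X \<subseteq> bounded_opers S"
  shows "von_neumann_algebra S (generated_vna S X)" "X \<subseteq> generated_vna S X"
proof -
  let ?F = "{M. von_neumann_algebra S M \<and> X \<subseteq> M}"
  have b: "bounded_opers S \<in> ?F" using assms von_neumann_algebra_bounded_opers by auto
  note vna = von_neumann_algebra_def[of S]
  show "von_neumann_algebra S (generated_vna S X)"
    unfolding vna
  proof (intro conjI ballI allI)
    show "generated_vna S X \<subseteq> bounded_opers S"
      unfolding generated_vna_def using b by (rule Inter_lower)
    show "op_id S \<in> generated_vna S X"
      unfolding generated_vna_def by (rule InterI) (simp add: vna)
    fix T assume T: "T \<in> generated_vna S X"
    then have TM: "T \<in> M" if "M \<in> ?F" for M using that unfolding generated_vna_def by (rule InterD)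
    show "op_scale S c T \<in> generated_vna S X" for c
      unfolding generated_vna_def by (rule InterI) (use TM in \<open>simp add: vna\<close>)
    show "op_adj S T \<in> generated_vna S X"
      unfolding generated_vna_def by (rule InterI) (use TM in \<open>simp add: vna\<close>)
    fix U assume U: "U \<in> generated_vna S X"
    then have UM: "U \<in> M" if "M \<in> ?F" for M using that unfolding generated_vna_def by (rule InterD)
    show "op_add S T U \<in> generated_vna S X"
      unfolding generated_vna_def by (rule InterI) (use TM UM in \<open>simp add: vna\<close>)
    show "op_mult S T U \<in> generated_vna S X"
      unfolding generated_vna_def by (rule InterI) (use TM UM in \<open>simp add: vna\<close>)
  next
    show "wot_closed S (generated_vna S X)"
      unfolding wot_closed_def
    proof (intro ballI impI)
      fix T assume T: "T \<in> bounded_opers S"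
        and approx: "\<forall>F \<epsilon>. finite F \<and> F \<subseteq> l2 S \<times> l2 S \<and> \<epsilon> > 0 \<longrightarrow>
          (\<exists>U\<in>generated_vna S X. \<forall>(f, g)\<in>F. cmod (l2_inner S f (U g) - l2_inner S f (T g)) < \<epsilon>)"
      show "T \<in> generated_vna S X"
        unfolding generated_vna_def
      proof (rule InterI)
        fix M assume M: "M \<in> ?F"
        then have "wot_closed S M" by (simp add: vna)
        moreover have "generated_vna S X \<subseteq> M"
          unfolding generated_vna_def using M by (rule Inter_lower)
        ultimately show "T \<in> M"
          unfolding wot_closed_def using T approx by (meson subsetD)
      qed
    qed
  qed
  show "X \<subseteq> generated_vna S X" by (auto simp: generated_vna_def)
qed

lemma generated_vna_least: "von_neumann_algebra S M \<Longrightarrow> X \<subseteq> M \<Longrightarrow> generated_vna S X \<subseteq> M"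
  by (auto simp: generated_vna_def)

section \<open>The group von Neumann algebra\<close>

lemma l2_delta_apply: "l2_delta a x = (if x = a then 1 else 0)"
  by (simp add: l2_delta_def)

text \<open>Gaussian elimination: the pivot \<open>g1\<close> clears the coordinate \<open>b\<close>
  from the other vectors, and its own coefficient is chosen afterwards to compensate. Applied to
  point masses expanded in finitely many vectors.\<close>

lemma exists_nontrivial_relation:
  fixes c :: "'g \<Rightarrow> 'b \<Rightarrow> complex"
  assumes "finite B" "finite F" "card B < card F"
  shows "\<exists>d. (\<exists>g\<in>F. d g \<noteq> 0) \<and> (\<forall>b\<in>B. (\<Sum>g\<in>F. d g * c g b) = 0)"
  using assms
proof (induction B arbitrary: F c rule: finite_induct)
  case empty
  then obtain g where "g \<in> F" by fastforce
  then show ?case by (intro exI[of _ "\<lambda>_. 1"]) auto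
next
  case (insert b B)
  show ?case
  proof (cases "\<forall>g\<in>F. c g b = 0")
    case True
    then show ?thesis using insert.IH[of F c] insert.hyps insert.prems by auto
  next
    case False
    then obtain g1 where g1: "g1 \<in> F" "c g1 b \<noteq> 0" by auto
    let ?F = "F - {g1}"
    have F: "F = insert g1 ?F" using g1 by auto
    define q where "q g = c g b / c g1 b" for g
    have "card B < card ?F" using insert g1 by simp
    from insert.IH[OF _ this, of "\<lambda>g b'. c g b' - q g * c g1 b'"]
    obtain d where d: "\<exists>g\<in>?F. d g \<noteq> 0"
      "\<And>b'. b' \<in> B \<Longrightarrow> (\<Sum>g\<in>?F. d g * (c g b' - q g * c g1 b')) = 0"
      using insert.prems by auto
    define d' where "d' g = (if g = g1 then - (\<Sum>g\<in>?F. d g * q g) else d g)" for g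
    have sum: "(\<Sum>g\<in>F. d' g * c g b') = (\<Sum>g\<in>?F. d g * (c g b' - q g * c g1 b'))" for b'
    proof -
      have "(\<Sum>g\<in>F. d' g * c g b') = d' g1 * c g1 b' + (\<Sum>g\<in>?F. d' g * c g b')"
        using insert.prems g1 by (intro sum.remove) auto
      also have "(\<Sum>g\<in>?F. d' g * c g b') = (\<Sum>g\<in>?F. d g * c g b')"
        by (rule sum.cong) (auto simp: d'_def)
      also have "d' g1 * c g1 b' + (\<Sum>g\<in>?F. d g * c g b') = (\<Sum>g\<in>?F. d g * (c g b' - q g * c g1 b'))"
        by (simp add: d'_def sum_distrib_right right_diff_distrib sum_subtractf mult.assoc)
      finally show ?thesis .
    qed
    have "(\<Sum>g\<in>F. d' g * c g b) = 0" unfolding sum using g1 by (simp add: q_def)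
    moreover have "\<exists>g\<in>F. d' g \<noteq> 0" using d(1) by (auto simp: d'_def)
    ultimately show ?thesis using sum d(2) by auto
  qed
qed

lemma op_mult_apply: "f \<in> l2 S \<Longrightarrow> op_mult S T U f = T (U f)"
  by (simp add: op_mult_def compose_def)

lemma unitary_norm:
  assumes "T \<in> bounded_opers S" "unitary_op S T" "f \<in> l2 S"
  shows "l2_norm S (T f) = l2_norm S f"
proof -
  have "op_adj S T (T f) = f"
    using assms(2,3) op_mult_apply[of f S "op_adj S T" T] by (simp add: unitary_op_def op_id_def)
  then have "l2_inner S f f = l2_inner S (T f) (T f)"
    using op_adj(2)[OF assms(1) bounded_opersD(2)[OF assms(1,3)] assms(3)] by simp
  then have "complex_of_real ((l2_norm S f)\<^sup>2) = complex_of_real ((l2_norm S (T f))\<^sup>2)"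
    using l2_inner_self[of f S] l2_inner_self[of "T f" S] bounded_opersD(2)[OF assms(1,3)] assms(3) by simp
  then have "(l2_norm S f)\<^sup>2 = (l2_norm S (T f))\<^sup>2" using of_real_eq_iff by blast
  then show ?thesis using power2_eq_iff_nonneg[of "l2_norm S f" "l2_norm S (T f)"] by simp
qed

section \<open>Operators commuting with right translations, and the trace\<close>

context group
begin

abbreviation "S \<equiv> carrier G"
abbreviation "LG \<equiv> group_vna G"
abbreviation "\<tau> \<equiv> group_trace G"

text \<open>Operators commuting with right translations, described by their matrix coefficients.\<close>

definition right_invariant :: "'a oper set" where
  "right_invariant = {T \<in> bounded_opers S.
     \<forall>h\<in>S. \<forall>k\<in>S. \<forall>g\<in>S. T (l2_delta (k \<otimes> g)) (h \<otimes> g) = T (l2_delta k) h}"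

lemma right_invariantD:
  assumes "T \<in> right_invariant"
  shows "T \<in> bounded_opers S" "h \<in> S \<Longrightarrow> k \<in> S \<Longrightarrow> T (l2_delta k) h = T (l2_delta \<one>) (h \<otimes> inv k)"
proof -
  show "T \<in> bounded_opers S" using assms by (simp add: right_invariant_def)
  assume "h \<in> S" "k \<in> S"
  moreover from this have "T (l2_delta (\<one> \<otimes> k)) (h \<otimes> inv k \<otimes> k) = T (l2_delta \<one>) (h \<otimes> inv k)"
    using assms unfolding right_invariant_def by blast
  ultimately show "T (l2_delta k) h = T (l2_delta \<one>) (h \<otimes> inv k)"
    by (simp add: m_assoc)
qed

lemma bij_mult_right: "g \<in> S \<Longrightarrow> bij_betw (\<lambda>x. x \<otimes> g) S S"
  by (rule bij_betwI[of _ _ _ "\<lambda>x. x \<otimes> inv g"]) (auto simp: m_assoc)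

lemma bij_mult_left: "g \<in> S \<Longrightarrow> bij_betw (\<lambda>x. g \<otimes> x) S S"
  by (rule bij_betwI[of _ _ _ "\<lambda>x. inv g \<otimes> x"]) (auto simp: m_assoc[symmetric])

lemma bij_inv: "bij_betw (\<lambda>x. inv x) S S"
  by (rule bij_betwI[of _ _ _ "\<lambda>x. inv x"]) auto

text \<open>The condition concerns single matrix coefficients and so survives weak limits. Since it
  holds for left translations, every operator in \<open>LG\<close> acts as left convolution by its
  vector \<open>T (l2_delta \<one>)\<close>, and questions about operators become questions about
  functions on the group.\<close>

lemma von_neumann_algebra_right_invariant: "von_neumann_algebra S right_invariant"
  unfolding von_neumann_algebra_def
proof (intro conjI ballI allI)
  show "right_invariant \<subseteq> bounded_opers S" by (auto simp: right_invariant_def)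
  show "op_id S \<in> right_invariant"
    using bounded_op_id[of S] by (auto simp: right_invariant_def op_id_def l2_delta l2_delta_apply)
  fix T assume T: "T \<in> right_invariant"
  note T' = right_invariantD(1)[OF T]
  show "op_scale S c T \<in> right_invariant" for c
    using T bounded_op_scale[OF T'] by (auto simp: right_invariant_def op_scale_def l2_delta)
  show "op_adj S T \<in> right_invariant"
    using T op_adj(1)[OF T'] by (auto simp: right_invariant_def op_adj_coeff)
  fix U assume U: "U \<in> right_invariant"
  note U' = right_invariantD(1)[OF U]
  show "op_add S T U \<in> right_invariant"
    using T U bounded_op_add[OF T' U'] by (auto simp: right_invariant_def op_add_def l2_delta)
  have "op_mult S T U (l2_delta (k \<otimes> g)) (h \<otimes> g) = op_mult S T U (l2_delta k) h"
    if hkg: "h \<in> S" "k \<in> S" "g \<in> S" for h k g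
  proof -
    have co: "op_mult S T U (l2_delta k) h = (\<Sum>\<^sub>\<infinity>y\<in>S. T (l2_delta y) h * U (l2_delta k) y)"
      if "h \<in> S" "k \<in> S" for h k
      using that oper_coeff[OF T' bounded_opersD(2)[OF U' l2_delta(1)[OF that(2)]] that(1)]
      by (simp add: op_mult_apply l2_delta)
    have "op_mult S T U (l2_delta (k \<otimes> g)) (h \<otimes> g) =
        (\<Sum>\<^sub>\<infinity>y\<in>S. T (l2_delta y) (h \<otimes> g) * U (l2_delta (k \<otimes> g)) y)"
      using hkg by (simp add: co)
    also have "\<dots> = (\<Sum>\<^sub>\<infinity>y\<in>S. T (l2_delta (y \<otimes> g)) (h \<otimes> g) * U (l2_delta (k \<otimes> g)) (y \<otimes> g))"
      using infsum_reindex_bij_betw[OF bij_mult_right[OF hkg(3)],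
        of "\<lambda>y. T (l2_delta y) (h \<otimes> g) * U (l2_delta (k \<otimes> g)) y"] by simp
    also have "\<dots> = (\<Sum>\<^sub>\<infinity>y\<in>S. T (l2_delta y) h * U (l2_delta k) y)"
      using T U hkg by (intro infsum_cong) (simp add: right_invariant_def)
    also have "\<dots> = op_mult S T U (l2_delta k) h" using hkg by (simp add: co)
    finally show ?thesis .
  qed
  then show "op_mult S T U \<in> right_invariant"
    using bounded_op_mult[OF T' U'] by (simp add: right_invariant_def)
next
  show "wot_closed S right_invariant"
    unfolding wot_closed_def
  proof (intro ballI impI)
    fix T assume T: "T \<in> bounded_opers S"
      and approx: "\<forall>F \<epsilon>. finite F \<and> F \<subseteq> l2 S \<times> l2 S \<and> \<epsilon> > 0 \<longrightarrow>
        (\<exists>U\<in>right_invariant. \<forall>(f, g)\<in>F. cmod (l2_inner S f (U g) - l2_inner S f (T g)) < \<epsilon>)"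
    have "T (l2_delta (k \<otimes> g)) (h \<otimes> g) = T (l2_delta k) h" if hkg: "h \<in> S" "k \<in> S" "g \<in> S" for h k g
    proof -
      let ?a = "T (l2_delta (k \<otimes> g)) (h \<otimes> g)" and ?b = "T (l2_delta k) h"
      have "cmod (?a - ?b) \<le> 0"
      proof (rule field_le_epsilon)
        fix \<epsilon> :: real assume "0 < \<epsilon>"
        let ?F = "{(l2_delta (h \<otimes> g), l2_delta (k \<otimes> g)), (l2_delta h, l2_delta k)} :: (('a \<Rightarrow> complex) \<times> ('a \<Rightarrow> complex)) set"
        have "finite ?F \<and> ?F \<subseteq> l2 S \<times> l2 S \<and> \<epsilon> / 2 > 0" using hkg \<open>0 < \<epsilon>\<close> by (auto simp: l2_delta)
        then obtain U where U: "U \<in> right_invariant"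
          "\<forall>(f, g)\<in>?F. cmod (l2_inner S f (U g) - l2_inner S f (T g)) < \<epsilon> / 2"
          using approx by blast
        have "cmod (U (l2_delta (k \<otimes> g)) (h \<otimes> g) - ?a) < \<epsilon> / 2" "cmod (U (l2_delta k) h - ?b) < \<epsilon> / 2"
          using U(2) hkg by (simp_all add: l2_inner_delta)
        moreover have "U (l2_delta (k \<otimes> g)) (h \<otimes> g) = U (l2_delta k) h"
          using U(1) hkg by (simp add: right_invariant_def)
        ultimately show "cmod (?a - ?b) \<le> 0 + \<epsilon>"
          using norm_triangle_half_l[of ?a "U (l2_delta k) h" \<epsilon> ?b] norm_minus_commute by (metis add_0 less_imp_le)
      qed
      then show ?thesis by simp
    qed
    then show "T \<in> right_invariant" using T by (simp add: right_invariant_def)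
  qed
qed

lemma left_translation_delta:
  assumes "g \<in> S" "k \<in> S"
  shows "left_translation G g (l2_delta k) = l2_delta (g \<otimes> k)"
proof
  fix x
  have "inv g \<otimes> x = k \<longleftrightarrow> x = g \<otimes> k" if "x \<in> S"
    using assms that by (metis inv_solve_left)
  then show "left_translation G g (l2_delta k) x = l2_delta (g \<otimes> k) x"
    using assms by (auto simp: left_translation_def l2_delta l2_delta_apply)
qed

lemma left_translation_bounded:
  assumes g: "g \<in> S"
  shows "left_translation G g \<in> bounded_opers S"
proof (rule bounded_opersI[where B = 1])
  have bij: "bij_betw (\<lambda>x. inv g \<otimes> x) S S" using g by (simp add: bij_mult_left)
  fix f assume f: "f \<in> l2 S"
  have *: "left_translation G g f x = f (inv g \<otimes> x)" if "x \<in> S" for x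
    using f that by (simp add: left_translation_def)
  have "(\<lambda>x. (cmod (f (inv g \<otimes> x)))\<^sup>2) summable_on S"
    using summable_on_reindex_bij_betw[OF bij, of "\<lambda>x. (cmod (f x))\<^sup>2"] l2_summable[OF f] by simp
  then show "left_translation G g f \<in> l2 S"
    unfolding l2_def using f by (auto simp: * left_translation_def cong: summable_on_cong)
  have "mass (left_translation G g f) S = mass (\<lambda>x. f (inv g \<otimes> x)) S"
    by (rule infsum_cong) (simp add: *)
  also have "\<dots> = mass f S"
    using infsum_reindex_bij_betw[OF bij, of "\<lambda>x. (cmod (f x))\<^sup>2"] by simp
  finally show "l2_norm S (left_translation G g f) \<le> 1 * l2_norm S f" by (simp add: l2_norm_def)
  show "left_translation G g (\<lambda>x. c * f x) = (\<lambda>x. c * left_translation G g f x)" for c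
    using f by (auto simp: left_translation_def l2_scale)
  show "left_translation G g (\<lambda>x. f x + h x) = (\<lambda>x. left_translation G g f x + left_translation G g h x)"
    if "h \<in> l2 S" for h
    using f that by (auto simp: left_translation_def l2_add)
qed (auto simp: left_translation_def)

lemma left_translation_right_invariant: "g \<in> S \<Longrightarrow> left_translation G g \<in> right_invariant"
  using left_translation_bounded
  by (auto simp: right_invariant_def left_translation_delta m_assoc[symmetric])
    (auto simp: l2_delta_apply)

lemma LG: "von_neumann_algebra S LG" "g \<in> S \<Longrightarrow> left_translation G g \<in> LG" "LG \<subseteq> right_invariant"
proof -
  have "left_translation G ` S \<subseteq> bounded_opers S" using left_translation_bounded by auto
  note gen = von_neumann_algebra_generated[OF this]
  show "von_neumann_algebra S LG" unfolding group_vna_def by (rule gen(1))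
  show "g \<in> S \<Longrightarrow> left_translation G g \<in> LG" using gen(2) by (auto simp: group_vna_def)
  show "LG \<subseteq> right_invariant"
    unfolding group_vna_def using left_translation_right_invariant
    by (intro generated_vna_least von_neumann_algebra_right_invariant) auto
qed

lemma LG_right_invariant: "T \<in> LG \<Longrightarrow> T \<in> right_invariant"
  using LG(3) by auto

lemma LG_bounded: "T \<in> LG \<Longrightarrow> T \<in> bounded_opers S"
  using LG(3) right_invariantD(1) by auto

lemma LG_closed:
  "T \<in> LG \<Longrightarrow> U \<in> LG \<Longrightarrow> op_mult S T U \<in> LG" "T \<in> LG \<Longrightarrow> op_adj S T \<in> LG"
  "T \<in> LG \<Longrightarrow> U \<in> LG \<Longrightarrow> op_diff S T U \<in> LG"
proof -
  have "op_diff S T U = op_add S T (op_scale S (-1) U)"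
    by (auto simp: op_diff_def op_add_def op_scale_def fun_eq_iff)
  then show "T \<in> LG \<Longrightarrow> U \<in> LG \<Longrightarrow> op_diff S T U \<in> LG"
    using LG(1) by (simp add: von_neumann_algebra_def)
qed (use LG(1) in \<open>simp_all add: von_neumann_algebra_def\<close>)

lemma trace_eq: "\<tau> T = T (l2_delta \<one>) \<one>"
  by (simp add: group_trace_def l2_inner_delta)

lemma trace_mult:
  assumes "T \<in> right_invariant" "U \<in> right_invariant"
  shows "\<tau> (op_mult S T U) = (\<Sum>\<^sub>\<infinity>y\<in>S. T (l2_delta \<one>) (inv y) * U (l2_delta \<one>) y)"
proof -
  note T = right_invariantD[OF assms(1)] and U = right_invariantD[OF assms(2)]
  have "\<tau> (op_mult S T U) = (\<Sum>\<^sub>\<infinity>y\<in>S. T (l2_delta y) \<one> * U (l2_delta \<one>) y)"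
    using oper_coeff[OF T(1) bounded_opersD(2)[OF U(1) l2_delta(1)]]
    by (simp add: trace_eq op_mult_apply l2_delta)
  also have "\<dots> = (\<Sum>\<^sub>\<infinity>y\<in>S. T (l2_delta \<one>) (inv y) * U (l2_delta \<one>) y)"
    by (rule infsum_cong) (subst T(2), auto)
  finally show ?thesis .
qed

text \<open>The convolution at the identity becomes symmetric under the substitution of
  \<open>inv y\<close> for \<open>y\<close>.\<close>

lemma trace_commute:
  assumes "T \<in> right_invariant" "U \<in> right_invariant"
  shows "\<tau> (op_mult S T U) = \<tau> (op_mult S U T)"
proof -
  have "\<tau> (op_mult S T U) = (\<Sum>\<^sub>\<infinity>y\<in>S. T (l2_delta \<one>) (inv y) * U (l2_delta \<one>) y)"
    using assms by (rule trace_mult)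
  also have "\<dots> = (\<Sum>\<^sub>\<infinity>y\<in>S. T (l2_delta \<one>) (inv (inv y)) * U (l2_delta \<one>) (inv y))"
    using infsum_reindex_bij_betw[OF bij_inv, of "\<lambda>y. T (l2_delta \<one>) (inv y) * U (l2_delta \<one>) y"] by simp
  also have "\<dots> = (\<Sum>\<^sub>\<infinity>y\<in>S. U (l2_delta \<one>) (inv y) * T (l2_delta \<one>) y)"
    by (rule infsum_cong) (simp add: mult.commute)
  also have "\<dots> = \<tau> (op_mult S U T)" using assms by (simp add: trace_mult)
  finally show ?thesis .
qed

lemma trace_adj_mult:
  assumes "T \<in> bounded_opers S"
  shows "\<tau> (op_mult S (op_adj S T) T) = complex_of_real ((l2_norm S (T (l2_delta \<one>)))\<^sup>2)"
proof -
  let ?d = "l2_delta \<one> :: 'a \<Rightarrow> complex"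
  have d: "?d \<in> l2 S" by (simp add: l2_delta)
  have d: "?d \<in> l2 S" "T ?d \<in> l2 S" using d bounded_opersD(2)[OF assms d] by simp_all
  have "\<tau> (op_mult S (op_adj S T) T) = l2_inner S ?d (op_adj S T (T ?d))"
    using d by (simp add: group_trace_def op_mult_apply)
  also have "\<dots> = cnj (l2_inner S (op_adj S T (T ?d)) ?d)" by (rule l2_inner_cnj)
  also have "\<dots> = complex_of_real ((l2_norm S (T ?d))\<^sup>2)"
    using op_adj(2)[OF assms d(2,1)] l2_inner_self[OF d(2)] by simp
  finally show ?thesis .
qed

lemma trace_norm2:
  assumes "T \<in> LG"
  shows "trace_norm2 S \<tau> T = l2_norm S (T (l2_delta \<one>))"
  unfolding trace_norm2_def
  using assms trace_commute[OF LG_right_invariant LG_right_invariant, of T "op_adj S T"]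
    trace_adj_mult[OF LG_bounded[OF assms]] LG_closed(2) by simp

lemma faithful_normal_trace: "faithful_normal_trace S LG \<tau>"
  unfolding faithful_normal_trace_def
proof (intro conjI ballI allI impI)
  have d: "l2_delta \<one> \<in> l2 S" by (simp add: l2_delta)
  fix T U assume T: "T \<in> LG" and U: "U \<in> LG"
  show "\<tau> (op_add S T U) = \<tau> T + \<tau> U" by (simp add: trace_eq op_add_def d)
  show "\<tau> (op_mult S T U) = \<tau> (op_mult S U T)"
    using T U by (intro trace_commute LG_right_invariant)
next
  fix c T show "\<tau> (op_scale S c T) = c * \<tau> T" by (simp add: trace_eq op_scale_def l2_delta)
next
  show "\<tau> (op_id S) = 1" by (simp add: trace_eq op_id_def l2_delta l2_delta_apply)
next
  fix T assume T: "T \<in> LG"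
  show "\<tau> (op_mult S (op_adj S T) T) \<in> \<real>\<^sub>\<ge>\<^sub>0"
    using trace_adj_mult[OF LG_bounded[OF T]] by simp
  assume "\<tau> (op_mult S (op_adj S T) T) = 0"
  then have "l2_norm S (T (l2_delta \<one>)) = 0"
    using trace_adj_mult[OF LG_bounded[OF T]] by simp
  then have 0: "T (l2_delta \<one>) h = 0" if "h \<in> S" for h
    using cmod_le_l2_norm[OF bounded_opersD(2)[OF LG_bounded[OF T] l2_delta(1)[OF one_closed]] that] by simp
  show "T = op_scale S 0 (op_id S)"
  proof (rule oper_eqI[OF LG_bounded[OF T] bounded_op_scale[OF bounded_op_id]])
    fix x y assume "x \<in> S" "y \<in> S"
    then show "T (l2_delta y) x = op_scale S 0 (op_id S) (l2_delta y) x"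
      using right_invariantD(2)[OF LG_right_invariant[OF T], of x y] 0
      by (simp add: op_scale_def l2_delta)
  qed
next
  fix \<epsilon> :: real assume "0 < \<epsilon>"
  \<comment> \<open>The trace is itself a matrix coefficient, so a single pair of vectors tests
    it.\<close>
  then show "\<exists>F \<delta>. finite F \<and> F \<subseteq> l2 S \<times> l2 S \<and> \<delta> > 0 \<and>
      (\<forall>T\<in>LG. (\<forall>f\<in>l2 S. l2_norm S (T f) \<le> l2_norm S f) \<and>
         (\<forall>(f, g)\<in>F. cmod (l2_inner S f (T g)) < \<delta>) \<longrightarrow> cmod (\<tau> T) < \<epsilon>)"
    by (intro exI[of _ "{(l2_delta \<one>, l2_delta \<one>)}"] exI[of _ \<epsilon>]) (auto simp: l2_delta group_trace_def)
qed

text \<open>Left translations send the point mass at the identity to all other point masses; a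
  finite spanning set of size \<open>card B\<close> would make any \<open>card B + 1\<close> of
  these dependent.\<close>

lemma infinite_dimensional_LG:
  assumes "infinite S"
  shows "infinite_dimensional S LG"
  unfolding infinite_dimensional_def
proof (intro notI, elim exE conjE)
  fix B assume B: "finite B" "B \<subseteq> LG"
    and span: "\<forall>T\<in>LG. \<exists>c. T = (\<lambda>f\<in>l2 S. \<lambda>x. \<Sum>b\<in>B. c b * b f x)"
  obtain F where F: "F \<subseteq> S" "finite F" "card F = Suc (card B)"
    using infinite_arbitrarily_large[OF assms] by metis
  have "\<exists>c. left_translation G g = (\<lambda>f\<in>l2 S. \<lambda>x. \<Sum>b\<in>B. c b * b f x)" if "g \<in> S" for g
    using span LG(2)[OF that] by blast
  then have "\<exists>c. \<forall>g\<in>S. left_translation G g = (\<lambda>f\<in>l2 S. \<lambda>x. \<Sum>b\<in>B. c g b * b f x)"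
    by (intro bchoice) blast
  then obtain c where c: "\<forall>g\<in>S. left_translation G g = (\<lambda>f\<in>l2 S. \<lambda>x. \<Sum>b\<in>B. c g b * b f x)"
    by (rule exE)
  have delta: "l2_delta g x = (\<Sum>b\<in>B. c g b * b (l2_delta \<one>) x)" if "g \<in> S" for g x
  proof -
    have "l2_delta g = left_translation G g (l2_delta \<one>)"
      using that by (simp add: left_translation_delta)
    also have "\<dots> = (\<lambda>x. \<Sum>b\<in>B. c g b * b (l2_delta \<one>) x)"
      unfolding bspec[OF c that] by (simp add: l2_delta)
    finally show ?thesis by (rule fun_cong)
  qed
  obtain d where d: "\<exists>g\<in>F. d g \<noteq> 0" "\<forall>b\<in>B. (\<Sum>g\<in>F. d g * c g b) = 0"
    using exists_nontrivial_relation[OF B(1) F(2), of c] F(3) by auto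
  have "d h = 0" if "h \<in> F" for h
  proof -
    have "d h = (\<Sum>g\<in>F. d g * l2_delta g h)"
      using that F(2) by (simp add: l2_delta_apply if_distrib cong: if_cong)
    also have "\<dots> = (\<Sum>g\<in>F. \<Sum>b\<in>B. d g * c g b * b (l2_delta \<one>) h)"
      using F(1) by (intro sum.cong) (auto simp: delta sum_distrib_left mult.assoc)
    also have "\<dots> = (\<Sum>b\<in>B. (\<Sum>g\<in>F. d g * c g b) * b (l2_delta \<one>) h)"
      by (subst sum.swap) (simp add: sum_distrib_right)
    also have "\<dots> = 0" using d(2) by simp
    finally show ?thesis .
  qed
  then show False using d(1) by blast
qed

abbreviation conj :: "'a \<Rightarrow> 'a \<Rightarrow> 'a" where "conj g x \<equiv> g \<otimes> x \<otimes> inv g"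

lemma bij_conj: "g \<in> S \<Longrightarrow> bij_betw (conj g) S S"
  using bij_betw_trans[OF bij_mult_left bij_mult_right[of "inv g"]] by (simp add: comp_def)

text \<open>The vector of a central operator is constant on conjugacy classes; being square summable
  it vanishes on the infinite ones.\<close>

lemma factor_LG:
  assumes icc: "icc G"
  shows "factor S LG"
  unfolding factor_def
proof (intro conjI ballI impI LG(1))
  fix T assume T: "T \<in> LG" and comm: "\<forall>U\<in>LG. op_mult S T U = op_mult S U T"
  let ?\<xi> = "T (l2_delta \<one>)"
  have \<xi>: "?\<xi> \<in> l2 S" using bounded_opersD(2)[OF LG_bounded[OF T] l2_delta(1)] by simp
  have inv: "?\<xi> (conj g h) = ?\<xi> h" if gh: "g \<in> S" "h \<in> S" for g h
  proof -
    have "T (left_translation G g (l2_delta \<one>)) = left_translation G g ?\<xi>"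
      using comm LG(2)[OF gh(1)] op_mult_apply[of "l2_delta \<one>" S] by (metis l2_delta(1) one_closed)
    then have "T (l2_delta g) (g \<otimes> h) = left_translation G g ?\<xi> (g \<otimes> h)"
      using gh by (simp add: left_translation_delta)
    also have "\<dots> = ?\<xi> h" using gh \<xi> by (simp add: left_translation_def m_assoc[symmetric])
    also have "T (l2_delta g) (g \<otimes> h) = ?\<xi> (conj g h)"
      by (rule right_invariantD(2)[OF LG_right_invariant[OF T] m_closed[OF gh] gh(1)])
    finally show ?thesis .
  qed
  have zero: "?\<xi> h = 0" if h: "h \<in> S" "h \<noteq> \<one>" for h
  proof (rule ccontr)
    assume n: "?\<xi> h \<noteq> 0"
    have "infinite ((\<lambda>g. conj g h) ` S)" using icc h by (simp add: icc_def)
    moreover obtain n where n: "(l2_norm S ?\<xi>)\<^sup>2 < real n * (cmod (?\<xi> h))\<^sup>2"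
      using reals_Archimedean3[of "(cmod (?\<xi> h))\<^sup>2"] n by auto
    ultimately obtain F where F: "F \<subseteq> (\<lambda>g. conj g h) ` S" "finite F" "card F = n"
      using infinite_arbitrarily_large by metis
    have "F \<subseteq> S" using F(1) h by auto
    have "?\<xi> x = ?\<xi> h" if "x \<in> F" for x using F(1) that inv h by auto
    then have "(\<Sum>x\<in>F. (cmod (?\<xi> x))\<^sup>2) = real n * (cmod (?\<xi> h))\<^sup>2" using F by simp
    then show False using finite_mass_le[OF \<xi> F(2) \<open>F \<subseteq> S\<close>] n by simp
  qed
  have "T = op_scale S (?\<xi> \<one>) (op_id S)"
  proof (rule oper_eqI[OF LG_bounded[OF T] bounded_op_scale[OF bounded_op_id]])
    fix x y assume xy: "x \<in> S" "y \<in> S"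
    then have "T (l2_delta y) x = ?\<xi> (x \<otimes> inv y)"
      using right_invariantD(2)[OF LG_right_invariant[OF T]] by blast
    moreover have "x \<otimes> inv y = \<one> \<longleftrightarrow> x = y" using xy by (metis inv_solve_right' l_one one_closed)
    ultimately show "T (l2_delta y) x = op_scale S (?\<xi> \<one>) (op_id S) (l2_delta y) x"
      using xy zero[of "x \<otimes> inv y"] by (auto simp: op_scale_def op_id_def l2_delta l2_delta_apply)
  qed
  then show "\<exists>c. T = op_scale S c (op_id S)" by blast
qed

lemma II1_factor_LG:
  assumes "icc G" "infinite S"
  shows "II1_factor S LG \<tau>"
  unfolding II1_factor_def
  using factor_LG[OF assms(1)] infinite_dimensional_LG[OF assms(2)] faithful_normal_trace by blast

text \<open>Reading the commutator at \<open>g \<otimes> x\<close> replaces one-sided translations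
  by conjugation. This translates centrality of operators into asymptotic invariance of
  vectors.\<close>

lemma trace_norm2_commutator:
  assumes T: "T \<in> LG" and g: "g \<in> S"
  shows "trace_norm2 S \<tau> (op_diff S (op_mult S T (left_translation G g)) (op_mult S (left_translation G g) T)) =
    sqrt (mass (\<lambda>x. T (l2_delta \<one>) (conj g x) - T (l2_delta \<one>) x) S)"
proof -
  let ?\<xi> = "T (l2_delta \<one>)" and ?L = "left_translation G g"
  have \<xi>: "?\<xi> \<in> l2 S" using bounded_opersD(2)[OF LG_bounded[OF T] l2_delta(1)] by simp
  let ?C = "op_diff S (op_mult S T ?L) (op_mult S ?L T)"
  have C: "?C (l2_delta \<one>) (g \<otimes> x) = ?\<xi> (conj g x) - ?\<xi> x" if x: "x \<in> S" for x
  proof -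
    have "?C (l2_delta \<one>) (g \<otimes> x) = T (l2_delta g) (g \<otimes> x) - ?\<xi> x"
      using g x \<xi> by (simp add: op_diff_def op_mult_apply l2_delta left_translation_delta)
        (simp add: left_translation_def m_assoc[symmetric])
    also have "T (l2_delta g) (g \<otimes> x) = ?\<xi> (conj g x)"
      by (rule right_invariantD(2)[OF LG_right_invariant[OF T] m_closed[OF g x] g])
    finally show ?thesis .
  qed
  have "?C \<in> LG" using T LG(2)[OF g] LG_closed by simp
  then have "trace_norm2 S \<tau> ?C = sqrt (mass (?C (l2_delta \<one>)) S)"
    by (simp add: trace_norm2 l2_norm_def)
  also have "mass (?C (l2_delta \<one>)) S = mass (\<lambda>x. ?C (l2_delta \<one>) (g \<otimes> x)) S"
    using infsum_reindex_bij_betw[OF bij_mult_left[OF g], of "\<lambda>x. (cmod (?C (l2_delta \<one>) x))\<^sup>2"] by simp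
  also have "\<dots> = mass (\<lambda>x. ?\<xi> (conj g x) - ?\<xi> x) S"
    by (rule infsum_cong) (simp add: C)
  finally show ?thesis .
qed

text \<open>The only form in which unitarity enters the Fourier estimate: convolution by the vector
  of \<open>T\<close> is isometric, tested on a finitely supported \<open>v\<close> and observed
  through a finite window \<open>H\<close>.\<close>

lemma unitary_convolution:
  assumes T: "T \<in> LG" "unitary_op S T" and F: "finite F" "F \<subseteq> S" and H: "finite H" "H \<subseteq> S"
  shows "(\<Sum>h\<in>H. (cmod (\<Sum>l\<in>F. v l * T (l2_delta \<one>) (h \<otimes> inv l)))\<^sup>2) \<le> (\<Sum>l\<in>F. (cmod (v l))\<^sup>2)"
proof -
  let ?v = "\<lambda>x. \<Sum>l\<in>F. v l * l2_delta l x"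
  have v: "?v x = (if x \<in> F then v x else 0)" for x
    using F by (simp add: l2_delta_apply if_distrib cong: if_cong)
  have v2: "?v \<in> l2 S" "(l2_norm S ?v)\<^sup>2 = (\<Sum>l\<in>F. (cmod (v l))\<^sup>2)"
    using l2_finite_support[OF F, of ?v] by (auto simp: v sum_nonneg)
  have Tv: "T ?v = (\<lambda>x. \<Sum>l\<in>F. v l * T (l2_delta l) x)"
    using F by (intro bounded_oper_sum[OF LG_bounded[OF T(1)]] l2_delta) auto
  have "(\<Sum>h\<in>H. (cmod (\<Sum>l\<in>F. v l * T (l2_delta \<one>) (h \<otimes> inv l)))\<^sup>2) = (\<Sum>h\<in>H. (cmod (T ?v h))\<^sup>2)"
  proof (rule sum.cong[OF refl])
    fix h assume h: "h \<in> H"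
    have "(\<Sum>l\<in>F. v l * T (l2_delta \<one>) (h \<otimes> inv l)) = (\<Sum>l\<in>F. v l * T (l2_delta l) h)"
    proof (rule sum.cong[OF refl])
      fix l assume "l \<in> F"
      then have "T (l2_delta l) h = T (l2_delta \<one>) (h \<otimes> inv l)"
        using h F H by (intro right_invariantD(2)[OF LG_right_invariant[OF T(1)]]) auto
      then show "v l * T (l2_delta \<one>) (h \<otimes> inv l) = v l * T (l2_delta l) h" by (rule arg_cong[OF sym])
    qed
    then show "(cmod (\<Sum>l\<in>F. v l * T (l2_delta \<one>) (h \<otimes> inv l)))\<^sup>2 = (cmod (T ?v h))\<^sup>2"
      unfolding Tv by (rule arg_cong)
  qed
  also have "\<dots> \<le> (l2_norm S (T ?v))\<^sup>2"
    by (intro finite_mass_le bounded_opersD(2)[OF LG_bounded[OF T(1)] v2(1)] H)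
  also have "\<dots> = (\<Sum>l\<in>F. (cmod (v l))\<^sup>2)"
    unfolding unitary_norm[OF LG_bounded[OF T(1)] T(2) v2(1)] by (rule v2(2))
  finally show ?thesis .
qed

end

section \<open>Almost invariant measures under elementary matrices\<close>

text \<open>The maps \<open>a\<close> and \<open>b\<close> move the plane point
  \<open>(r, s)\<close> by the two elementary matrices, except on a set \<open>B\<close> of small
  measure. The exception is meant for the torus, where representatives of large size do not
  add.\<close>

locale almost_invariant_measure =
  fixes X :: "'x set" and \<mu> :: "'x set \<Rightarrow> real" and a b :: "'x \<Rightarrow> 'x" and \<epsilon> \<delta> :: real
    and B :: "'x set" and r s :: "'x \<Rightarrow> real"
  assumes mono: "P \<subseteq> Q \<Longrightarrow> Q \<subseteq> X \<Longrightarrow> \<mu> P \<le> \<mu> Q"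
    and additive: "P \<subseteq> X \<Longrightarrow> Q \<subseteq> X \<Longrightarrow> P \<inter> Q = {} \<Longrightarrow> \<mu> (P \<union> Q) = \<mu> P + \<mu> Q"
    and bij_a: "bij_betw a X X" and bij_b: "bij_betw b X X"
    and inv_a: "P \<subseteq> X \<Longrightarrow> \<bar>\<mu> (a ` P) - \<mu> P\<bar> \<le> \<epsilon>" and inv_b: "P \<subseteq> X \<Longrightarrow> \<bar>\<mu> (b ` P) - \<mu> P\<bar> \<le> \<epsilon>"
    and B: "B \<subseteq> X" "\<mu> B \<le> \<delta>"
    and a: "x \<in> X \<Longrightarrow> x \<notin> B \<Longrightarrow> r (a x) = r x + s x" "x \<in> X \<Longrightarrow> x \<notin> B \<Longrightarrow> s (a x) = s x"
    and b: "x \<in> X \<Longrightarrow> x \<notin> B \<Longrightarrow> r (b x) = r x" "x \<in> X \<Longrightarrow> x \<notin> B \<Longrightarrow> s (b x) = s x + r x"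
begin

lemma empty: "\<mu> {} = 0"
  using additive[of "{}" "{}"] by simp

lemma nonneg: "P \<subseteq> X \<Longrightarrow> 0 \<le> \<mu> P"
  using mono[of "{}" P] empty by simp

lemma subadditive:
  assumes "P \<subseteq> Q \<union> R" "Q \<subseteq> X" "R \<subseteq> X"
  shows "\<mu> P \<le> \<mu> Q + \<mu> R"
proof -
  have "\<mu> P \<le> \<mu> (Q \<union> (R - Q))" using assms by (intro mono) auto
  also have "\<dots> = \<mu> Q + \<mu> (R - Q)" using assms by (intro additive) auto
  also have "\<mu> (R - Q) \<le> \<mu> R" using assms by (intro mono) auto
  finally show ?thesis by simp
qed

lemma push_forward:
  assumes c: "c = a \<or> c = b" and PQ: "P \<subseteq> X" "Q \<subseteq> X" and im: "c ` (P - B) \<subseteq> Q"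
  shows "\<mu> P \<le> \<mu> Q + (\<epsilon> + \<delta>)"
proof -
  have "\<mu> P \<le> \<mu> (P - B) + \<mu> B" using PQ B by (intro subadditive) auto
  moreover have "\<mu> (P - B) \<le> \<mu> (c ` (P - B)) + \<epsilon>"
  proof -
    have "P - B \<subseteq> X" using PQ by auto
    then show ?thesis using inv_a[of "P - B"] inv_b[of "P - B"] c by (auto simp: abs_le_iff)
  qed
  moreover have "\<mu> (c ` (P - B)) \<le> \<mu> Q" using im PQ by (intro mono)
  ultimately show ?thesis using B by simp
qed

text \<open>Covering \<open>P\<close> by the images of \<open>B\<close> and \<open>Q\<close> handles
  the inverse map without naming it. Each of the two images costs one \<epsilon>, hence
  \<open>2 * \<epsilon>\<close>.\<close>

lemma pull_back:
  assumes c: "c = a \<or> c = b" and PQ: "P \<subseteq> X" "Q \<subseteq> X"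
    and im: "\<And>x. x \<in> X \<Longrightarrow> x \<notin> B \<Longrightarrow> c x \<in> P \<Longrightarrow> x \<in> Q"
  shows "\<mu> P \<le> \<mu> Q + (2 * \<epsilon> + \<delta>)"
proof -
  have cX: "c ` X = X" using c bij_a bij_b by (auto simp: bij_betw_def)
  have "P \<subseteq> c ` B \<union> c ` Q"
  proof
    fix y assume y: "y \<in> P"
    then obtain x where "x \<in> X" "y = c x" using PQ cX by blast
    then show "y \<in> c ` B \<union> c ` Q" using im y by blast
  qed
  then have "\<mu> P \<le> \<mu> (c ` B) + \<mu> (c ` Q)" using PQ B cX by (intro subadditive) blast+
  moreover have "\<mu> (c ` B) \<le> \<mu> B + \<epsilon>" "\<mu> (c ` Q) \<le> \<mu> Q + \<epsilon>"
    using inv_a[of B] inv_b[of B] inv_a[of Q] inv_b[of Q] PQ B c by (auto simp: abs_le_iff)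
  ultimately show ?thesis using B by simp
qed

text \<open>
  In the quadrants where \<open>r\<close> and \<open>s\<close> have the same sign, \<open>a\<close> pushes everything into \<open>\<bar>s\<bar> \<le> \<bar>r\<bar>\<close> and \<open>b\<close>
  into \<open>\<bar>r\<bar> \<le> \<bar>s\<bar>\<close>; in the other quadrants the inverses do.
\<close>

lemma measure_nonzero_le: "\<mu> {x \<in> X. r x \<noteq> 0 \<or> s x \<noteq> 0} \<le> 12 * (\<epsilon> + \<delta>)"
proof -
  define R where "R C = {x \<in> X. C (r x) (s x)}" for C :: "real \<Rightarrow> real \<Rightarrow> bool"
  have RX: "R C \<subseteq> X" for C by (auto simp: R_def)
  \<comment> \<open>By \<open>lt\<close> and \<open>gt\<close> the parts above and below the
    diagonal have measure at most \<eta> each; by \<open>eq\<close> the diagonal itself has at most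
    one of these parts plus \<eta>, so the total is \<open>4 * \<eta>\<close>.\<close>
  have split3: "\<mu> (R C) \<le> 4 * \<eta>"
    if lt: "\<mu> (R C) \<le> \<mu> (R (\<lambda>x y. C x y \<and> \<bar>y\<bar> \<le> \<bar>x\<bar>)) + \<eta>"
      and gt: "\<mu> (R C) \<le> \<mu> (R (\<lambda>x y. C x y \<and> \<bar>x\<bar> \<le> \<bar>y\<bar>)) + \<eta>"
      and eq: "\<mu> (R (\<lambda>x y. C x y \<and> \<bar>x\<bar> = \<bar>y\<bar>)) \<le> \<mu> (R (\<lambda>x y. C x y \<and> \<bar>y\<bar> < \<bar>x\<bar>)) + \<eta>" for C \<eta>
  proof -
    have Un: "R C = R (\<lambda>x y. C x y \<and> D x y) \<union> R (\<lambda>x y. C x y \<and> \<not> D x y)"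
      "R (\<lambda>x y. C x y \<and> D x y) \<inter> R (\<lambda>x y. C x y \<and> \<not> D x y) = {}" for D
      by (auto simp: R_def)
    have 1: "\<mu> (R C) = \<mu> (R (\<lambda>x y. C x y \<and> \<bar>y\<bar> \<le> \<bar>x\<bar>)) + \<mu> (R (\<lambda>x y. C x y \<and> \<bar>x\<bar> < \<bar>y\<bar>))"
      using additive[OF RX RX Un(2)] Un(1) by (simp flip: not_le; metis)
    have 2: "\<mu> (R C) = \<mu> (R (\<lambda>x y. C x y \<and> \<bar>x\<bar> \<le> \<bar>y\<bar>)) + \<mu> (R (\<lambda>x y. C x y \<and> \<bar>y\<bar> < \<bar>x\<bar>))"
      using additive[OF RX RX Un(2)] Un(1) by (simp flip: not_le; metis)
    have 3: "\<mu> (R (\<lambda>x y. C x y \<and> \<bar>x\<bar> \<le> \<bar>y\<bar>)) \<le>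
        \<mu> (R (\<lambda>x y. C x y \<and> \<bar>x\<bar> < \<bar>y\<bar>)) + \<mu> (R (\<lambda>x y. C x y \<and> \<bar>x\<bar> = \<bar>y\<bar>))"
      by (rule subadditive[OF _ RX RX]) (auto simp: R_def)
    show ?thesis using 1 2 3 lt gt eq by linarith
  qed
  let ?same = "\<lambda>x y :: real. 0 \<le> x * y \<and> (x \<noteq> 0 \<or> y \<noteq> 0)"
  let ?opp = "\<lambda>x y :: real. x * y \<le> 0 \<and> (x \<noteq> 0 \<or> y \<noteq> 0)"
  have aX: "a x \<in> X" "b x \<in> X" if "x \<in> X" for x
    using that bij_a bij_b by (auto simp: bij_betw_def)
  have same: "\<mu> (R ?same) \<le> 4 * (\<epsilon> + \<delta>)"
  proof (rule split3)
    have abs: "\<bar>x + y\<bar> = \<bar>x\<bar> + \<bar>y\<bar>" "0 \<le> (x + y) * y" "0 \<le> x * (y + x)"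
      "\<bar>y + x\<bar> = \<bar>x\<bar> + \<bar>y\<bar>" if "0 \<le> x * y" for x y :: real
      using that by (auto simp: zero_le_mult_iff abs_if algebra_simps)
    show "\<mu> (R ?same) \<le> \<mu> (R (\<lambda>x y. ?same x y \<and> \<bar>y\<bar> \<le> \<bar>x\<bar>)) + (\<epsilon> + \<delta>)"
      by (rule push_forward[of a, OF _ RX RX]) (auto simp: R_def a abs aX)
    show "\<mu> (R ?same) \<le> \<mu> (R (\<lambda>x y. ?same x y \<and> \<bar>x\<bar> \<le> \<bar>y\<bar>)) + (\<epsilon> + \<delta>)"
      by (rule push_forward[of b, OF _ RX RX]) (auto simp: R_def b abs(3,4) aX)
    show "\<mu> (R (\<lambda>x y. ?same x y \<and> \<bar>x\<bar> = \<bar>y\<bar>)) \<le> \<mu> (R (\<lambda>x y. ?same x y \<and> \<bar>y\<bar> < \<bar>x\<bar>)) + (\<epsilon> + \<delta>)"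
      by (rule push_forward[of a, OF _ RX RX]) (auto simp: R_def a abs aX)
  qed
  have opp: "\<mu> (R ?opp) \<le> 4 * (2 * \<epsilon> + \<delta>)"
  proof (rule split3)
    have abs: "(x - y) * y \<le> 0" "x * (y - x) \<le> 0" "\<bar>x - y\<bar> = \<bar>x\<bar> + \<bar>y\<bar>" if "x * y \<le> 0" for x y :: real
    proof -
      show "(x - y) * y \<le> 0" "x * (y - x) \<le> 0"
        using that zero_le_square[of x] zero_le_square[of y]
        unfolding left_diff_distrib right_diff_distrib by linarith+
      show "\<bar>x - y\<bar> = \<bar>x\<bar> + \<bar>y\<bar>" using that by (auto simp: mult_le_0_iff abs_if)
    qed
    have a': "r x = r (a x) - s (a x)" "s x = s (a x)" if "x \<in> X" "x \<notin> B" for x using a[OF that] by auto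
    have b': "s x = s (b x) - r (b x)" "r x = r (b x)" if "x \<in> X" "x \<notin> B" for x using b[OF that] by auto
    have a_opp: "?opp (r x) (s x)" "\<bar>s x\<bar> \<le> \<bar>r x\<bar>" "\<bar>r (a x)\<bar> = \<bar>s (a x)\<bar> \<Longrightarrow> \<bar>s x\<bar> < \<bar>r x\<bar>"
      if "x \<in> X" "x \<notin> B" "?opp (r (a x)) (s (a x))" for x
      using a'[OF that(1,2)] abs[of "r (a x)" "s (a x)"] that(3) by auto
    have b_opp: "?opp (r x) (s x)" "\<bar>r x\<bar> \<le> \<bar>s x\<bar>"
      if "x \<in> X" "x \<notin> B" "?opp (r (b x)) (s (b x))" for x
      using b'[OF that(1,2)] abs[of "r (b x)" "s (b x)"] that(3)
      by (auto simp: abs_minus_commute[of "s _"])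
    show "\<mu> (R ?opp) \<le> \<mu> (R (\<lambda>x y. ?opp x y \<and> \<bar>y\<bar> \<le> \<bar>x\<bar>)) + (2 * \<epsilon> + \<delta>)"
      by (rule pull_back[of a, OF _ RX RX]) (use a_opp in \<open>auto simp: R_def\<close>)
    show "\<mu> (R ?opp) \<le> \<mu> (R (\<lambda>x y. ?opp x y \<and> \<bar>x\<bar> \<le> \<bar>y\<bar>)) + (2 * \<epsilon> + \<delta>)"
      by (rule pull_back[of b, OF _ RX RX]) (use b_opp in \<open>auto simp: R_def\<close>)
    show "\<mu> (R (\<lambda>x y. ?opp x y \<and> \<bar>x\<bar> = \<bar>y\<bar>)) \<le> \<mu> (R (\<lambda>x y. ?opp x y \<and> \<bar>y\<bar> < \<bar>x\<bar>)) + (2 * \<epsilon> + \<delta>)"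
      by (rule pull_back[of a, OF _ RX RX]) (use a_opp in \<open>auto simp: R_def\<close>)
  qed
  have "\<mu> {x \<in> X. r x \<noteq> 0 \<or> s x \<noteq> 0} \<le> \<mu> (R ?same) + \<mu> (R ?opp)"
    by (rule subadditive[OF _ RX RX]) (auto simp: R_def)
  \<comment> \<open>The two regions contribute \<open>12 * \<epsilon> + 8 * \<delta>\<close>
    altogether; nonnegativity of \<delta> allows rounding up to the uniform constant 12.\<close>
  moreover have "0 \<le> \<delta>" using B nonneg[of B] by linarith
  ultimately show ?thesis using same opp by simp
qed

end

lemma ex_3: "(\<exists>i::3. P i) \<longleftrightarrow> P 1 \<or> P 2 \<or> P 3"
  by (metis exhaust_3)

section \<open>Masses of square summable functions\<close>

lemma mass_nonneg: "0 \<le> mass f X"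
  by (simp add: infsum_nonneg)

lemma mass_mono: "(\<lambda>x. (cmod (f x))\<^sup>2) summable_on Y \<Longrightarrow> X \<subseteq> Y \<Longrightarrow> mass f X \<le> mass f Y"
  using summable_on_subset_banach by (intro infsum_mono_neutral) auto

lemma mass_union:
  assumes "(\<lambda>x. (cmod (f x))\<^sup>2) summable_on Y" "P \<subseteq> Y" "Q \<subseteq> Y" "P \<inter> Q = {}"
  shows "mass f (P \<union> Q) = mass f P + mass f Q"
  using assms summable_on_subset_banach by (intro infsum_Un_disjoint) blast+

lemma mass_reindex: "inj_on h X \<Longrightarrow> mass f (h ` X) = mass (\<lambda>x. f (h x)) X"
  by (subst infsum_reindex) (simp_all add: comp_def)

lemma square_summable_diff:
  assumes "(\<lambda>x. (cmod (f x))\<^sup>2) summable_on X" "(\<lambda>x. (cmod (g x))\<^sup>2) summable_on X"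
  shows "(\<lambda>x. (cmod (f x - g x))\<^sup>2) summable_on X"
proof -
  define cut where "cut h x = (if x \<in> X then h x else 0)" for h :: "'a \<Rightarrow> complex" and x
  have "cut f \<in> l2 X" "cut g \<in> l2 X"
    using assms by (auto simp: l2_def cut_def cong: summable_on_cong)
  from l2_summable[OF l2_diff(1)[OF this]] show ?thesis by (simp add: cut_def cong: summable_on_cong)
qed

text \<open>A difference of squared norms factors into the difference and the sum of the norms; both
  norms are at most 1, which gives the factor 2 that \<open>defect\<close> carries later.\<close>

lemma mass_difference:
  assumes f: "(\<lambda>x. (cmod (f x))\<^sup>2) summable_on X" "mass f X \<le> 1"
    and g: "(\<lambda>x. (cmod (g x))\<^sup>2) summable_on X" "mass g X \<le> 1"
    and Y: "Y \<subseteq> X"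
  shows "\<bar>mass f Y - mass g Y\<bar> \<le> 2 * sqrt (mass (\<lambda>x. f x - g x) X)"
proof -
  define cut where "cut h x = (if x \<in> Y then h x else 0)" for h :: "'a \<Rightarrow> complex" and x
  have cut_l2: "cut h \<in> l2 Y" if "(\<lambda>x. (cmod (h x))\<^sup>2) summable_on X" for h
    using summable_on_subset_banach[OF that Y] by (auto simp: l2_def cut_def cong: summable_on_cong)
  have norm_cut: "l2_norm Y (cut h) = sqrt (mass h Y)" for h
    by (simp add: l2_norm_def cut_def cong: infsum_cong)
  have diff_summable: "(\<lambda>x. (cmod (f x - g x))\<^sup>2) summable_on X"
    using f(1) g(1) by (rule square_summable_diff)
  let ?d = "sqrt (mass (\<lambda>x. f x - g x) Y)"
  have diff: "(\<lambda>x. cut f x - cut g x) = cut (\<lambda>x. f x - g x)" by (auto simp: cut_def)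
  have "l2_norm Y (cut f) \<le> ?d + l2_norm Y (cut g)"
    using l2_add(2)[OF l2_diff(1)[OF cut_l2[OF f(1)] cut_l2[OF g(1)]] cut_l2[OF g(1)]]
    by (simp add: diff norm_cut)
  moreover have "l2_norm Y (cut g) \<le> l2_norm Y (cut f) + ?d"
    using l2_diff(2)[OF cut_l2[OF f(1)] l2_diff(1)[OF cut_l2[OF f(1)] cut_l2[OF g(1)]]]
    by (simp add: diff norm_cut)
  ultimately have d: "\<bar>sqrt (mass f Y) - sqrt (mass g Y)\<bar> \<le> ?d" by (simp add: norm_cut abs_le_iff)
  have le1: "sqrt (mass f Y) \<le> 1" "sqrt (mass g Y) \<le> 1"
    using mass_mono[OF f(1) Y] mass_mono[OF g(1) Y] f g by simp_all
  have "\<bar>mass f Y - mass g Y\<bar> = \<bar>(sqrt (mass f Y))\<^sup>2 - (sqrt (mass g Y))\<^sup>2\<bar>"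
    by (simp add: mass_nonneg)
  also have "\<dots> = \<bar>sqrt (mass f Y) - sqrt (mass g Y)\<bar> * (sqrt (mass f Y) + sqrt (mass g Y))"
  proof -
    have factor: "\<bar>x\<^sup>2 - y\<^sup>2\<bar> = \<bar>x - y\<bar> * (x + y)" if "0 \<le> x" "0 \<le> y" for x y :: real
      using that by (simp add: power2_eq_square square_diff_square_factored abs_mult)
    show ?thesis by (rule factor) (simp_all add: mass_nonneg)
  qed
  also have "\<dots> \<le> ?d * 2"
    using d add_mono[OF le1] by (intro mult_mono) (auto simp: mass_nonneg)
  also have "?d \<le> sqrt (mass (\<lambda>x. f x - g x) X)"
    using mass_mono[OF diff_summable Y] by simp
  finally show ?thesis by simp
qed

section \<open>Asymptotically conjugation invariant vectors\<close>

context vaes_group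
begin

lemma e_closed [simp]: "x \<in> carrier K \<Longrightarrow> det M = 1 \<Longrightarrow> e (x, M) \<in> carrier G"
  using e_hom by (auto simp: hom_def Pi_iff)

lemma e_mult: "x \<in> carrier K \<Longrightarrow> y \<in> carrier K \<Longrightarrow> det M = 1 \<Longrightarrow> det N = 1 \<Longrightarrow>
    e (x, M) \<otimes> e (y, N) = e (x \<otimes>\<^bsub>K\<^esub> K_act p M y, M ** N)"
  using hom_mult[OF e_hom, of "(x, M)" "(y, N)"] by simp

lemma e_one: "e (zero_K, mat 1) = \<one>"
  using hom_one[OF e_hom group_G0 is_group] by simp

lemma e_eq_iff: "x \<in> carrier K \<Longrightarrow> y \<in> carrier K \<Longrightarrow> det M = 1 \<Longrightarrow> det N = 1 \<Longrightarrow>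
    e (x, M) = e (y, N) \<longleftrightarrow> x = y \<and> M = N"
  using e_inj by (auto simp: inj_on_def)

abbreviation "KG \<equiv> (\<lambda>x. e (x, mat 1)) ` carrier K"
abbreviation "lam M \<equiv> e (zero_K, M)"

lemma conj_lam:
  assumes "x \<in> carrier K" "det A = 1" "det M = 1" "det M' = 1" "M' ** M = mat 1"
  shows "conj (lam M) (e (x, A)) = e (K_act p M x, M ** A ** M')"
proof -
  have "inv (lam M) = lam M'"
    using assms by (intro inv_equality) (auto simp: e_mult e_one)
  then show ?thesis using assms by (simp add: e_mult K_act_closed K_act_one det_mul)
qed

lemma subgroup_G0: "subgroup (e ` carrier G0) G"
  using group_hom.img_is_subgroup[of G0 G e] e_hom group_G0 is_group
  by (simp add: group_hom_def group_hom_axioms_def)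

lemma inv_cancel: "g \<in> S \<Longrightarrow> x \<in> S \<Longrightarrow> inv g \<otimes> (g \<otimes> x) = x" "g \<in> S \<Longrightarrow> x \<in> S \<Longrightarrow> g \<otimes> (inv g \<otimes> x) = x"
  by (simp_all add: m_assoc[symmetric])

lemma bij_conj_subgroup:
  assumes H: "subgroup H G" "g \<in> H"
  shows "bij_betw (conj g) H H" "bij_betw (conj g) (S - H) (S - H)"
proof -
  interpret H: subgroup H G by (rule H)
  have HS: "h \<in> S" if "h \<in> H" for h using that by simp
  show 1: "bij_betw (conj g) H H"
    by (rule bij_betwI[of _ _ _ "conj (inv g)"]) (use H HS in \<open>auto simp: m_assoc inv_cancel\<close>)
  have 2: "bij_betw (conj g) S S" using H HS by (intro bij_conj) auto
  have "conj g ` (S - H) = conj g ` S - conj g ` H"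
    using 2 H.subset by (intro inj_on_image_set_diff[of _ S]) (auto simp: bij_betw_def)
  then show "bij_betw (conj g) (S - H) (S - H)"
    using 1 2 by (auto simp: bij_betw_def intro: inj_on_subset)
qed

end

text \<open>Instantiated twice: with a constant sequence obtained from a finite conjugacy class, and
  with the vectors of a central sequence.\<close>

locale asymptotically_invariant = vaes_group +
  fixes \<xi> :: "nat \<Rightarrow> 'a \<Rightarrow> complex"
  assumes summable: "(\<lambda>x. (cmod (\<xi> i x))\<^sup>2) summable_on carrier G"
    and mass_le: "mass (\<xi> i) (carrier G) \<le> 1"
    and asymptotic: "g \<in> carrier G \<Longrightarrow>
      (\<lambda>i. sqrt (mass (\<lambda>x. \<xi> i (g \<otimes> x \<otimes> inv g) - \<xi> i x) (carrier G))) \<longlonglongrightarrow> 0"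
begin

abbreviation "m i \<equiv> mass (\<xi> i)"

definition defect :: "'a \<Rightarrow> nat \<Rightarrow> real" where
  "defect g i = 2 * sqrt (mass (\<lambda>x. \<xi> i (conj g x) - \<xi> i x) S)"

lemma defect_tendsto: "g \<in> S \<Longrightarrow> defect g \<longlonglongrightarrow> 0"
  unfolding defect_def using tendsto_mult[OF tendsto_const asymptotic, of g 2] by simp

lemma defect_nonneg: "0 \<le> defect g i"
  by (simp add: defect_def mass_nonneg)

lemma m_conj:
  assumes g: "g \<in> S" and P: "P \<subseteq> S"
  shows "\<bar>m i (conj g ` P) - m i P\<bar> \<le> defect g i"
proof -
  note bij = bij_conj[OF g]
  have inj: "inj_on (conj g) P" using bij P by (auto simp: bij_betw_def intro: inj_on_subset)
  have "(\<lambda>x. (cmod (\<xi> i (conj g x)))\<^sup>2) summable_on S"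
    using summable_on_reindex_bij_betw[OF bij, of "\<lambda>x. (cmod (\<xi> i x))\<^sup>2"] summable by simp
  moreover have "mass (\<lambda>x. \<xi> i (conj g x)) S \<le> 1"
    using infsum_reindex_bij_betw[OF bij, of "\<lambda>x. (cmod (\<xi> i x))\<^sup>2"] mass_le by simp
  ultimately show ?thesis
    unfolding mass_reindex[OF inj] defect_def using summable mass_le P by (intro mass_difference)
qed

definition null :: "'a set \<Rightarrow> bool" where
  "null P \<longleftrightarrow> P \<subseteq> S \<and> (\<lambda>i. m i P) \<longlonglongrightarrow> 0"

lemma nullI:
  assumes "P \<subseteq> S" "\<And>i. m i P \<le> c i" "c \<longlonglongrightarrow> 0"
  shows "null P"
  unfolding null_def
  using assms by (auto intro!: tendsto_sandwich[of "\<lambda>_. 0" "\<lambda>i. m i P" sequentially c 0] simp: mass_nonneg)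

lemma null_subset: "null Q \<Longrightarrow> P \<subseteq> Q \<Longrightarrow> null P"
  using summable_on_subset_banach[OF summable]
  by (intro nullI[of P "\<lambda>i. m i Q"] mass_mono) (auto simp: null_def)

lemma null_union: "null P \<Longrightarrow> null Q \<Longrightarrow> null (P \<union> Q)"
proof (rule nullI[of _ "\<lambda>i. m i P + m i Q"])
  assume PQ: "null P" "null Q"
  then show "P \<union> Q \<subseteq> S" by (auto simp: null_def)
  show "(\<lambda>i. m i P + m i Q) \<longlonglongrightarrow> 0"
    using PQ tendsto_add[of "\<lambda>i. m i P" 0 sequentially "\<lambda>i. m i Q" 0] by (simp add: null_def)
  fix i
  have "m i (P \<union> Q) = m i (P \<union> (Q - P))" by simp
  also have "\<dots> = m i P + m i (Q - P)"
    using PQ by (intro mass_union[OF summable]) (auto simp: null_def)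
  also have "m i (Q - P) \<le> m i Q"
    using PQ summable_on_subset_banach[OF summable] by (intro mass_mono) (auto simp: null_def)
  finally show "m i (P \<union> Q) \<le> m i P + m i Q" by simp
qed

lemma null_UN: "finite I \<Longrightarrow> (\<And>i. i \<in> I \<Longrightarrow> null (P i)) \<Longrightarrow> null (\<Union>i\<in>I. P i)"
proof (induction I rule: finite_induct)
  case empty
  show ?case by (simp add: null_def)
next
  case (insert i I)
  then show ?case by (simp add: null_union)
qed

lemma null_conj:
  assumes "g \<in> S" "P \<subseteq> S" "conj g ` P \<subseteq> Q" "null Q"
  shows "null P"
proof (rule nullI[of _ "\<lambda>i. m i Q + defect g i"])
  show "(\<lambda>i. m i Q + defect g i) \<longlonglongrightarrow> 0"
    using tendsto_add[OF _ defect_tendsto[OF assms(1)], of "\<lambda>i. m i Q" 0] assms(4) by (simp add: null_def)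
  fix i
  have "Q \<subseteq> S" using assms by (simp add: null_def)
  have "m i (conj g ` P) \<le> m i Q"
    using summable_on_subset_banach[OF summable \<open>Q \<subseteq> S\<close>] assms by (intro mass_mono)
  then show "m i P \<le> m i Q + defect g i" using m_conj[OF assms(1,2), of i] by linarith
qed (rule assms)

text \<open>Integer coordinates transform exactly, so the exceptional set is empty and only the
  defects of the two group elements enter.\<close>

lemma null_elementary:
  fixes r s :: "'a \<Rightarrow> int"
  assumes X: "X \<subseteq> S" and g: "g \<in> S" "bij_betw (conj g) X X" and h: "h \<in> S" "bij_betw (conj h) X X"
    and "\<And>x. x \<in> X \<Longrightarrow> r (conj g x) = r x + s x" "\<And>x. x \<in> X \<Longrightarrow> s (conj g x) = s x"
    and "\<And>x. x \<in> X \<Longrightarrow> r (conj h x) = r x" "\<And>x. x \<in> X \<Longrightarrow> s (conj h x) = s x + r x"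
  shows "null {x \<in> X. r x \<noteq> 0 \<or> s x \<noteq> 0}"
proof (rule nullI[of _ "\<lambda>i. 12 * (defect g i + defect h i)"])
  show "(\<lambda>i. 12 * (defect g i + defect h i)) \<longlonglongrightarrow> 0"
    using tendsto_mult[OF tendsto_const tendsto_add[OF defect_tendsto[OF g(1)] defect_tendsto[OF h(1)]], of 12]
    by simp
  fix i
  interpret almost_invariant_measure X "m i" "conj g" "conj h" "defect g i + defect h i" 0 "{}"
    "\<lambda>x. real_of_int (r x)" "\<lambda>x. real_of_int (s x)"
  proof unfold_locales
    show "m i P \<le> m i Q" if "P \<subseteq> Q" "Q \<subseteq> X" for P Q
      using that X summable_on_subset_banach[OF summable] by (intro mass_mono) blast+
    show "m i (P \<union> Q) = m i P + m i Q" if "P \<subseteq> X" "Q \<subseteq> X" "P \<inter> Q = {}" for P Q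
      using that X by (intro mass_union[OF summable]) auto
    show "\<bar>m i (conj g ` P) - m i P\<bar> \<le> defect g i + defect h i" if "P \<subseteq> X" for P
      using m_conj[OF g(1) order_trans[OF that X], of i] defect_nonneg[of h i] by simp
    show "\<bar>m i (conj h ` P) - m i P\<bar> \<le> defect g i + defect h i" if "P \<subseteq> X" for P
      using m_conj[OF h(1) order_trans[OF that X], of i] defect_nonneg[of g i] by simp
  qed (use assms in auto)
  show "m i {x \<in> X. r x \<noteq> 0 \<or> s x \<noteq> 0} \<le> 12 * (defect g i + defect h i)"
    using measure_nonzero_le by simp
qed (use X in auto)

lemma null_outside_G0: "null (S - e ` carrier G0)"
proof -
  let ?X = "S - e ` carrier G0"
  have null: "null {x \<in> ?X. \<phi> x $ i \<noteq> 0 \<or> \<phi> x $ j \<noteq> 0}" if ij: "i \<noteq> j" for i j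
  proof -
    have in_G0: "lam (elem k l) \<in> e ` carrier G0" "lam (elem k l) \<in> S" if "k \<noteq> l" for k l
      using that by (simp_all add: det_elem)
    show ?thesis
      by (rule null_elementary[of _ "lam (elem i j)" "lam (elem j i)"])
        (use ij in \<open>auto intro!: bij_conj_subgroup(2)[OF subgroup_G0] in_G0
          simp: \<phi>_conj det_elem elem_mult_vec simp del: G0_simps\<close>)
  qed
  \<comment> \<open>The coordinate pairs (1, 2) and (1, 3) together see every nonzero
    vector.\<close>
  have "null ({x \<in> ?X. \<phi> x $ 1 \<noteq> 0 \<or> \<phi> x $ 2 \<noteq> 0} \<union> {x \<in> ?X. \<phi> x $ 1 \<noteq> 0 \<or> \<phi> x $ 3 \<noteq> 0})"
    by (intro null_union null) auto
  then show ?thesis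
    by (rule null_subset) (use \<phi>_nonzero in \<open>auto simp: vec_eq_iff forall_3 simp del: G0_simps\<close>)
qed

definition matrix_part :: "'a \<Rightarrow> int^3^3" where
  "matrix_part g = snd (inv_into (carrier G0) e g)"

lemma matrix_part: "x \<in> carrier K \<Longrightarrow> det M = 1 \<Longrightarrow> matrix_part (e (x, M)) = M"
  using inv_into_f_f[OF e_inj, of "(x, M)"] by (simp add: matrix_part_def)

text \<open>With the elementary matrix on the right instead of its inverse on the other side, both
  products are plain row and column operations.\<close>

lemma matrix_part_conj:
  assumes "i \<noteq> j" "g \<in> e ` carrier G0"
  shows "matrix_part (conj (lam (elem i j)) g) ** elem i j = elem i j ** matrix_part g"
proof -
  obtain x A where g: "g = e (x, A)" "x \<in> carrier K" "det A = 1" using assms by auto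
  obtain E' where E': "det E' = 1" "E' ** elem i j = mat 1"
    using SL3Z_inverse[OF det_elem[OF assms(1)]] by metis
  have "matrix_part (conj (lam (elem i j)) g) = elem i j ** A ** E'"
    using g E' det_elem[OF assms(1)] by (simp add: conj_lam matrix_part K_act_closed det_mul)
  then show ?thesis
    using g E' by (simp add: matrix_part matrix_mul_assoc[symmetric])
qed

text \<open>Once off-diagonal entries and differences of diagonal entries carry no mass, only scalar
  matrices are left, and over the integers determinant one makes a scalar matrix the
  identity.\<close>

lemma null_G0_outside_K: "null (e ` carrier G0 - KG)"
proof -
  let ?X = "e ` carrier G0"
  have X: "?X \<subseteq> S" using subgroup.subset[OF subgroup_G0] .
  have lam: "lam (elem i j) \<in> ?X" "lam (elem i j) \<in> S" if "i \<noteq> j" for i j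
    using that by (simp_all add: det_elem)
  have bij: "bij_betw (conj (lam (elem i j))) ?X ?X" if "i \<noteq> j" for i j
    using that lam by (intro bij_conj_subgroup(1)[OF subgroup_G0])
  have entry: "matrix_part (conj (lam (elem i j)) x) $ k $ l + (if l = j then matrix_part (conj (lam (elem i j)) x) $ k $ i else 0) =
      matrix_part x $ k $ l + (if k = i then matrix_part x $ j $ l else 0)" if "i \<noteq> j" "x \<in> ?X" for i j k l x
    using arg_cong[OF matrix_part_conj[OF that], of "\<lambda>A. A $ k $ l"] that(1)
    by (simp add: mult_elem elem_mult)
  have off: "null {x \<in> ?X. matrix_part x $ i $ k \<noteq> 0}" if "i \<noteq> k" for i k :: 3
  proof -
    \<comment> \<open>With \<open>j\<close> the third index, column \<open>k\<close> is neither
      \<open>i\<close> nor \<open>j\<close>. The right factor of the conjugation leaves it alone, so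
      it transforms as a vector under row operations.\<close>
    obtain j :: 3 where j: "j \<noteq> i" "j \<noteq> k"
    proof -
      have "\<exists>j::3. j \<noteq> i \<and> j \<noteq> k"
        using exhaust_3[of i] exhaust_3[of k] by (elim disjE) (simp_all add: ex_3)
      then show ?thesis using that by blast
    qed
    have "null {x \<in> ?X. matrix_part x $ i $ k \<noteq> 0 \<or> matrix_part x $ j $ k \<noteq> 0}"
    proof (rule null_elementary[OF X, of "lam (elem i j)" "lam (elem j i)"])
      fix x assume x: "x \<in> ?X"
      show "matrix_part (conj (lam (elem i j)) x) $ i $ k = matrix_part x $ i $ k + matrix_part x $ j $ k"
        "matrix_part (conj (lam (elem i j)) x) $ j $ k = matrix_part x $ j $ k"
        using entry[of i j x i k] entry[of i j x j k] x j that by auto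
      show "matrix_part (conj (lam (elem j i)) x) $ i $ k = matrix_part x $ i $ k"
        "matrix_part (conj (lam (elem j i)) x) $ j $ k = matrix_part x $ j $ k + matrix_part x $ i $ k"
        using entry[of j i x i k] entry[of j i x j k] x j that by auto
    qed (use j lam bij in auto)
    then show ?thesis by (rule null_subset) auto
  qed
  define N where "N = (\<Union>(i, k)\<in>{(i, k). i \<noteq> k}. {x \<in> ?X. matrix_part x $ i $ k \<noteq> 0})"
  have N: "null N" unfolding N_def by (rule null_UN) (use off in auto)
  \<comment> \<open>Conjugating a diagonal matrix by \<open>elem i j\<close> creates at place (i, j)
    the difference of the j-th and i-th diagonal entries, so unequal entries are carried into the
    null set \<open>N\<close>.\<close>
  have diag: "null {x \<in> ?X - N. matrix_part x $ i $ i \<noteq> matrix_part x $ j $ j}" if ij: "i \<noteq> j" for i j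
  proof (rule null_conj[OF lam(2)[OF ij] _ _ N])
    show "conj (lam (elem i j)) ` {x \<in> ?X - N. matrix_part x $ i $ i \<noteq> matrix_part x $ j $ j} \<subseteq> N"
    proof
      fix y assume "y \<in> conj (lam (elem i j)) ` {x \<in> ?X - N. matrix_part x $ i $ i \<noteq> matrix_part x $ j $ j}"
      then obtain x where x: "x \<in> ?X" "x \<notin> N" "matrix_part x $ i $ i \<noteq> matrix_part x $ j $ j"
        "y = conj (lam (elem i j)) x" by blast
      have yX: "y \<in> ?X" using bij[OF ij] x by (auto simp: bij_betw_def simp del: G0_simps)
      have zero: "matrix_part x $ k $ l = 0" if "k \<noteq> l" for k l using x(1,2) that unfolding N_def by blast
      have "matrix_part y $ i $ j \<noteq> 0"
        using entry[OF ij x(1), of i j] entry[OF ij x(1), of i i] zero[of i j] zero[of j i] x(3,4) ij by auto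
      then show "y \<in> N" using yX ij unfolding N_def by blast
    qed
  qed (use X in auto)
  have "null (N \<union> ({x \<in> ?X - N. matrix_part x $ 1 $ 1 \<noteq> matrix_part x $ 2 $ 2} \<union>
      {x \<in> ?X - N. matrix_part x $ 1 $ 1 \<noteq> matrix_part x $ 3 $ 3}))"
    by (intro null_union N diag) auto
  then show ?thesis
  proof (rule null_subset, intro subsetI)
    fix g assume g: "g \<in> ?X - KG"
    then obtain x A where x: "g = e (x, A)" "x \<in> carrier K" "det A = 1" by auto
    then have mp: "matrix_part g = A" by (simp add: matrix_part)
    show "g \<in> N \<union> ({x \<in> ?X - N. matrix_part x $ 1 $ 1 \<noteq> matrix_part x $ 2 $ 2} \<union>
        {x \<in> ?X - N. matrix_part x $ 1 $ 1 \<noteq> matrix_part x $ 3 $ 3})"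
    proof (rule ccontr)
      assume "\<not> ?thesis"
      then have *: "g \<notin> N" "A $ 1 $ 1 = A $ 2 $ 2" "A $ 1 $ 1 = A $ 3 $ 3" using g mp by auto
      have zero: "A $ k $ l = 0" if "k \<noteq> l" for k l using *(1) g that mp unfolding N_def by blast
      have cube: "A $ 1 $ 1 * A $ 1 $ 1 * A $ 1 $ 1 = 1" using x(3) zero * by (simp add: det_3)
      then have "A $ 1 $ 1 dvd 1" by (metis dvd_triv_right)
      then have "A $ 1 $ 1 = 1" using cube by (auto simp: zdvd1_eq abs_if split: if_splits)
      then have "A = mat 1" using zero * by (simp add: vec_eq_iff mat_def forall_3)
      then show False using g x by auto
    qed
  qed
qed

lemma null_outside_tail: "null (S - (\<lambda>x. e (x, mat 1)) ` T N)"
proof -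
  have 1: "null ((S - e ` carrier G0) \<union> (e ` carrier G0 - KG))"
    by (intro null_union null_outside_G0 null_G0_outside_K)
  then have K: "null (S - KG)" by (rule null_subset) blast
  have "null (KG - (\<lambda>x. e (x, mat 1)) ` T N)"
    by (rule null_conj[OF t_closed[of N] _ _ K]) (use t_moves[of _ N] t_closed in auto)
  then have "null ((S - KG) \<union> (KG - (\<lambda>x. e (x, mat 1)) ` T N))" using K by (rule null_union[rotated])
  then show ?thesis by (rule null_subset) auto
qed

end

section \<open>Infinite conjugacy classes\<close>

context vaes_group
begin

text \<open>The normalized indicator of a finite conjugacy class is exactly invariant. Taken as a
  constant sequence it has no mass outside any tail, and the intersection of the tails is
  trivial.\<close>

lemma icc_G: "icc G"
  unfolding icc_def
proof (intro conjI ballI notI)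
  fix g assume g: "g \<in> S - {\<one>}" and fin: "finite ((\<lambda>h. conj h g) ` S)"
  define C where "C = (\<lambda>h. conj h g) ` S"
  have C: "finite C" "C \<subseteq> S" using fin g by (auto simp: C_def)
  have gC: "g \<in> C" unfolding C_def using g by (intro image_eqI[of _ _ \<one>]) auto
  have conjC: "conj h x \<in> C" if hx: "h \<in> S" "x \<in> C" for h x
  proof -
    obtain k where k: "k \<in> S" "x = conj k g" using hx by (auto simp: C_def)
    then have "conj h x = conj (h \<otimes> k) g" using hx g by (simp add: m_assoc inv_mult_group)
    then show ?thesis using hx k by (auto simp: C_def)
  qed
  have conjC_iff: "conj h x \<in> C \<longleftrightarrow> x \<in> C" if "h \<in> S" "x \<in> S" for h x
  proof
    assume "conj h x \<in> C"
    then have "conj (inv h) (conj h x) \<in> C" using conjC[of "inv h"] that by blast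
    moreover have "conj (inv h) (conj h x) = x"
      using that by (simp add: m_assoc) (simp add: m_assoc[symmetric])
    ultimately show "x \<in> C" by simp
  qed (use conjC that in auto)
  define f where "f x = (if x \<in> C then complex_of_real (1 / sqrt (real (card C))) else 0)" for x
  have card: "0 < card C" using C gC card_gt_0_iff by blast
  have sq: "(cmod (f x))\<^sup>2 = (if x \<in> C then 1 / real (card C) else 0)" for x
    using card by (simp add: f_def norm_divide power_divide)
  have has_sum: "((\<lambda>x. (cmod (f x))\<^sup>2) has_sum (real (card (C \<inter> Y)) / real (card C))) Y" for Y
    by (rule has_sum_finite_neutralI[of "C \<inter> Y"]) (use C in \<open>auto simp: sq\<close>)
  interpret asymptotically_invariant p G e t \<phi> "\<lambda>_. f"
  proof unfold_locales
    show "(\<lambda>x. (cmod (f x))\<^sup>2) summable_on S" using has_sum by (rule has_sum_imp_summable)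
    show "mass f S \<le> 1" using infsumI[OF has_sum[of S]] C card by (simp add: Int_absorb2)
    show "(\<lambda>i. sqrt (mass (\<lambda>x. f (conj h x) - f x) S)) \<longlonglongrightarrow> 0" if "h \<in> S" for h
    proof -
      have "mass (\<lambda>x. f (conj h x) - f x) S = mass (\<lambda>x. 0) S"
        by (rule infsum_cong) (simp add: f_def conjC_iff that)
      then show ?thesis by simp
    qed
  qed
  have "g \<in> (\<lambda>x. e (x, mat 1)) ` T N" for N
  proof (rule ccontr)
    assume n: "g \<notin> (\<lambda>x. e (x, mat 1)) ` T N"
    let ?Y = "S - (\<lambda>x. e (x, mat 1)) ` T N"
    have "mass f ?Y = 0"
      using null_outside_tail[of N] LIMSEQ_unique[OF tendsto_const] by (auto simp: null_def)
    then have "card (C \<inter> ?Y) = 0" using infsumI[OF has_sum[of ?Y]] card by simp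
    then show False using n g gC C by auto
  qed
  then have tails: "\<exists>x\<in>T N. g = e (x, mat 1)" for N by blast
  obtain x where x: "x \<in> carrier K" "g = e (x, mat 1)" using tails[of 0] by (auto simp: K_tail_iff)
  have "x \<in> T N" for N
    using tails[of N] x by (auto simp: e_eq_iff K_tail_iff)
  then have "x n = (\<lambda>i. 0)" for n unfolding K_tail_iff by blast
  then have "x = zero_K" by auto
  then show False using g x e_one by simp
qed (rule is_group)

lemma infinite_G: "infinite S"
proof -
  let ?x = "\<lambda>n i. if n = 0 \<and> i = 1 then 1 else 0 :: int"
  have "{n. ?x n \<noteq> (\<lambda>i. 0)} \<subseteq> {0}" by auto
  then have x: "?x \<in> carrier K"
    using prime_gt_1_nat[OF prime_p[of 0]] by (auto simp: carrier_K intro: finite_subset)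
  have "?x \<noteq> zero_K" by (auto simp: fun_eq_iff)
  then have "e (?x, mat 1) \<noteq> \<one>" using x e_eq_iff[OF x, of zero_K "mat 1" "mat 1"] e_one by simp
  moreover have "e (?x, mat 1) \<in> S" using x by simp
  ultimately have "infinite ((\<lambda>h. conj h (e (?x, mat 1))) ` S)" using icc_G by (simp add: icc_def)
  then show ?thesis using finite_imageI by blast
qed

end

section \<open>The partial Fourier transform\<close>

lemma plancherel:
  fixes ch :: "'d \<Rightarrow> 'v \<Rightarrow> complex"
  assumes fin: "finite D" "finite V"
    and orth: "\<And>v v'. v \<in> V \<Longrightarrow> v' \<in> V \<Longrightarrow>
      (\<Sum>d\<in>D. ch d v * cnj (ch d v')) = (if v = v' then of_real c else 0)"
  shows "(\<Sum>d\<in>D. (cmod (\<Sum>v\<in>V. f v * ch d v))\<^sup>2) = c * (\<Sum>v\<in>V. (cmod (f v))\<^sup>2)"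
proof -
  have "complex_of_real (\<Sum>d\<in>D. (cmod (\<Sum>v\<in>V. f v * ch d v))\<^sup>2) =
      (\<Sum>d\<in>D. \<Sum>v\<in>V. \<Sum>v'\<in>V. f v * cnj (f v') * (ch d v * cnj (ch d v')))"
    unfolding of_real_sum complex_norm_square cnj_sum sum_product by (simp add: ac_simps)
  also have "\<dots> = (\<Sum>v\<in>V. \<Sum>v'\<in>V. f v * cnj (f v') * (\<Sum>d\<in>D. ch d v * cnj (ch d v')))"
    by (subst sum.swap, rule sum.cong[OF refl], subst sum.swap) (simp add: sum_distrib_left)
  also have "\<dots> = (\<Sum>v\<in>V. \<Sum>v'\<in>V. if v = v' then of_real c * (f v * cnj (f v)) else 0)"
    by (intro sum.cong) (auto simp: orth)
  also have "\<dots> = complex_of_real (c * (\<Sum>v\<in>V. (cmod (f v))\<^sup>2))"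
    using fin by (simp only: of_real_mult of_real_sum complex_norm_square) (simp add: sum_distrib_left)
  finally show ?thesis by (simp only: of_real_eq_iff)
qed

section \<open>Characters of a finite product of prime cyclic groups\<close>

locale finite_fourier = prime_seq p for p :: "nat \<Rightarrow> nat" +
  fixes J :: "nat set"
  assumes finite_J: "finite J" and inj_J: "inj_on p J"
begin

definition F :: "(nat \<Rightarrow> int) set" where
  "F = {w. (\<forall>n\<in>J. 0 \<le> w n \<and> w n < int (p n)) \<and> (\<forall>n. n \<notin> J \<longrightarrow> w n = 0)}"

definition add :: "(nat \<Rightarrow> int) \<Rightarrow> (nat \<Rightarrow> int) \<Rightarrow> nat \<Rightarrow> int" (infixl \<open>\<boxplus>\<close> 65) where
  "w \<boxplus> v = (\<lambda>n. (w n + v n) mod int (p n))"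

text \<open>Modulo 1 this embeds the product of the groups Z/p_n, n in \<open>J\<close>, into R/Z
  (Chinese remainder theorem). Composed with componentwise multiplication it is the pairing of the
  group with itself behind \<open>ch\<close>, and it makes products such as u y points of the
  circle.\<close>

definition \<theta> :: "(nat \<Rightarrow> int) \<Rightarrow> real" where
  "\<theta> w = (\<Sum>n\<in>J. of_int (w n) / real (p n))"

definition ch :: "(nat \<Rightarrow> int) \<Rightarrow> (nat \<Rightarrow> int) \<Rightarrow> complex" where
  "ch y v = cis (2 * pi * \<theta> (\<lambda>n. y n * v n))"

lemma finite_F: "finite F"
proof -
  have "F \<subseteq> {w. \<forall>n. (n \<in> J \<longrightarrow> w n \<in> (\<Union>n\<in>J. {0..<int (p n)})) \<and> (n \<notin> J \<longrightarrow> w n = 0)}"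
    by (force simp: F_def)
  then show ?thesis by (rule finite_subset) (intro finite_set_of_finite_funs finite_J finite_UN_I, auto)
qed

lemma zero_in_F: "(\<lambda>n. 0) \<in> F"
  by (simp add: F_def)

lemma card_F: "0 < card F"
  using finite_F zero_in_F card_gt_0_iff by blast

lemma F_mod: "w \<in> F \<Longrightarrow> w n mod int (p n) = w n"
  by (cases "n \<in> J") (auto simp: F_def)

lemma add_closed [simp]: "w \<in> F \<Longrightarrow> v \<in> F \<Longrightarrow> w \<boxplus> v \<in> F"
  by (auto simp: F_def add_def)

lemma bij_add: "v \<in> F \<Longrightarrow> bij_betw (\<lambda>w. w \<boxplus> v) F F"
proof (rule bij_betwI[of _ _ _ "\<lambda>w n. (w n - v n) mod int (p n)"])
  assume v: "v \<in> F"
  show "(\<lambda>w n. (w n - v n) mod int (p n)) \<in> F \<rightarrow> F" using v by (auto simp: F_def)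
  fix w assume w: "w \<in> F"
  show "(\<lambda>n. ((w \<boxplus> v) n - v n) mod int (p n)) = w"
    using F_mod[OF w] by (auto simp: add_def mod_simps)
  show "(\<lambda>n. (w n - v n) mod int (p n)) \<boxplus> v = w"
    using F_mod[OF w] by (auto simp: add_def mod_simps)
qed auto

lemma \<theta>_add: "\<theta> (\<lambda>n. w n + v n) = \<theta> w + \<theta> v"
  by (simp add: \<theta>_def sum.distrib add_divide_distrib)

lemma \<theta>_cong:
  assumes "\<And>n. n \<in> J \<Longrightarrow> w n mod int (p n) = v n mod int (p n)"
  shows "\<theta> w - \<theta> v \<in> \<int>"
proof -
  have "\<theta> w - \<theta> v = (\<Sum>n\<in>J. of_int (w n - v n) / real (p n))"
    by (simp add: \<theta>_def sum_subtractf diff_divide_distrib)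
  also have "\<dots> \<in> \<int>"
  proof (rule Ints_sum)
    fix n assume "n \<in> J"
    then have "int (p n) dvd w n - v n" using assms mod_eq_dvd_iff by blast
    then obtain k where "w n - v n = int (p n) * k" by (rule dvdE)
    then have "of_int (w n - v n) / real (p n) = of_int k" by simp
    then show "of_int (w n - v n) / real (p n) \<in> \<int>" by simp
  qed
  finally show ?thesis .
qed

text \<open>Here the primes need to be distinct.\<close>

lemma \<theta>_Ints:
  assumes "\<theta> w \<in> \<int>" "n \<in> J"
  shows "int (p n) dvd w n"
proof -
  obtain k where k: "\<theta> w = of_int k" using assms(1) by (auto elim: Ints_cases)
  \<comment> \<open>\<open>P\<close> clears every denominator except \<open>p n\<close>; being
    coprime to \<open>p n\<close>, it is cancelled at the end.\<close>
  define P where "P = (\<Prod>m\<in>J - {n}. p m)"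
  define R where "R = (\<Sum>m\<in>J - {n}. of_int (w m) / real (p m))"
  have "of_int (w n) / real (p n) + R = of_int k"
    using k assms(2) finite_J by (simp add: \<theta>_def sum.remove R_def)
  then have w: "of_int (w n) = real (p n) * (of_int k - R)"
    by (simp add: field_simps)
  have "real P * of_int (w n) = real (p n) * (real P * of_int k - real P * R)"
    unfolding w by (simp add: algebra_simps)
  also have "real P * R = of_int (\<Sum>m\<in>J - {n}. int (\<Prod>l\<in>J - {n} - {m}. p l) * w m)"
    unfolding R_def sum_distrib_left of_int_sum
  proof (rule sum.cong[OF refl])
    fix m assume "m \<in> J - {n}"
    then have "P = p m * (\<Prod>l\<in>J - {n} - {m}. p l)"
      unfolding P_def using finite_J by (intro prod.remove) auto
    then show "real P * (of_int (w m) / real (p m)) = of_int (int (\<Prod>l\<in>J - {n} - {m}. p l) * w m)"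
      by (simp del: of_nat_prod)
  qed
  finally have "of_int (int P * w n) = (of_int (int (p n) *
      (int P * k - (\<Sum>m\<in>J - {n}. int (\<Prod>l\<in>J - {n} - {m}. p l) * w m))) :: real)"
    by (simp del: of_nat_prod)
  then have "int P * w n = int (p n) * (int P * k - (\<Sum>m\<in>J - {n}. int (\<Prod>l\<in>J - {n} - {m}. p l) * w m))"
    by (simp only: of_int_eq_iff)
  then have "int (p n) dvd int P * w n" by simp
  moreover have "coprime (p n) P"
    unfolding P_def
  proof (rule prod_coprime_right)
    fix m assume "m \<in> J - {n}"
    then have "p n \<noteq> p m" using inj_J assms(2) by (auto simp: inj_on_def)
    then show "coprime (p n) (p m)" using prime_p primes_coprime by blast
  qed
  ultimately show ?thesis using coprime_dvd_mult_right_iff[of "int (p n)" "int P" "w n"] by simp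
qed

lemma cis_2pi_Ints: "x \<in> \<int> \<Longrightarrow> cis (2 * pi * x) = 1"
  by (rule cis_multiple_2pi)

lemma cis_2pi_eq_1: "cis (2 * pi * x) = 1 \<Longrightarrow> x \<in> \<int>"
proof -
  assume "cis (2 * pi * x) = 1"
  then have "cos (2 * pi * x) = 1" by (metis cis.simps(1) one_complex.simps(1))
  then obtain k :: int where "2 * pi * x = of_int k * 2 * pi" by (auto simp: cos_one_2pi_int)
  then have "x = of_int k" by simp
  then show ?thesis by simp
qed

lemma cis_2pi_cong: "x - y \<in> \<int> \<Longrightarrow> cis (2 * pi * x) = cis (2 * pi * y)"
  using cis_2pi_Ints[of "x - y"] by (metis add_diff_cancel_left' cis_mult diff_add_cancel distrib_left mult.left_neutral)

lemma ch_cong: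
  assumes "\<And>n. n \<in> J \<Longrightarrow> (y n * v n) mod int (p n) = (y' n * v' n) mod int (p n)"
  shows "ch y v = ch y' v'"
  unfolding ch_def using assms by (intro cis_2pi_cong \<theta>_cong)

lemma ch_plus_right: "ch y (\<lambda>n. v n + w n) = ch y v * ch y w"
  by (simp add: ch_def cis_mult \<theta>_add[symmetric] distrib_left flip: distrib_left[of "2 * pi"])

lemma ch_commute: "ch y v = ch v y"
  by (simp add: ch_def mult.commute)

lemma ch_add_right: "ch y (v \<boxplus> w) = ch y v * ch y w"
proof -
  have "ch y (v \<boxplus> w) = ch y (\<lambda>n. v n + w n)"
    by (rule ch_cong) (simp add: add_def mod_mult_right_eq)
  then show ?thesis by (simp add: ch_plus_right)
qed

lemma ch_add_left: "ch (y \<boxplus> z) v = ch y v * ch z v"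
  using ch_add_right[of v y z] by (simp add: ch_commute)

lemma cmod_ch [simp]: "cmod (ch y v) = 1"
  by (simp add: ch_def)

lemma ch_cnj: "ch y v * cnj (ch y w) = ch y (\<lambda>n. v n - w n)"
proof -
  have "cnj (ch y w) = ch y (\<lambda>n. - w n)"
    by (simp add: ch_def cis_cnj \<theta>_def sum_negf)
  then show ?thesis using ch_plus_right[of y v "\<lambda>n. - w n"] by simp
qed

lemma sum_ch:
  assumes v: "v \<in> F" and w: "w \<in> F"
  shows "(\<Sum>y\<in>F. ch y v * cnj (ch y w)) = (if v = w then of_nat (card F) else 0)"
proof (cases "v = w")
  case True
  have "ch y w * cnj (ch y w) = 1" for y by (simp add: complex_norm_square[symmetric])
  then show ?thesis using True by simp
next
  case False
  let ?d = "\<lambda>n. v n - w n"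
  let ?s = "\<Sum>y\<in>F. ch y ?d"
  obtain n where n: "v n \<noteq> w n" using False by auto
  have nJ: "n \<in> J" by (rule ccontr) (use n v w in \<open>auto simp: F_def\<close>)
  \<comment> \<open>Translating the summation variable by this unit vector multiplies the sum by a
    factor that differs from 1, so the sum vanishes.\<close>
  define y0 where "y0 m = (if m = n then 1 else 0 :: int)" for m
  have y0: "y0 \<in> F" using nJ prime_gt_1_nat[OF prime_p[of n]] by (auto simp: F_def y0_def)
  have "ch y0 ?d \<noteq> 1"
  proof
    assume "ch y0 ?d = 1"
    then have "\<theta> (\<lambda>m. y0 m * ?d m) \<in> \<int>" unfolding ch_def by (rule cis_2pi_eq_1)
    from \<theta>_Ints[OF this nJ] have "int (p n) dvd v n - w n" by (simp add: y0_def)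
    then have "v n mod int (p n) = w n mod int (p n)" by (simp add: mod_eq_dvd_iff)
    then show False using F_mod v w n by simp
  qed
  moreover have "?s = ?s * ch y0 ?d"
  proof -
    have "?s = (\<Sum>y\<in>F. ch (y \<boxplus> y0) ?d)"
      using sum.reindex_bij_betw[OF bij_add[OF y0], of "\<lambda>y. ch y ?d"] by simp
    also have "\<dots> = ?s * ch y0 ?d" by (simp add: ch_add_left sum_distrib_right)
    finally show ?thesis .
  qed
  ultimately have "?s = 0" by simp
  then show ?thesis using False by (simp add: ch_cnj)
qed

text \<open>Only the last two variables are transformed; the normalization makes this an isometry.\<close>

definition ft :: "((nat \<Rightarrow> int) \<times> (nat \<Rightarrow> int) \<times> (nat \<Rightarrow> int) \<Rightarrow> complex) \<Rightarrow>
    (nat \<Rightarrow> int) \<times> (nat \<Rightarrow> int) \<times> (nat \<Rightarrow> int) \<Rightarrow> complex" where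
  "ft \<eta> = (\<lambda>(u, y, z). (\<Sum>v\<in>F. \<Sum>w\<in>F. \<eta> (u, v, w) * (ch y v * ch z w)) / of_nat (card F))"

abbreviation "F3 \<equiv> F \<times> F \<times> F"

lemma finite_F3: "finite F3"
  by (intro finite_cartesian_product finite_F)

lemma mass_F3: "P \<subseteq> F3 \<Longrightarrow> mass f P = (\<Sum>x\<in>P. (cmod (f x))\<^sup>2)"
  using finite_subset[OF _ finite_F3] by simp

lemma ft_parseval_slice:
  "(\<Sum>(y, z)\<in>F \<times> F. (cmod (ft \<eta> (u, y, z)))\<^sup>2) = (\<Sum>(v, w)\<in>F \<times> F. (cmod (\<eta> (u, v, w)))\<^sup>2)"
proof -
  let ?ch = "\<lambda>(y, z) (v, w). ch y v * ch z w" and ?f = "\<lambda>(v, w). \<eta> (u, v, w)"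
  let ?c = "(real (card F))\<^sup>2"
  have "(\<Sum>d\<in>F \<times> F. (cmod (\<Sum>v\<in>F \<times> F. ?f v * ?ch d v))\<^sup>2) = ?c * (\<Sum>v\<in>F \<times> F. (cmod (?f v))\<^sup>2)"
  proof (rule plancherel)
    fix a b assume a: "a \<in> F \<times> F" and b: "b \<in> F \<times> F"
    obtain v w v' w' where ab: "a = (v, w)" "b = (v', w')" by (cases a; cases b)
    have "(\<Sum>d\<in>F \<times> F. ?ch d a * cnj (?ch d b)) =
        (\<Sum>y\<in>F. ch y v * cnj (ch y v')) * (\<Sum>z\<in>F. ch z w * cnj (ch z w'))"
      unfolding sum_product sum.cartesian_product by (rule sum.cong) (auto simp: ab)
    then show "(\<Sum>d\<in>F \<times> F. ?ch d a * cnj (?ch d b)) = (if a = b then of_real ?c else 0)"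
      using a b by (auto simp: ab sum_ch power2_eq_square)
  qed (simp_all add: finite_F)
  moreover have "ft \<eta> (u, y, z) = (\<Sum>v\<in>F \<times> F. ?f v * ?ch (y, z) v) / of_nat (card F)" for y z
    by (simp add: ft_def sum.cartesian_product split_beta)
  ultimately show ?thesis
    using card_F by (simp add: norm_divide power_divide split_beta flip: sum_divide_distrib)
qed

lemma ft_parseval: "mass (ft \<eta>) (U \<times> F \<times> F) = mass \<eta> (U \<times> F \<times> F)" if "U \<subseteq> F"
proof -
  have U: "U \<times> F \<times> F \<subseteq> F3" using that by auto
  have "(\<Sum>x\<in>U \<times> F \<times> F. (cmod (f x))\<^sup>2) = (\<Sum>u\<in>U. \<Sum>(y, z)\<in>F \<times> F. (cmod (f (u, y, z)))\<^sup>2)"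
    for f :: "_ \<Rightarrow> complex"
    by (simp add: sum.cartesian_product split_beta)
  then show ?thesis unfolding mass_F3[OF U] by (simp only: ft_parseval_slice)
qed

lemma ft_diff: "ft (\<lambda>x. \<eta> x - \<zeta> x) x = ft \<eta> x - ft \<zeta> x"
  by (cases x) (simp add: ft_def left_diff_distrib sum_subtractf diff_divide_distrib)

section \<open>The shears induced by elementary matrices, and their Fourier duals\<close>

definition "g21 = (\<lambda>(u, v, w). (u, v \<boxplus> u, w))"
definition "g31 = (\<lambda>(u, v, w). (u, v, w \<boxplus> u))"
definition "g23 = (\<lambda>(u, v, w). (u, v \<boxplus> w, w))"
definition "g32 = (\<lambda>(u, v, w). (u, v, w \<boxplus> v))"

lemma bij_g: "bij_betw g21 F3 F3" "bij_betw g31 F3 F3" "bij_betw g23 F3 F3" "bij_betw g32 F3 F3"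
proof -
  have *: "bij_betw g F3 F3" if "inj_on g F3" "g ` F3 \<subseteq> F3" for g
    using that finite_F3 by (simp add: bij_betw_def endo_inj_surj)
  have inj: "w = w'" if "w \<boxplus> v = w' \<boxplus> v" "v \<in> F" "w \<in> F" "w' \<in> F" for v w w'
    using that bij_add[of v] by (auto simp: bij_betw_def inj_on_def)
  show "bij_betw g21 F3 F3" "bij_betw g31 F3 F3" "bij_betw g23 F3 F3" "bij_betw g32 F3 F3"
    by (intro *; auto simp: inj_on_def g21_def g31_def g23_def g32_def dest: inj)+
qed

lemma sum_shift: "u \<in> F \<Longrightarrow> (\<Sum>v\<in>F. f (v \<boxplus> u)) = (\<Sum>v\<in>F. f v)"
  by (rule sum.reindex_bij_betw[OF bij_add])

text \<open>Shearing the second variable by the first is dual to shearing the first dual variable by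
  the second. Placing the shift in the argument on the left avoids the inverse.\<close>

lemma ft_g32: "y \<in> F \<Longrightarrow> z \<in> F \<Longrightarrow> ft (\<lambda>x. \<eta> (g32 x)) (u, y \<boxplus> z, z) = ft \<eta> (u, y, z)"
proof -
  have "(\<Sum>w\<in>F. \<eta> (u, v, w \<boxplus> v) * (ch (y \<boxplus> z) v * ch z w)) = (\<Sum>w\<in>F. \<eta> (u, v, w) * (ch y v * ch z w))"
    if "v \<in> F" for v
    using sum_shift[OF that, of "\<lambda>w. \<eta> (u, v, w) * (ch y v * ch z w)"]
    by (simp add: ch_add_left ch_add_right ac_simps)
  then show ?thesis by (simp add: ft_def g32_def)
qed

lemma ft_swap: "ft \<eta> (u, y, z) = (\<Sum>w\<in>F. \<Sum>v\<in>F. \<eta> (u, v, w) * (ch y v * ch z w)) / of_nat (card F)"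
  unfolding ft_def prod.case by (subst sum.swap) (rule refl)

lemma ft_g23: "y \<in> F \<Longrightarrow> z \<in> F \<Longrightarrow> ft (\<lambda>x. \<eta> (g23 x)) (u, y, z \<boxplus> y) = ft \<eta> (u, y, z)"
proof -
  have "(\<Sum>v\<in>F. \<eta> (u, v \<boxplus> w, w) * (ch y v * ch (z \<boxplus> y) w)) = (\<Sum>v\<in>F. \<eta> (u, v, w) * (ch y v * ch z w))"
    if "w \<in> F" for w
    using sum_shift[OF that, of "\<lambda>v. \<eta> (u, v, w) * (ch y v * ch z w)"]
    by (simp add: ch_add_left ch_add_right ac_simps)
  then show ?thesis by (simp add: ft_swap g23_def)
qed

text \<open>The shift by \<open>u\<close> fixes all three coordinates after the transform and
  becomes the phase \<open>ch y u\<close>. Almost invariance under \<open>g21\<close> therefore says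
  that this phase is close to 1 on most of the mass.\<close>

lemma ft_g21: "u \<in> F \<Longrightarrow> ft (\<lambda>x. \<eta> (g21 x)) (u, y, z) * ch y u = ft \<eta> (u, y, z)"
proof -
  assume u: "u \<in> F"
  have "(\<Sum>v\<in>F. \<eta> (u, v \<boxplus> u, w) * (ch y v * ch z w)) * ch y u = (\<Sum>v\<in>F. \<eta> (u, v, w) * (ch y v * ch z w))" for w
    using sum_shift[OF u, of "\<lambda>v. \<eta> (u, v, w) * (ch y v * ch z w)"]
    by (simp add: ch_add_right ac_simps sum_distrib_left)
  then show ?thesis by (simp add: ft_swap g21_def sum_distrib_right)
qed

lemma ft_g31: "u \<in> F \<Longrightarrow> ft (\<lambda>x. \<eta> (g31 x)) (u, y, z) * ch z u = ft \<eta> (u, y, z)"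
proof -
  assume u: "u \<in> F"
  have "(\<Sum>w\<in>F. \<eta> (u, v, w \<boxplus> u) * (ch y v * ch z w)) * ch z u = (\<Sum>w\<in>F. \<eta> (u, v, w) * (ch y v * ch z w))" for v
    using sum_shift[OF u, of "\<lambda>w. \<eta> (u, v, w) * (ch y v * ch z w)"]
    by (simp add: ch_add_right ac_simps sum_distrib_left)
  then show ?thesis by (simp add: ft_def g31_def sum_distrib_right)
qed

text \<open>The representative nearest to zero of a point of the circle. The plane estimate compares
  absolute values and signs and so needs real coordinates.\<close>

definition signed :: "(nat \<Rightarrow> int) \<Rightarrow> real" where
  "signed w = \<theta> w - of_int (round (\<theta> w))"

lemma signed_bound: "\<bar>signed w\<bar> \<le> 1/2"
  using of_int_round_abs_le[of "\<theta> w"] by (simp add: signed_def abs_minus_commute)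

lemma signed_\<theta>: "\<theta> w - signed w \<in> \<int>"
  by (simp add: signed_def)

lemma signed_unique: "\<theta> w - x \<in> \<int> \<Longrightarrow> \<bar>x\<bar> < 1/2 \<Longrightarrow> signed w = x"
proof -
  assume x: "\<theta> w - x \<in> \<int>" "\<bar>x\<bar> < 1/2"
  then obtain k where k: "\<theta> w - x = of_int k" by (auto elim: Ints_cases)
  then have "\<theta> w - of_int k = x" by simp
  then have "round (\<theta> w) = k" using x by (intro round_unique') simp
  then show ?thesis using k by (simp add: signed_def)
qed

text \<open>Two representatives below 1/4 have a sum below 1/2, hence do not wrap around the circle.
  This is the origin of the threshold 1/4.\<close>

lemma signed_add:
  assumes "\<bar>signed (\<lambda>n. u n * y n)\<bar> < 1/4" "\<bar>signed (\<lambda>n. u n * z n)\<bar> < 1/4"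
  shows "signed (\<lambda>n. u n * (y \<boxplus> z) n) = signed (\<lambda>n. u n * y n) + signed (\<lambda>n. u n * z n)"
proof (rule signed_unique)
  have "\<theta> (\<lambda>n. u n * (y \<boxplus> z) n) - (\<theta> (\<lambda>n. u n * y n) + \<theta> (\<lambda>n. u n * z n)) \<in> \<int>"
    unfolding \<theta>_add[symmetric] distrib_left[symmetric]
    by (rule \<theta>_cong) (simp add: add_def mod_mult_right_eq)
  from Ints_add[OF Ints_add[OF this signed_\<theta>[of "\<lambda>n. u n * y n"]] signed_\<theta>[of "\<lambda>n. u n * z n"]]
  show "\<theta> (\<lambda>n. u n * (y \<boxplus> z) n) - (signed (\<lambda>n. u n * y n) + signed (\<lambda>n. u n * z n)) \<in> \<int>"
    by (simp add: algebra_simps)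
qed (use assms in linarith)

text \<open>A representative of size at least 1/4 puts the phase into the closed left half plane,
  and \<open>(cmod (1 - cis x))\<^sup>2 = 2 - 2 * cos x\<close>.\<close>

lemma signed_large: "1/4 \<le> \<bar>signed (\<lambda>n. u n * y n)\<bar> \<Longrightarrow> 2 \<le> (cmod (1 - ch y u))\<^sup>2"
proof -
  let ?r = "signed (\<lambda>n. u n * y n)"
  assume r: "1/4 \<le> \<bar>?r\<bar>"
  have "ch y u = cis (2 * pi * ?r)"
    unfolding ch_commute[of y u] unfolding ch_def by (rule cis_2pi_cong[OF signed_\<theta>])
  moreover have "cos (2 * pi * ?r) \<le> 0"
  proof -
    have "cos (2 * pi * ?r) = cos \<bar>2 * pi * ?r\<bar>" by simp
    also have "\<dots> \<le> cos (pi / 2)"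
      using r signed_bound[of "\<lambda>n. u n * y n"] pi_gt_zero
      by (intro cos_monotone_0_pi_le) (auto simp: abs_mult field_simps)
    finally show ?thesis by simp
  qed
  moreover have "(cmod (1 - cis x))\<^sup>2 = 2 - 2 * cos x" for x
  proof -
    have "(cmod (1 - cis x))\<^sup>2 = (1 - cos x)\<^sup>2 + (sin x)\<^sup>2" by (simp add: cmod_power2)
    then show ?thesis using sin_cos_squared_add[of x] by (simp add: power2_diff)
  qed
  ultimately show ?thesis by simp
qed

text \<open>An integral sum of fractions with distinct prime denominators is integral in each term,
  by \<open>\<theta>_Ints\<close>; primality then decides which of the two factors is
  divisible.\<close>

lemma signed_zero: "signed (\<lambda>n. u n * y n) = 0 \<Longrightarrow> n \<in> J \<Longrightarrow> u \<in> F \<Longrightarrow> y \<in> F \<Longrightarrow> u n \<noteq> 0 \<Longrightarrow> y n = 0"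
proof -
  assume *: "signed (\<lambda>n. u n * y n) = 0" "n \<in> J" "u \<in> F" "y \<in> F" "u n \<noteq> 0"
  then have "\<theta> (\<lambda>n. u n * y n) \<in> \<int>" using signed_\<theta>[of "\<lambda>n. u n * y n"] by simp
  then have "int (p n) dvd u n * y n" using \<theta>_Ints *(2) by blast
  then have "int (p n) dvd u n \<or> int (p n) dvd y n" using prime_p[of n] by (simp add: prime_dvd_mult_iff)
  then show "y n = 0" using * zdvd_not_zless[of "u n" "int (p n)"] zdvd_not_zless[of "y n" "int (p n)"]
    by (auto simp: F_def order_less_le)
qed

lemma card_vanishing:
  assumes "n \<in> J"
  shows "real (card {y \<in> F. y n = 0}) = real (card F) / real (p n)"
proof -
  have "bij_betw (\<lambda>(y, a). y(n := a)) ({y \<in> F. y n = 0} \<times> {0..<int (p n)}) F"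
    by (rule bij_betwI[of _ _ _ "\<lambda>y. (y(n := 0), y n)"]) (use assms in \<open>auto simp: F_def\<close>)
  from bij_betw_same_card[OF this] have "card {y \<in> F. y n = 0} * p n = card F"
    by (simp add: card_cartesian_product)
  then have "real (card {y \<in> F. y n = 0}) * real (p n) = real (card F)"
    by (simp flip: of_nat_mult)
  then show ?thesis by (simp add: eq_divide_eq)
qed

text \<open>\<open>slice\<close> is the contraction property after the Fourier transform: no dual
  pair (y, z) carries more than its even share. Outside \<open>B1 \<union> B2\<close> the plane
  estimate applies to \<open>(r, s)\<close>; what it leaves over with nonzero u sits on few dual
  pairs, where \<open>slice\<close> bounds it.\<close>

lemma mass_first_coordinate_le:
  assumes \<eta>: "mass \<eta> F3 \<le> 1"
    and slice: "\<And>y z. y \<in> F \<Longrightarrow> z \<in> F \<Longrightarrow> real ((card F)\<^sup>2) * (\<Sum>u\<in>F. (cmod (ft \<eta> (u, y, z)))\<^sup>2) \<le> 1"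
    and D: "mass (\<lambda>x. \<eta> (g21 x) - \<eta> x) F3 \<le> d21\<^sup>2" "mass (\<lambda>x. \<eta> (g31 x) - \<eta> x) F3 \<le> d31\<^sup>2"
      "mass (\<lambda>x. \<eta> (g23 x) - \<eta> x) F3 \<le> d23\<^sup>2" "mass (\<lambda>x. \<eta> (g32 x) - \<eta> x) F3 \<le> d32\<^sup>2"
    and d: "0 \<le> d23" "0 \<le> d32"
  shows "mass \<eta> ((F - {\<lambda>n. 0}) \<times> F \<times> F) \<le>
    12 * (2 * d23 + 2 * d32 + (d21\<^sup>2 + d31\<^sup>2) / 2) + (\<Sum>n\<in>J. 1 / (real (p n))\<^sup>2)"
proof -
  define r where "r = (\<lambda>(u, y, z :: nat \<Rightarrow> int). signed (\<lambda>n. u n * y n))"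
  define s where "s = (\<lambda>(u, y :: nat \<Rightarrow> int, z). signed (\<lambda>n. u n * z n))"
  define a where "a = (\<lambda>(u :: nat \<Rightarrow> int, y, z). (u, y \<boxplus> z, z))"
  define b where "b = (\<lambda>(u :: nat \<Rightarrow> int, y, z). (u, y, z \<boxplus> y))"
  define B1 where "B1 = {x \<in> F3. 1/4 \<le> \<bar>r x\<bar>}"
  define B2 where "B2 = {x \<in> F3. 1/4 \<le> \<bar>s x\<bar>}"
  have summable: "(\<lambda>x. (cmod (f x))\<^sup>2) summable_on P" if "P \<subseteq> F3" for f :: "_ \<Rightarrow> complex" and P
    using finite_subset[OF that finite_F3] by simp
  have parseval: "mass (ft f) F3 = mass f F3" for f using ft_parseval[of F f] by simp
  have mass_g: "mass (\<lambda>x. \<eta> (g x)) F3 = mass \<eta> F3" if "bij_betw g F3 F3" for g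
    using infsum_reindex_bij_betw[OF that, of "\<lambda>x. (cmod (\<eta> x))\<^sup>2"] by simp
  \<comment> \<open>The transform is an isometry, so almost invariance in the original variables
    passes to the transform with the same distance.\<close>
  have near: "\<bar>mass (ft \<eta>) P - mass (ft (\<lambda>x. \<eta> (g x))) P\<bar> \<le> 2 * d"
    if g: "bij_betw g F3 F3" "mass (\<lambda>x. \<eta> (g x) - \<eta> x) F3 \<le> d\<^sup>2" "0 \<le> d" and P: "P \<subseteq> F3" for g P d
  proof -
    have "mass (\<lambda>x. ft \<eta> x - ft (\<lambda>x. \<eta> (g x)) x) F3 = mass (\<lambda>x. \<eta> x - \<eta> (g x)) F3"
      by (simp only: ft_diff[symmetric] parseval)
    also have "\<dots> \<le> d\<^sup>2" using g by (simp add: norm_minus_commute)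
    finally have "sqrt (mass (\<lambda>x. ft \<eta> x - ft (\<lambda>x. \<eta> (g x)) x) F3) \<le> d"
      using g(3) by (intro real_le_lsqrt) auto
    moreover have "\<bar>mass (ft \<eta>) P - mass (ft (\<lambda>x. \<eta> (g x))) P\<bar> \<le>
        2 * sqrt (mass (\<lambda>x. ft \<eta> x - ft (\<lambda>x. \<eta> (g x)) x) F3)"
      using \<eta> P by (intro mass_difference summable) (auto simp only: parseval mass_g[OF g(1)])
    ultimately show ?thesis by linarith
  qed
  \<comment> \<open>A phase \<open>c x\<close> with \<open>2 \<le> (cmod (1 - c x))\<^sup>2\<close>
    makes the two transforms differ in square by at least twice the mass at \<open>x\<close>, which
    gives the factor 1/2.\<close>
  have large: "mass (ft \<eta>) P \<le> d\<^sup>2 / 2"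
    if P: "P \<subseteq> F3" and D: "mass (\<lambda>x. \<eta> (g x) - \<eta> x) F3 \<le> d\<^sup>2"
      and c: "\<And>x. x \<in> P \<Longrightarrow> ft (\<lambda>x. \<eta> (g x)) x * c x = ft \<eta> x" "\<And>x. x \<in> P \<Longrightarrow> 2 \<le> (cmod (1 - c x))\<^sup>2"
        "\<And>x. cmod (c x) = 1" for P g d c
  proof -
    have "2 * mass (ft \<eta>) P = (\<Sum>x\<in>P. 2 * (cmod (ft \<eta> x))\<^sup>2)"
      by (simp add: mass_F3[OF P] sum_distrib_left)
    also have "\<dots> \<le> (\<Sum>x\<in>P. (cmod (ft (\<lambda>x. \<eta> (g x)) x - ft \<eta> x))\<^sup>2)"
    proof (rule sum_mono)
      fix x assume x: "x \<in> P"
      have "ft (\<lambda>x. \<eta> (g x)) x - ft \<eta> x = ft (\<lambda>x. \<eta> (g x)) x * (1 - c x)"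
        using c(1)[OF x] by (simp add: right_diff_distrib)
      moreover have "cmod (ft \<eta> x) = cmod (ft (\<lambda>x. \<eta> (g x)) x)"
        using c(1)[OF x, symmetric] c(3) by (simp add: norm_mult)
      ultimately show "2 * (cmod (ft \<eta> x))\<^sup>2 \<le> (cmod (ft (\<lambda>x. \<eta> (g x)) x - ft \<eta> x))\<^sup>2"
        using c(2)[OF x] by (simp add: norm_mult power_mult_distrib mult_right_mono mult.commute)
    qed
    also have "\<dots> = mass (\<lambda>x. ft (\<lambda>x. \<eta> (g x)) x - ft \<eta> x) P" by (simp add: mass_F3[OF P])
    also have "\<dots> \<le> mass (\<lambda>x. ft (\<lambda>x. \<eta> (g x)) x - ft \<eta> x) F3"
      by (rule mass_mono[OF summable P]) simp
    also have "\<dots> = mass (\<lambda>x. \<eta> (g x) - \<eta> x) F3" by (simp only: ft_diff[symmetric] parseval)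
    finally show ?thesis using D by simp
  qed
  have B1: "mass (ft \<eta>) B1 \<le> d21\<^sup>2 / 2"
    by (rule large[of B1 g21 _ "\<lambda>(u, y, z). ch y u"])
      (use D signed_large ft_g21 in \<open>auto simp: B1_def r_def\<close>)
  have B2: "mass (ft \<eta>) B2 \<le> d31\<^sup>2 / 2"
    by (rule large[of B2 g31 _ "\<lambda>(u, y, z). ch z u"])
      (use D signed_large ft_g31 in \<open>auto simp: B2_def s_def\<close>)
  have BX: "B1 \<union> B2 \<subseteq> F3" by (auto simp: B1_def B2_def)
  interpret almost_invariant_measure F3 "mass (ft \<eta>)" a b "2 * d23 + 2 * d32" "(d21\<^sup>2 + d31\<^sup>2) / 2" "B1 \<union> B2" r s
  proof unfold_locales
    show "mass (ft \<eta>) P \<le> mass (ft \<eta>) Q" if "P \<subseteq> Q" "Q \<subseteq> F3" for P Q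
      using that by (intro mass_mono summable)
    show "mass (ft \<eta>) (P \<union> Q) = mass (ft \<eta>) P + mass (ft \<eta>) Q"
      if "P \<subseteq> F3" "Q \<subseteq> F3" "P \<inter> Q = {}" for P Q
      using that by (intro mass_union[of _ F3] summable) auto
    show "B1 \<union> B2 \<subseteq> F3" by (rule BX)
    have "mass (ft \<eta>) (B1 \<union> B2) = mass (ft \<eta>) (B1 \<union> (B2 - B1))" by simp
    also have "\<dots> = mass (ft \<eta>) B1 + mass (ft \<eta>) (B2 - B1)"
      using BX by (intro mass_union[of _ F3] summable) auto
    also have "mass (ft \<eta>) (B2 - B1) \<le> mass (ft \<eta>) B2"
      using BX by (intro mass_mono summable) auto
    finally show "mass (ft \<eta>) (B1 \<union> B2) \<le> (d21\<^sup>2 + d31\<^sup>2) / 2" using B1 B2 by simp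
    have inj: "w = w'" if "w \<boxplus> v = w' \<boxplus> v" "v \<in> F" "w \<in> F" "w' \<in> F" for v w w'
      using that bij_add[of v] by (auto simp: bij_betw_def inj_on_def)
    have "inj_on a F3" "a ` F3 \<subseteq> F3" "inj_on b F3" "b ` F3 \<subseteq> F3"
      by (auto simp: inj_on_def a_def b_def dest: inj)
    then show ab: "bij_betw a F3 F3" "bij_betw b F3 F3"
      using finite_F3 by (simp_all add: bij_betw_def endo_inj_surj)
    show "\<bar>mass (ft \<eta>) (a ` P) - mass (ft \<eta>) P\<bar> \<le> 2 * d23 + 2 * d32" if P: "P \<subseteq> F3" for P
    proof -
      have inj: "inj_on a P" using ab(1) P by (auto simp: bij_betw_def intro: inj_on_subset)
      have aP: "a ` P \<subseteq> F3" using ab(1) P by (auto simp: bij_betw_def)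
      have "mass (ft (\<lambda>x. \<eta> (g32 x))) (a ` P) = mass (ft \<eta>) P"
        unfolding mass_reindex[OF inj] using P
        by (intro infsum_cong) (auto simp: a_def ft_g32)
      then show ?thesis using near[OF bij_g(4) D(4) d(2) aP] d by simp
    qed
    show "\<bar>mass (ft \<eta>) (b ` P) - mass (ft \<eta>) P\<bar> \<le> 2 * d23 + 2 * d32" if P: "P \<subseteq> F3" for P
    proof -
      have inj: "inj_on b P" using ab(2) P by (auto simp: bij_betw_def intro: inj_on_subset)
      have bP: "b ` P \<subseteq> F3" using ab(2) P by (auto simp: bij_betw_def)
      have "mass (ft (\<lambda>x. \<eta> (g23 x))) (b ` P) = mass (ft \<eta>) P"
        unfolding mass_reindex[OF inj] using P
        by (intro infsum_cong) (auto simp: b_def ft_g23)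
      then show ?thesis using near[OF bij_g(3) D(3) d(1) bP] d by simp
    qed
    show "r (a x) = r x + s x" "s (b x) = s x + r x" if "x \<in> F3" "x \<notin> B1 \<union> B2" for x
      using that by (auto simp: B1_def B2_def r_def s_def a_def b_def signed_add)
    show "s (a x) = s x" "r (b x) = r x" for x
      by (auto simp: r_def s_def a_def b_def split: prod.splits)
  qed
  \<comment> \<open>For each n the pairs vanishing at n make up the fraction
    \<open>1 / (real (p n))\<^sup>2\<close> of all pairs; the bound per pair from
    \<open>slice\<close> cancels the number of pairs.\<close>
  define Z where "Z = {x \<in> F3. \<exists>n\<in>J. fst (snd x) n = 0 \<and> snd (snd x) n = 0}"
  have "mass (ft \<eta>) Z \<le> (\<Sum>n\<in>J. 1 / (real (p n))\<^sup>2)"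
  proof -
    let ?Y = "\<Union>n\<in>J. {y \<in> F. y n = 0} \<times> {z \<in> F. z n = 0}"
    have Y: "finite ?Y" "?Y \<subseteq> F \<times> F" using finite_J finite_F by auto
    have Z: "Z = F \<times> ?Y" by (auto simp: Z_def)
    have ZF: "F \<times> ?Y \<subseteq> F3" using Y(2) by blast
    have "mass (ft \<eta>) Z = (\<Sum>x\<in>F \<times> ?Y. (cmod (ft \<eta> x))\<^sup>2)"
      unfolding Z by (rule mass_F3[OF ZF])
    also have "\<dots> = (\<Sum>u\<in>F. \<Sum>d\<in>?Y. (cmod (ft \<eta> (u, d)))\<^sup>2)"
      by (simp add: sum.cartesian_product split_beta)
    also have "\<dots> = (\<Sum>d\<in>?Y. \<Sum>u\<in>F. (cmod (ft \<eta> (u, d)))\<^sup>2)" by (rule sum.swap)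
    also have "\<dots> \<le> (\<Sum>d\<in>?Y. 1 / (real (card F))\<^sup>2)"
      using slice card_F Y by (intro sum_mono) (auto simp: field_simps)
    also have "\<dots> = real (card ?Y) / (real (card F))\<^sup>2" by simp
    also have "real (card ?Y) \<le> (\<Sum>n\<in>J. real (card ({y \<in> F. y n = 0} \<times> {z \<in> F. z n = 0})))"
      using card_UN_le[OF finite_J, of "\<lambda>n. {y \<in> F. y n = 0} \<times> {z \<in> F. z n = 0}"] by (simp flip: of_nat_sum)
    also have "\<dots> = (\<Sum>n\<in>J. (real (card F))\<^sup>2 / (real (p n))\<^sup>2)"
      by (intro sum.cong) (auto simp: card_cartesian_product card_vanishing power2_eq_square)
    finally show ?thesis using card_F by (simp add: divide_right_mono flip: sum_divide_distrib)
        (simp add: field_simps sum_distrib_left sum_divide_distrib)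
  qed
  moreover have "mass (ft \<eta>) {x \<in> F3. r x \<noteq> 0 \<or> s x \<noteq> 0} \<le> 12 * (2 * d23 + 2 * d32 + (d21\<^sup>2 + d31\<^sup>2) / 2)"
    by (rule measure_nonzero_le)
  \<comment> \<open>Some component of u is nonzero; if \<open>r\<close> and \<open>s\<close> vanish,
    \<open>signed_zero\<close> makes y and z vanish at that same component.\<close>
  moreover have "mass (ft \<eta>) ((F - {\<lambda>n. 0}) \<times> F \<times> F) \<le> mass (ft \<eta>) {x \<in> F3. r x \<noteq> 0 \<or> s x \<noteq> 0} + mass (ft \<eta>) Z"
  proof (rule subadditive)
    show "(F - {\<lambda>n. 0}) \<times> F \<times> F \<subseteq> {x \<in> F3. r x \<noteq> 0 \<or> s x \<noteq> 0} \<union> Z"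
    proof (clarify, rule ccontr)
      fix u y z assume u: "u \<in> F" "u \<noteq> (\<lambda>n. 0)" and yz: "y \<in> F" "z \<in> F"
        and n: "(u, y, z) \<notin> Z" "\<not> ((u, y, z) \<in> F3 \<and> (r (u, y, z) \<noteq> 0 \<or> s (u, y, z) \<noteq> 0))"
      obtain n where un: "u n \<noteq> 0" using u(2) by auto
      then have nJ: "n \<in> J" using u(1) by (auto simp: F_def)
      have "signed (\<lambda>n. u n * y n) = 0" "signed (\<lambda>n. u n * z n) = 0"
        using n u yz by (auto simp: r_def s_def)
      then have "y n = 0" "z n = 0" using signed_zero nJ u yz un by blast+
      then show False using n(1) nJ u yz by (auto simp: Z_def)
    qed
  qed (auto simp: Z_def)
  ultimately show ?thesis using ft_parseval[of "F - {\<lambda>n. 0}" \<eta>] by simp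
qed

end

section \<open>Inner amenability\<close>

text \<open>Stated through closed conditions, so that additivity and invariance pass to the cluster point.\<close>

lemma cluster_point:
  fixes \<mu> :: "nat \<Rightarrow> 'x set \<Rightarrow> real"
  assumes "\<And>n X. 0 \<le> \<mu> n X \<and> \<mu> n X \<le> 1"
  shows "\<exists>m. \<forall>Z. closed Z \<longrightarrow> (\<forall>\<^sub>F n in sequentially. \<mu> n \<in> Z) \<longrightarrow> m \<in> Z"
proof -
  let ?C = "PiE UNIV (\<lambda>_. {0..1}) :: ('x set \<Rightarrow> real) set"
  have "compactin (product_topology (\<lambda>_. euclidean) UNIV) ?C"
    unfolding compactin_PiE by (simp add: compactin_euclidean_iff)
  then have C: "compact ?C" by (simp add: euclidean_product_topology compactin_euclidean_iff)
  let ?F = "{Z. closed Z \<and> (\<forall>\<^sub>F n in sequentially. \<mu> n \<in> Z)}"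
  have "?C \<inter> \<Inter>?F \<noteq> {}"
  proof (rule compact_imp_fip[OF C])
    fix F' assume F': "finite F'" "F' \<subseteq> ?F"
    then have "\<forall>\<^sub>F n in sequentially. \<forall>Z\<in>F'. \<mu> n \<in> Z" by (intro eventually_ball_finite) auto
    then obtain n where "\<forall>Z\<in>F'. \<mu> n \<in> Z" using eventually_happens' trivial_limit_sequentially by blast
    moreover have "\<mu> n \<in> ?C" using assms by (auto simp: PiE_UNIV_domain)
    ultimately show "?C \<inter> \<Inter>F' \<noteq> {}" by blast
  qed auto
  then obtain m where "m \<in> ?C \<inter> \<Inter>?F" unfolding ex_in_conv[symmetric] by (rule exE)
  then show ?thesis by (intro exI[of _ m]) auto
qed

context vaes_group
begin

definition sphere :: "nat \<Rightarrow> 'a set" where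
  "sphere n = (\<lambda>x. e (x, mat 1)) ` {x \<in> carrier K. x \<noteq> zero_K \<and> (\<forall>m. m \<noteq> n \<longrightarrow> x m = (\<lambda>i. 0))}"

lemma sphere: "finite (sphere n)" "sphere n \<noteq> {}" "sphere n \<subseteq> S - {\<one>}"
proof -
  let ?Y = "{x \<in> carrier K. x \<noteq> zero_K \<and> (\<forall>m. m \<noteq> n \<longrightarrow> x m = (\<lambda>i. 0))}"
  have "finite {h :: 3 \<Rightarrow> int. \<forall>i. (i \<in> UNIV \<longrightarrow> h i \<in> {0..<int (p n)}) \<and> (i \<notin> UNIV \<longrightarrow> h i = 0)}"
    by (rule finite_set_of_finite_funs) auto
  moreover have "?Y \<subseteq> (\<lambda>h m. if m = n then h else (\<lambda>i. 0)) `
      {h :: 3 \<Rightarrow> int. \<forall>i. (i \<in> UNIV \<longrightarrow> h i \<in> {0..<int (p n)}) \<and> (i \<notin> UNIV \<longrightarrow> h i = 0)}"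
    by (auto simp: carrier_K image_iff fun_eq_iff)
  ultimately have "finite ?Y" using finite_surj by blast
  then show "finite (sphere n)" by (simp add: sphere_def)
  let ?x = "\<lambda>m i. if m = n \<and> i = 1 then 1 else 0 :: int"
  have "{m. ?x m \<noteq> (\<lambda>i. 0)} \<subseteq> {n}" by auto
  then have "?x \<in> carrier K"
    using prime_gt_1_nat[OF prime_p[of n]] by (auto simp: carrier_K intro: finite_subset)
  then have "?x \<in> ?Y" by (auto simp: fun_eq_iff)
  then show "sphere n \<noteq> {}" unfolding sphere_def by blast
  show "sphere n \<subseteq> S - {\<one>}"
    using e_eq_iff[of _ zero_K "mat 1" "mat 1"] e_one by (auto simp: sphere_def)
qed

lemma conj_sphere:
  assumes "g \<in> S"
  shows "\<exists>N. \<forall>n\<ge>N. conj g ` sphere n = sphere n"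
proof -
  obtain N M where M: "det M = 1" "\<And>x. x \<in> T N \<Longrightarrow> conj g (e (x, mat 1)) = e (K_act p M x, mat 1)"
    using conj_tail[OF assms] by blast
  have "conj g ` sphere n = sphere n" if "n \<ge> N" for n
  \<comment> \<open>The sphere is finite and conjugation is injective, so only the inclusion of the
    image has to be checked.\<close>
  proof (rule endo_inj_surj)
    show "finite (sphere n)" by (rule sphere)
    show inj: "inj_on (conj g) (sphere n)"
      using bij_conj[OF assms] sphere(3) by (auto simp: bij_betw_def intro: inj_on_subset)
    show "conj g ` sphere n \<subseteq> sphere n"
    proof
      fix y assume "y \<in> conj g ` sphere n"
      then obtain x where x: "x \<in> carrier K" "x \<noteq> zero_K" "\<And>m. m \<noteq> n \<Longrightarrow> x m = (\<lambda>i. 0)"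
        "y = conj g (e (x, mat 1))" by (auto simp: sphere_def)
      then have "x \<in> T N" using that by (simp add: K_tail_iff)
      then have y: "y = e (K_act p M x, mat 1)" using M x by simp
      have "K_act p M x \<noteq> zero_K"
      proof
        assume "K_act p M x = zero_K"
        then have "conj g (e (x, mat 1)) = \<one>" unfolding x(4)[symmetric] y using e_one by simp
        moreover have "conj g \<one> = \<one>" using assms by simp
        moreover have "inj_on (conj g) S" using bij_conj[OF assms] by (simp add: bij_betw_def)
        ultimately have "e (x, mat 1) = \<one>"
          using x(1) by (metis inj_onD e_closed det_I one_closed)
        then show False using x e_eq_iff[of x zero_K "mat 1" "mat 1"] e_one by simp
      qed
      moreover have "K_act p M x m = (\<lambda>i. 0)" if "m \<noteq> n" for m using x(3)[OF that] by (rule K_act_zero)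
      ultimately show "y \<in> sphere n" using K_act_closed[OF x(1), of M] y by (auto simp: sphere_def)
    qed
  qed
  then show ?thesis by blast
qed

lemma inner_amenable_G: "inner_amenable G"
proof -
  define \<mu> where "\<mu> n X = real (card (X \<inter> sphere n)) / real (card (sphere n))" for n and X :: "'a set"
  have card: "0 < card (sphere n)" for n using sphere card_gt_0_iff by blast
  have bounds: "0 \<le> \<mu> n X \<and> \<mu> n X \<le> 1" for n X
    using card[of n] card_mono[OF sphere(1), of "X \<inter> sphere n" n] by (simp add: \<mu>_def)
  obtain m where "\<forall>Z. closed Z \<longrightarrow> (\<forall>\<^sub>F n in sequentially. \<mu> n \<in> Z) \<longrightarrow> m \<in> Z"
    using cluster_point[of \<mu>] bounds by blast
  then have m: "m \<in> Z" if "closed Z" "\<forall>\<^sub>F n in sequentially. \<mu> n \<in> Z" for Z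
    using that by blast
  have cont: "continuous_on UNIV (\<lambda>f. f X)" for X :: "'a set"
    by (rule continuous_on_product_coordinates)
  have nonneg: "0 \<le> m X" for X
    using m[of "{f. 0 \<le> f X}"] bounds by (simp add: closed_Collect_le cont)
  have total: "m (S - {\<one>}) = 1"
  proof -
    have "\<mu> n (S - {\<one>}) = 1" for n
      using sphere(3)[of n] card[of n] by (simp add: \<mu>_def Int_absorb1)
    then show ?thesis using m[of "{f. f (S - {\<one>}) = 1}"] by (simp add: closed_Collect_eq cont)
  qed
  have additive: "m (X \<union> Y) = m X + m Y" if "X \<inter> Y = {}" for X Y
  proof -
    have "\<mu> n (X \<union> Y) = \<mu> n X + \<mu> n Y" for n
    proof -
      have "card ((X \<union> Y) \<inter> sphere n) = card (X \<inter> sphere n) + card (Y \<inter> sphere n)"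
        unfolding Int_Un_distrib2 using that sphere(1) by (intro card_Un_disjoint) auto
      then show ?thesis by (simp add: \<mu>_def add_divide_distrib)
    qed
    then show ?thesis
      using m[of "{f. f (X \<union> Y) = f X + f Y}"] by (simp add: closed_Collect_eq cont continuous_on_add)
  qed
  have invariant: "m (conj g ` X) = m X" if g: "g \<in> S" and X: "X \<subseteq> S" for g X
  proof -
    obtain N where N: "\<And>n. n \<ge> N \<Longrightarrow> conj g ` sphere n = sphere n" using conj_sphere[OF g] by blast
    have inj: "inj_on (conj g) S" using bij_conj[OF g] by (simp add: bij_betw_def)
    have "\<mu> n (conj g ` X) = \<mu> n X" if "n \<ge> N" for n
    proof -
      have "conj g ` X \<inter> sphere n = conj g ` (X \<inter> sphere n)"
        using inj_on_image_Int[OF inj X, of "sphere n"] sphere(3)[of n] N[OF that] by auto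
      moreover have "inj_on (conj g) (X \<inter> sphere n)" using inj X by (auto intro: inj_on_subset)
      ultimately show ?thesis by (simp add: \<mu>_def card_image)
    qed
    \<comment> \<open>Invariance holds only from \<open>N\<close> on, which is enough for a cluster
      point.\<close>
    then have "\<forall>\<^sub>F n in sequentially. \<mu> n (conj g ` X) = \<mu> n X"
      by (auto simp: eventually_sequentially)
    then show ?thesis
      using m[of "{f. f (conj g ` X) = f X}"] by (simp add: closed_Collect_eq cont)
  qed
  have "X \<subseteq> S" if "X \<subseteq> S - {\<one>}" for X using that by auto
  then show ?thesis
    unfolding inner_amenable_def
    using nonneg total additive invariant
    by (intro conjI is_group countable_G exI[of _ m]) auto
qed

end

section \<open>Absence of property Gamma\<close>

text \<open>The added inequality is the contraction property, the one condition that the normalized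
  indicators of the spheres \<open>sphere n\<close> fail.\<close>

locale asymptotically_central = asymptotically_invariant +
  assumes convolution: "finite A \<Longrightarrow> A \<subseteq> carrier G \<Longrightarrow> finite H \<Longrightarrow> H \<subseteq> carrier G \<Longrightarrow>
    (\<Sum>h\<in>H. (cmod (\<Sum>l\<in>A. v l * \<xi> i (h \<otimes> inv l)))\<^sup>2) \<le> (\<Sum>l\<in>A. (cmod (v l))\<^sup>2)"
begin

fun k3 :: "(nat \<Rightarrow> int) \<times> (nat \<Rightarrow> int) \<times> (nat \<Rightarrow> int) \<Rightarrow> k_elem" where
  "k3 (u, v, w) = (\<lambda>n i. if i = 1 then u n else if i = 2 then v n else w n)"

definition \<kappa> :: "(nat \<Rightarrow> int) \<times> (nat \<Rightarrow> int) \<times> (nat \<Rightarrow> int) \<Rightarrow> 'a" where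
  "\<kappa> x = e (k3 x, mat 1)"

text \<open>The halves undo the factor 2 in \<open>defect\<close>, since
  \<open>mass_first_coordinate_le\<close> is stated with plain distances.\<close>

definition error :: "nat \<Rightarrow> real" where
  "error i = 12 * (2 * (defect (lam (elem 2 3)) i / 2) + 2 * (defect (lam (elem 3 2)) i / 2) +
     ((defect (lam (elem 2 1)) i / 2)\<^sup>2 + (defect (lam (elem 3 1)) i / 2)\<^sup>2) / 2)"

lemma lam_closed: "i \<noteq> j \<Longrightarrow> lam (elem i j) \<in> S"
  by (simp add: det_elem)

lemma error_tendsto: "error \<longlonglongrightarrow> 0"
proof -
  have d: "defect (lam (elem i j)) \<longlonglongrightarrow> 0" if "i \<noteq> j" for i j
    using that by (intro defect_tendsto lam_closed)
  have "(\<lambda>i. 12 * (2 * (defect (lam (elem 2 3)) i / 2) + 2 * (defect (lam (elem 3 2)) i / 2) +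
     ((defect (lam (elem 2 1)) i / 2)\<^sup>2 + (defect (lam (elem 3 1)) i / 2)\<^sup>2) / 2)) \<longlonglongrightarrow>
     12 * (2 * (0 / 2) + 2 * (0 / 2) + ((0 / 2)\<^sup>2 + (0 / 2)\<^sup>2) / 2)"
    by (intro tendsto_intros d) auto
  then show ?thesis by (simp add: error_def[abs_def])
qed

lemma conj_elem:
  assumes "i \<noteq> j" "x \<in> carrier K"
  shows "conj (lam (elem i j)) (e (x, mat 1)) = e (K_act p (elem i j) x, mat 1)"
proof -
  obtain M where "det M = 1" "M ** elem i j = mat 1" "elem i j ** M = mat 1"
    using SL3Z_inverse[OF det_elem[OF assms(1)]] by metis
  then show ?thesis using conj_lam[OF assms(2), of "mat 1" "elem i j" M] det_elem[OF assms(1)] by simp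
qed

lemma K_act_elem: "i \<noteq> j \<Longrightarrow> K_act p (elem i j) x n k =
    (x n k + (if k = i then x n j else 0)) mod int (p n)"
  using exhaust_3[of i] exhaust_3[of j] exhaust_3[of k] by (auto simp: K_act_apply elem_def sum_3 add.commute)

lemma mass_block:
  fixes N M :: nat
  defines "F \<equiv> finite_fourier.F p {N..<M}"
  shows "m i (\<kappa> ` ((F - {\<lambda>n. 0}) \<times> F \<times> F)) \<le> error i + (\<Sum>n=N..<M. 1 / (real (p n))\<^sup>2)"
proof -
  interpret ff: finite_fourier p "{N..<M}"
    by unfold_locales (use inj_p in \<open>auto intro: inj_on_subset\<close>)
  have F: "F = ff.F" by (simp add: F_def)
  have k3: "k3 x \<in> carrier K" if x3: "x \<in> ff.F3" for x
  proof -
    obtain u v w where x: "x = (u, v, w)" "u \<in> ff.F" "v \<in> ff.F" "w \<in> ff.F" using x3 by auto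
    have "{n. k3 x n \<noteq> (\<lambda>i. 0)} \<subseteq> {N..<M}" using x by (auto simp: ff.F_def)
    moreover have "0 \<le> a n \<and> a n < int (p n)" if "a \<in> ff.F" for a n
      using that by (cases "n \<in> {N..<M}") (auto simp: ff.F_def)
    ultimately show ?thesis using x finite_subset[OF _ finite_atLeastLessThan] by (auto simp: carrier_K)
  qed
  have \<kappa>_closed: "\<kappa> x \<in> S" if "x \<in> ff.F3" for x using k3[OF that] by (simp add: \<kappa>_def)
  have \<kappa>_inj: "inj_on \<kappa> ff.F3"
  proof (rule inj_onI)
    fix x y assume xy: "x \<in> ff.F3" "y \<in> ff.F3" "\<kappa> x = \<kappa> y"
    then have k: "k3 x = k3 y" using k3 by (simp add: \<kappa>_def e_eq_iff)
    obtain u v w u' v' w' where uvw: "x = (u, v, w)" "y = (u', v', w')" by (cases x; cases y)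
    show "x = y"
      using fun_cong[OF fun_cong[OF k], of _ 1] fun_cong[OF fun_cong[OF k], of _ 2]
        fun_cong[OF fun_cong[OF k], of _ 3] by (auto simp: uvw fun_eq_iff)
  qed
  let ?\<eta> = "\<lambda>x. \<xi> i (\<kappa> x)"
  have mass_\<kappa>: "mass ?\<eta> P = m i (\<kappa> ` P)" if "P \<subseteq> ff.F3" for P
    using \<kappa>_inj that by (intro mass_reindex[symmetric]) (rule inj_on_subset)
  have D: "mass (\<lambda>x. ?\<eta> (g x) - ?\<eta> x) ff.F3 \<le> (defect (lam (elem k l)) i / 2)\<^sup>2"
    if kl: "k \<noteq> l" and g: "\<And>x. x \<in> ff.F3 \<Longrightarrow> \<kappa> (g x) = conj (lam (elem k l)) (\<kappa> x)" for k l g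
  proof -
    let ?d = "\<lambda>x. \<xi> i (conj (lam (elem k l)) x) - \<xi> i x"
    note bij = bij_conj[OF lam_closed[OF kl]]
    have "(\<lambda>x. (cmod (\<xi> i (conj (lam (elem k l)) x)))\<^sup>2) summable_on S"
      using summable_on_reindex_bij_betw[OF bij, of "\<lambda>x. (cmod (\<xi> i x))\<^sup>2"] summable by simp
    then have sum: "(\<lambda>x. (cmod (?d x))\<^sup>2) summable_on S" using summable by (rule square_summable_diff)
    have "mass (\<lambda>x. ?\<eta> (g x) - ?\<eta> x) ff.F3 = mass (\<lambda>x. ?d (\<kappa> x)) ff.F3"
      by (rule infsum_cong) (simp add: g)
    also have "\<dots> = mass ?d (\<kappa> ` ff.F3)" by (rule mass_reindex[OF \<kappa>_inj, symmetric])
    also have "\<dots> \<le> mass ?d S" using sum \<kappa>_closed by (intro mass_mono) auto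
    also have "\<dots> = (defect (lam (elem k l)) i / 2)\<^sup>2" by (simp add: defect_def mass_nonneg)
    finally show ?thesis .
  qed
  have g: "\<kappa> (ff.g21 x) = conj (lam (elem 2 1)) (\<kappa> x)" "\<kappa> (ff.g31 x) = conj (lam (elem 3 1)) (\<kappa> x)"
    "\<kappa> (ff.g23 x) = conj (lam (elem 2 3)) (\<kappa> x)" "\<kappa> (ff.g32 x) = conj (lam (elem 3 2)) (\<kappa> x)"
    if "x \<in> ff.F3" for x
  proof -
    obtain u v w where x: "x = (u, v, w)" "u \<in> ff.F" "v \<in> ff.F" "w \<in> ff.F" using \<open>x \<in> ff.F3\<close> by auto
    have *: "\<kappa> y = conj (lam (elem k l)) (\<kappa> x)"
      if "k \<noteq> l" "\<And>n. \<forall>j. k3 y n j = (k3 x n j + (if j = k then k3 x n l else 0)) mod int (p n)" for y k l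
    proof -
      have "k3 y = K_act p (elem k l) (k3 x)"
        by (intro ext) (simp only: spec[OF that(2)] K_act_elem[OF that(1)])
      then show ?thesis
        unfolding \<kappa>_def conj_elem[OF that(1) k3[OF \<open>x \<in> ff.F3\<close>]] by (simp only:)
    qed
    show "\<kappa> (ff.g21 x) = conj (lam (elem 2 1)) (\<kappa> x)"
      by (rule *) (use x ff.F_mod in \<open>simp_all add: forall_3 ff.g21_def ff.add_def\<close>)
    show "\<kappa> (ff.g31 x) = conj (lam (elem 3 1)) (\<kappa> x)"
      by (rule *) (use x ff.F_mod in \<open>simp_all add: forall_3 ff.g31_def ff.add_def\<close>)
    show "\<kappa> (ff.g23 x) = conj (lam (elem 2 3)) (\<kappa> x)"
      by (rule *) (use x ff.F_mod in \<open>simp_all add: forall_3 ff.g23_def ff.add_def\<close>)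
    show "\<kappa> (ff.g32 x) = conj (lam (elem 3 2)) (\<kappa> x)"
      by (rule *) (use x ff.F_mod in \<open>simp_all add: forall_3 ff.g32_def ff.add_def\<close>)
  qed
  \<comment> \<open>The convolution inequality is applied to the normalized character (y, z), placed
    on the inverses of the block elements with first coordinate zero. Its result at (u, v, w) has
    the modulus of the transform at (u, y, z) whatever (v, w) is, so each u is counted
    \<open>(card F)\<^sup>2\<close> times.\<close>
  have slice: "real ((card ff.F)\<^sup>2) * (\<Sum>u\<in>ff.F. (cmod (ff.ft ?\<eta> (u, y, z)))\<^sup>2) \<le> 1"
    if yz: "y \<in> ff.F" "z \<in> ff.F" for y z
  proof -
    let ?F2 = "ff.F \<times> ff.F" and ?O = "(\<lambda>n. 0) :: nat \<Rightarrow> int"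
    define h where "h = (\<lambda>(v, w). inv (\<kappa> (?O, v, w)))"
    define d where "d = (\<lambda>(v, w). ff.ch y v * ff.ch z w / of_nat (card ff.F))"
    have O: "(?O, a) \<in> ff.F3" if "a \<in> ?F2" for a using that ff.zero_in_F by auto
    have h_inj: "inj_on h ?F2"
    proof (rule inj_onI)
      fix a b assume ab: "a \<in> ?F2" "b \<in> ?F2" "h a = h b"
      then have "\<kappa> (?O, a) = \<kappa> (?O, b)"
        using inv_inv[OF \<kappa>_closed[OF O[OF ab(1)]]] inv_inv[OF \<kappa>_closed[OF O[OF ab(2)]]]
        by (cases a; cases b) (simp add: h_def)
      then have "(?O, a) = (?O, b)" using inj_onD[OF \<kappa>_inj _ O[OF ab(1)] O[OF ab(2)]] by blast
      then show "a = b" by simp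
    qed
    have fin: "finite ?F2" using ff.finite_F by simp
    define c where "c l = d (the_inv_into ?F2 h l)" for l
    have c: "c (h a) = d a" if "a \<in> ?F2" for a using the_inv_into_f_f[OF h_inj that] by (simp add: c_def)
    have norm_d: "(cmod (d a))\<^sup>2 = 1 / (real (card ff.F))\<^sup>2" for a
      by (cases a) (simp add: d_def norm_mult norm_divide power_divide)
    have inner: "cmod (\<Sum>l\<in>h ` ?F2. c l * \<xi> i (\<kappa> (u, v, w) \<otimes> inv l)) = cmod (ff.ft ?\<eta> (u, y, z))"
      if uvw: "u \<in> ff.F" "v \<in> ff.F" "w \<in> ff.F" for u v w
    proof -
      have prod: "\<kappa> (u, v, w) \<otimes> \<kappa> (?O, v', w') = \<kappa> (u, ff.add v' v, ff.add w' w)"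
        if "v' \<in> ff.F" "w' \<in> ff.F" for v' w'
      proof -
        have "k3 (u, v, w) \<otimes>\<^bsub>K\<^esub> k3 (?O, v', w') = k3 (u, ff.add v' v, ff.add w' w)"
          using ff.F_mod uvw by (intro ext) (auto simp: mult_K ff.add_def add.commute)
        then show ?thesis
          using k3[of "(u, v, w)"] k3[of "(?O, v', w')"] uvw that ff.zero_in_F
          by (simp add: \<kappa>_def e_mult K_act_one)
      qed
      let ?s = "\<Sum>l\<in>h ` ?F2. c l * \<xi> i (\<kappa> (u, v, w) \<otimes> inv l)"
      have "?s = (\<Sum>a\<in>?F2. d a * \<xi> i (\<kappa> (u, v, w) \<otimes> inv (h a)))"
        by (simp add: sum.reindex[OF h_inj] c)
      also have "\<dots> = (\<Sum>(v', w')\<in>?F2. d (v', w') * ?\<eta> (u, ff.add v' v, ff.add w' w))"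
      proof (rule sum.cong[OF refl])
        fix a assume "a \<in> ?F2"
        then obtain v' w' where a: "a = (v', w')" "v' \<in> ff.F" "w' \<in> ff.F" by auto
        then have "inv (h a) = \<kappa> (?O, v', w')" using \<kappa>_closed[OF O, of a] by (simp add: h_def)
        then show "d a * \<xi> i (\<kappa> (u, v, w) \<otimes> inv (h a)) =
            (case a of (v', w') \<Rightarrow> d (v', w') * ?\<eta> (u, ff.add v' v, ff.add w' w))"
          using a prod by simp
      qed
      also have "\<dots> = (\<Sum>v'\<in>ff.F. \<Sum>w'\<in>ff.F. d (v', w') * ?\<eta> (u, ff.add v' v, ff.add w' w))"
        by (rule sum.cartesian_product[symmetric])
      finally have s: "?s = (\<Sum>v'\<in>ff.F. \<Sum>w'\<in>ff.F. d (v', w') * ?\<eta> (u, ff.add v' v, ff.add w' w))" .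
      \<comment> \<open>The phase at (v, w), of modulus one, aligns the character with the shifted
        argument, after which the shift can be summed away.\<close>
      have "?s * (ff.ch y v * ff.ch z w) = (\<Sum>v'\<in>ff.F. \<Sum>w'\<in>ff.F.
          d (ff.add v' v, ff.add w' w) * ?\<eta> (u, ff.add v' v, ff.add w' w))"
        unfolding s sum_distrib_right
        by (intro sum.cong refl) (simp add: d_def ff.ch_add_right)
      also have "\<dots> = (\<Sum>v'\<in>ff.F. \<Sum>w'\<in>ff.F. d (v', w') * ?\<eta> (u, v', w'))"
        unfolding ff.sum_shift[OF uvw(3), of "\<lambda>w'. d (_, w') * ?\<eta> (u, _, w')"]
        by (rule ff.sum_shift[OF uvw(2), of "\<lambda>v'. \<Sum>w'\<in>ff.F. d (v', w') * ?\<eta> (u, v', w')"])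
      also have "\<dots> = ff.ft ?\<eta> (u, y, z)"
        by (simp add: ff.ft_def d_def sum_divide_distrib ac_simps)
      finally have "cmod (?s * (ff.ch y v * ff.ch z w)) = cmod (ff.ft ?\<eta> (u, y, z))" by simp
      then show ?thesis by (simp add: norm_mult)
    qed
    have "real ((card ff.F)\<^sup>2) * (\<Sum>u\<in>ff.F. (cmod (ff.ft ?\<eta> (u, y, z)))\<^sup>2) =
        (\<Sum>u\<in>ff.F. \<Sum>a\<in>?F2. (cmod (ff.ft ?\<eta> (u, y, z)))\<^sup>2)"
      by (simp add: sum_distrib_left card_cartesian_product power2_eq_square)
    also have "\<dots> = (\<Sum>x\<in>ff.F3. (cmod (ff.ft ?\<eta> (fst x, y, z)))\<^sup>2)"
      by (subst sum.cartesian_product) (simp add: split_beta)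
    also have "\<dots> = (\<Sum>x\<in>ff.F3. (cmod (\<Sum>l\<in>h ` ?F2. c l * \<xi> i (\<kappa> x \<otimes> inv l)))\<^sup>2)"
      by (rule sum.cong) (auto simp: inner)
    also have "\<dots> = (\<Sum>g\<in>\<kappa> ` ff.F3. (cmod (\<Sum>l\<in>h ` ?F2. c l * \<xi> i (g \<otimes> inv l)))\<^sup>2)"
      by (simp add: sum.reindex[OF \<kappa>_inj])
    also have "\<dots> \<le> (\<Sum>l\<in>h ` ?F2. (cmod (c l))\<^sup>2)"
      using fin ff.finite_F3 \<kappa>_closed O by (intro convolution) (auto simp: h_def)
    also have "\<dots> = (\<Sum>a\<in>?F2. 1 / (real (card ff.F))\<^sup>2)"
      unfolding sum.reindex[OF h_inj] by (rule sum.cong) (simp_all add: c norm_d)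
    also have "\<dots> = 1" using ff.card_F by (simp add: card_cartesian_product power2_eq_square)
    finally show ?thesis .
  qed
  have "mass ?\<eta> ff.F3 \<le> 1"
    unfolding mass_\<kappa>[OF order_refl] using mass_mono[OF summable, of "\<kappa> ` ff.F3"] \<kappa>_closed mass_le[of i]
    by (meson image_subsetI order_trans)
  then have "mass ?\<eta> ((ff.F - {\<lambda>n. 0}) \<times> ff.F \<times> ff.F) \<le> error i + (\<Sum>n=N..<M. 1 / (real (p n))\<^sup>2)"
    unfolding error_def
    by (rule ff.mass_first_coordinate_le[OF _ slice D[OF _ g(1)] D[OF _ g(2)] D[OF _ g(3)] D[OF _ g(4)]])
      (auto simp: defect_nonneg)
  then show ?thesis unfolding F by (subst mass_\<kappa>[symmetric]) auto
qed

section \<open>From finite blocks to whole tails\<close>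

definition tail1 :: "nat \<Rightarrow> 'a set" where
  "tail1 N = (\<lambda>x. e (x, mat 1)) ` {x \<in> T N. \<exists>n. x n 1 \<noteq> 0}"

abbreviation "rest N \<equiv> \<Sum>n. 1 / (real (p (n + N)))\<^sup>2"

text \<open>Since \<open>p\<close> is injective, this is a rearranged part of the series of inverse
  squares of all natural numbers.\<close>

lemma summable_squares: "Series.summable (\<lambda>n. 1 / (real (p n))\<^sup>2)"
proof -
  have "(\<lambda>n. 1 / (real n)\<^sup>2) summable_on UNIV"
    using inverse_power_summable[of 2, where 'a = real]
    by (subst summable_on_UNIV_nonneg_real_iff) (auto simp: inverse_eq_divide)
  then have "(\<lambda>n. 1 / (real n)\<^sup>2) summable_on range p" by (rule summable_on_subset_banach) simp
  then have "(\<lambda>n. 1 / (real (p n))\<^sup>2) summable_on UNIV"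
    using summable_on_reindex[OF inj_p, of "\<lambda>n. 1 / (real n)\<^sup>2"] by (simp add: comp_def)
  then show ?thesis by (rule summable_on_imp_summable)
qed

text \<open>Finitely many elements of a tail live on one block, and the block bound is uniform in
  the right end of the block.\<close>

lemma mass_tail1: "m i (tail1 N) \<le> error i + rest N"
proof (rule infsum_le_finite_sums)
  have sub: "tail1 N \<subseteq> S" by (auto simp: tail1_def K_tail_iff)
  then show "(\<lambda>x. (cmod (\<xi> i x))\<^sup>2) summable_on tail1 N" by (rule summable_on_subset_banach[OF summable])
  fix P assume P: "finite P" "P \<subseteq> tail1 N"
  then obtain Q where Q: "finite Q" "Q \<subseteq> {x \<in> T N. \<exists>n. x n 1 \<noteq> 0}" "P = (\<lambda>x. e (x, mat 1)) ` Q"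
    unfolding tail1_def by (meson finite_subset_image)
  have "finite (\<Union>x\<in>Q. {n. x n \<noteq> (\<lambda>i. 0)})"
    using Q by (auto simp: K_tail_iff carrier_K)
  then obtain M where M: "\<And>x n. x \<in> Q \<Longrightarrow> x n \<noteq> (\<lambda>i. 0) \<Longrightarrow> n < M"
    unfolding finite_nat_set_iff_bounded by blast
  interpret ff: finite_fourier p "{N..<M}"
    by unfold_locales (use inj_p in \<open>auto intro: inj_on_subset\<close>)
  let ?Z = "(ff.F - {\<lambda>n. 0}) \<times> ff.F \<times> ff.F"
  have "P \<subseteq> \<kappa> ` ?Z"
  proof
    fix g assume "g \<in> P"
    then obtain x where x: "x \<in> Q" "g = e (x, mat 1)" using Q by auto
    then have xT: "x \<in> T N" "\<exists>n. x n 1 \<noteq> 0" using Q by auto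
    have F: "(\<lambda>n. x n k) \<in> ff.F" for k
    proof -
      have "x n k = 0" if "n \<notin> {N..<M}" for n
      proof (cases "n < N")
        case True
        then show ?thesis using xT by (simp add: K_tail_iff)
      next
        case False
        then have "x n = (\<lambda>i. 0)" using M[OF x(1), of n] that by fastforce
        then show ?thesis by simp
      qed
      then show ?thesis using xT by (auto simp: ff.F_def K_tail_iff carrier_K)
    qed
    have three: "k = 3" if "k \<noteq> 1" "k \<noteq> 2" for k :: 3 using exhaust_3[of k] that by auto
    have "g = \<kappa> (\<lambda>n. x n 1, \<lambda>n. x n 2, \<lambda>n. x n 3)"
      unfolding \<kappa>_def x(2) using three by (auto simp: fun_eq_iff intro!: arg_cong[of _ _ e])
    moreover have "(\<lambda>n. x n 1, \<lambda>n. x n 2, \<lambda>n. x n 3) \<in> ?Z" using F xT(2) by (auto simp: fun_eq_iff)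
    ultimately show "g \<in> \<kappa> ` ?Z" by blast
  qed
  moreover have fin: "finite (\<kappa> ` ?Z)" using ff.finite_F by auto
  ultimately have "(\<Sum>x\<in>P. (cmod (\<xi> i x))\<^sup>2) \<le> m i (\<kappa> ` ?Z)"
    unfolding infsum_finite[OF fin] by (intro sum_mono2) auto
  also have "\<dots> \<le> error i + (\<Sum>n=N..<M. 1 / (real (p n))\<^sup>2)" by (rule mass_block)
  also have "(\<Sum>n=N..<M. 1 / (real (p n))\<^sup>2) \<le> rest N"
  proof -
    have "(\<Sum>n=N..<M. 1 / (real (p n))\<^sup>2) = (\<Sum>n<M - N. 1 / (real (p (n + N)))\<^sup>2)"
      by (rule sum.reindex_bij_witness[of _ "\<lambda>n. n + N" "\<lambda>n. n - N"]) auto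
    also have "\<dots> \<le> rest N"
      using summable_ignore_initial_segment[OF summable_squares, of N] by (intro sum_le_suminf) auto
    finally show ?thesis .
  qed
  finally show "(\<Sum>x\<in>P. (cmod (\<xi> i x))\<^sup>2) \<le> error i + rest N" by simp
qed

text \<open>
  A vector with vanishing first but nonvanishing \<open>j\<close>-th coordinate is moved by \<open>elem 1 j\<close> to one with
  nonvanishing first coordinate.
\<close>

lemma mass_tail:
  "m i ((\<lambda>x. e (x, mat 1)) ` (T N - {zero_K})) \<le>
    3 * (error i + rest N) + defect (lam (elem 1 2)) i + defect (lam (elem 1 3)) i"
proof -
  define Pj where "Pj j = (\<lambda>x. e (x, mat 1)) ` {x \<in> T N. (\<forall>n. x n 1 = 0) \<and> (\<exists>n. x n j \<noteq> 0)}" for j :: 3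
  have PS: "Pj j \<subseteq> S" for j by (auto simp: Pj_def K_tail_iff)
  have tS: "tail1 N \<subseteq> S" by (auto simp: tail1_def K_tail_iff)
  have m_mono: "m i P \<le> m i Q" if "P \<subseteq> Q" "Q \<subseteq> S" for P Q
    using that summable_on_subset_banach[OF summable] by (intro mass_mono)
  have subadd: "m i (P \<union> Q) \<le> m i P + m i Q" if "P \<subseteq> S" "Q \<subseteq> S" for P Q
  proof -
    have "m i (P \<union> (Q - P)) = m i P + m i (Q - P)" using that by (intro mass_union[OF summable]) auto
    moreover have "m i (Q - P) \<le> m i Q" using that by (intro m_mono) auto
    ultimately show ?thesis by simp
  qed
  have Pj: "m i (Pj j) \<le> error i + rest N + defect (lam (elem 1 j)) i" if j: "1 \<noteq> j" for j
  proof -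
    have "conj (lam (elem 1 j)) ` Pj j \<subseteq> tail1 N"
    proof
      fix g assume "g \<in> conj (lam (elem 1 j)) ` Pj j"
      then obtain x n where x: "x \<in> T N" "\<forall>n. x n 1 = 0" "x n j \<noteq> 0"
        "g = conj (lam (elem 1 j)) (e (x, mat 1))" by (auto simp: Pj_def)
      then have xK: "x \<in> carrier K" by (simp add: K_tail_iff)
      have "K_act p (elem 1 j) x n 1 = x n j"
        using x xK j by (simp add: K_act_elem carrier_K)
      then have "K_act p (elem 1 j) x \<in> {x \<in> T N. \<exists>n. x n 1 \<noteq> 0}"
        using x(3) K_act_tail[OF x(1)] by (intro CollectI conjI exI[of _ n]) simp_all
      then show "g \<in> tail1 N"
        unfolding tail1_def x(4) conj_elem[OF j xK] by (rule imageI)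
    qed
    then have "m i (conj (lam (elem 1 j)) ` Pj j) \<le> m i (tail1 N)" using tS by (intro m_mono)
    then show ?thesis using m_conj[OF lam_closed[OF j] PS, of i j] mass_tail1[of i N] by linarith
  qed
  have "(\<lambda>x. e (x, mat 1)) ` (T N - {zero_K}) \<subseteq> tail1 N \<union> (Pj 2 \<union> Pj 3)"
  proof
    fix g assume "g \<in> (\<lambda>x. e (x, mat 1)) ` (T N - {zero_K})"
    then obtain x where x: "x \<in> T N" "x \<noteq> zero_K" "g = e (x, mat 1)" by auto
    then obtain n k where "x n k \<noteq> 0" by (auto simp: fun_eq_iff)
    then show "g \<in> tail1 N \<union> (Pj 2 \<union> Pj 3)"
      using x exhaust_3[of k] unfolding tail1_def Pj_def by blast
  qed
  then have "m i ((\<lambda>x. e (x, mat 1)) ` (T N - {zero_K})) \<le> m i (tail1 N \<union> (Pj 2 \<union> Pj 3))"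
    using tS PS by (intro m_mono) auto
  also have "\<dots> \<le> m i (tail1 N) + (m i (Pj 2) + m i (Pj 3))"
    using subadd[OF tS, of "Pj 2 \<union> Pj 3"] subadd[OF PS PS, of 2 3] PS by auto
  also have "\<dots> \<le> (error i + rest N) + ((error i + rest N + defect (lam (elem 1 2)) i) +
      (error i + rest N + defect (lam (elem 1 3)) i))"
    by (intro add_mono mass_tail1 Pj) auto
  finally show ?thesis by simp
qed

lemma no_central_unit_vectors:
  assumes "\<And>i. m i S = 1" "\<And>i. \<xi> i \<one> = 0"
  shows False
proof -
  \<comment> \<open>The bound of \<open>mass_tail\<close> contains \<open>rest N\<close> three
    times, once per coordinate, so 1/3 brings the limit below 1.\<close>
  obtain N where "norm (rest N) < 1/3"
    using suminf_exist_split[OF _ summable_squares, of "1/3"] by auto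
  then have N: "rest N < 1/3" by simp
  let ?T = "(\<lambda>x. e (x, mat 1)) ` T N" and ?T' = "(\<lambda>x. e (x, mat 1)) ` (T N - {zero_K})"
  let ?c = "\<lambda>i. m i (S - ?T) + (3 * (error i + rest N) + defect (lam (elem 1 2)) i + defect (lam (elem 1 3)) i)"
  have "1 \<le> ?c i" for i
  proof -
    have TS: "?T \<subseteq> S" by (auto simp: K_tail_iff)
    have T: "?T = ?T' \<union> {\<one>}"
    proof -
      have "T N = (T N - {zero_K}) \<union> {zero_K}" by auto
      then have "?T = (\<lambda>x. e (x, mat 1)) ` ((T N - {zero_K}) \<union> {zero_K})" by (rule arg_cong)
      then show ?thesis unfolding image_Un by (simp add: e_one)
    qed
    have "\<one> \<notin> ?T'"
    proof
      assume "\<one> \<in> ?T'"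
      then obtain x where x: "\<one> = e (x, mat 1)" "x \<in> T N - {zero_K}" by (rule imageE)
      then have "e (x, mat 1) = e (zero_K, mat 1)" using e_one by simp
      then show False using x(2) e_eq_iff[of x zero_K "mat 1" "mat 1"] by (simp add: K_tail_iff)
    qed
    then have "?T' \<inter> {\<one>} = {}" by simp
    moreover have "\<xi> i x = 0" if "x \<in> {\<one>}" for x using that assms by simp
    ultimately have "m i ?T = m i ?T'"
      unfolding T using TS by (subst mass_union[OF summable]) (auto simp: T assms)
    moreover have "m i ((S - ?T) \<union> ?T) = m i (S - ?T) + m i ?T"
      using TS by (intro mass_union[OF summable]) auto
    moreover have "(S - ?T) \<union> ?T = S" using TS by auto
    ultimately show ?thesis using mass_tail[of i N] assms(1)[of i] by simp
  qed
  moreover have "?c \<longlonglongrightarrow> 0 + (3 * (0 + rest N) + 0 + 0)"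
    using null_outside_tail[of N] unfolding null_def
    by (intro tendsto_intros error_tendsto defect_tendsto lam_closed) auto
  ultimately have "1 \<le> 0 + (3 * (0 + rest N) + 0 + 0)"
    by (intro tendsto_lowerbound[of ?c _ sequentially 1]) auto
  then show False using N by simp
qed

end

text \<open>For the vectors of a central sequence, unitarity gives norm one and the convolution
  bound, trace zero gives vanishing at the identity, and commutation with the translations gives
  asymptotic invariance.\<close>

lemma (in vaes_group) not_property_Gamma: "\<not> property_Gamma S LG \<tau>"
proof
  assume "property_Gamma S LG \<tau>"
  then obtain x where x: "\<And>n. x n \<in> LG" "\<And>n. unitary_op S (x n)" "\<And>n. \<tau> (x n) = 0"
    and comm: "\<And>y. y \<in> LG \<Longrightarrow>
      (\<lambda>n. trace_norm2 S \<tau> (op_diff S (op_mult S (x n) y) (op_mult S y (x n)))) \<longlonglongrightarrow> 0"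
    unfolding property_Gamma_def by blast
  have d: "l2_delta \<one> \<in> l2 S" by (simp add: l2_delta)
  have \<xi>: "x n (l2_delta \<one>) \<in> l2 S" "mass (x n (l2_delta \<one>)) S = 1" for n
    using bounded_opersD(2)[OF LG_bounded[OF x(1)] d] unitary_norm[OF LG_bounded[OF x(1)] x(2) d]
    by (simp_all add: l2_delta(2) flip: l2_norm_sq)
  interpret asymptotically_central p G e t \<phi> "\<lambda>n. x n (l2_delta \<one>)"
  proof unfold_locales
    show "(\<lambda>h. (cmod (x n (l2_delta \<one>) h))\<^sup>2) summable_on S" for n by (rule l2_summable[OF \<xi>(1)])
    show "mass (x n (l2_delta \<one>)) S \<le> 1" for n by (simp add: \<xi>)
    show "(\<lambda>n. sqrt (mass (\<lambda>h. x n (l2_delta \<one>) (conj g h) - x n (l2_delta \<one>) h) S)) \<longlonglongrightarrow> 0"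
      if "g \<in> S" for g
      using comm[OF LG(2)[OF that]] by (simp add: trace_norm2_commutator[OF x(1) that])
  qed (rule unitary_convolution[OF x(1,2)])
  show False by (rule no_central_unit_vectors) (use \<xi> x(3) trace_eq in auto)
qed

theorem theorem1:
  fixes p :: "nat \<Rightarrow> nat"
  assumes "\<forall>n. prime (p n)" and "inj p"
  shows "inner_amenable (G_group p) \<and>
    icc (G_group p) \<and>
    II1_factor (carrier (G_group p)) (group_vna (G_group p)) (group_trace (G_group p)) \<and>
    \<not> property_Gamma (carrier (G_group p)) (group_vna (G_group p)) (group_trace (G_group p))"
proof -
  interpret prime_seq p by unfold_locales (use assms(1) in blast)
  interpret vaes_group p "G_group p" limit_e limit_t limit_\<phi>
    using assms(2) by (rule vaes_group)
  show ?thesis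
    using inner_amenable_G icc_G II1_factor_LG[OF icc_G infinite_G] not_property_Gamma by blast
qed

end
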